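(* For any lamination $\mathcal{L}$ in $\mathcal{C}_\pi^\psi$, the set $h(\mathcal{L})$ of all $h(X)$ with $X\in\mathcal{L}$ is a closed subset of $\mathcal{H}$.
   Context: **The categories.** $R$ is a discrete valuation ring with uniformizer $u$ and residue field $K=R/(u)$ of characteristic $\neq2$. For $0<b\le\pi$ let $\tilde{\mathcal{X}}_b=\{(x,y,\epsilon)\in\mathbb{R}\times\mathbb{R}\times\{+,-\}: |x-y|\le b\}$, with $(x,y,\epsilon)\le(x',y',\epsilon')$ iff $x\le x'$ and $y\le y'$, and automorphism $\sigma(x,y,\epsilon)=(y+\pi,x+\pi,-\epsilon)$. Let $\mathcal{X}_b$ be the set of $\sigma$-orbits, $M(x,y)$ the orbit of $(x,y,+)$ and $M(x,y)'$ the orbit of $(x,y,-)$; thus $M(x,y)'=M(y+\pi,x+\pi)$ and $M(x+2\pi,y+2\pi)=M(x,y)$. For $X,Y,Z\in\mathcal{X}_b$ with representatives $\tilde X,\tilde Y,\tilde Z$ put $c(X,Y,Z)=i+j-k$ where $i,j,k$ are the minimal integers with $\tilde X\le\sigma^i\tilde Y$, $\tilde Y\le\sigma^j\tilde Z$, $\tilde X\le\sigma^k\tilde Z$. Let $\mathcal{F}_b$ be the additive $R$-category of finite direct sums of elements of $\mathcal{X}_b$, where $\mathrm{Hom}(X,Y)=Rf_{XY}$ is free of rank one for $X,Y\in\mathcal{X}_b$ ($f_{XY}$ is the basic morphism), $f_{XX}=\mathrm{id}$ and $f_{YZ}f_{XY}=u^{c(X,Y,Z)}f_{XZ}$. It is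 known that $\mathcal{F}_b$ has a unique exact structure making it a Frobenius category whose indecomposable projective-injectives are the $M(x,y)$ with $|x-y|=b$. Let $\psi$ be the $R$-linear involution of $\mathcal{F}_b$ with $\psi M(x,y)=M(x+\pi,y+\pi)$ and $\psi f_{XY}=f_{\psi X,\psi Y}$. Let $\mathcal{F}_b^\psi$ have objects $(X,\xi)$, $\xi:\psi X\to X$ an isomorphism with $\xi\circ\psi\xi=\mathrm{id}$, morphisms $(X,\xi^X)\to(Y,\xi^Y)$ the $f:X\to Y$ with $f\xi^X=\xi^Y\psi f$, and exact sequences those exact in $\mathcal{F}_b$. It is a Frobenius category; its stable category, a triangulated category with shift $[1]$, is $\mathcal{C}_b^\psi$, and $\mathrm{Ext}^1(A,B)=\mathcal{C}_b^\psi(A,B[1])$. **Objects.** $SX=(X\oplus\psi X,\xi)$ with $\xi$ the swap of summands; $E(x,y)=M(x,y-\pi)$; $Z_\epsilon(x)=(M(x,x),\epsilon\zeta)$ for $\epsilon=\pm$, with $\zeta:\psi M(x,x)\to M(x,x)$ the basic isomorphism. The nonzero indecomposable objects of $\mathcal{C}_b^\psi$ are, up to isomorphism, the regular objects $SM(x,y)$ with $0<|x-y|<b$ and the singular objects $Z_\epsilon(x)$. **Compatibility and laminations.** For $0<b<\pi$, objects $X,Y$ of $\mathcal{C}_b^\psi$ are compatible if $\mathrm{Ext}^1(X,Y)=0=\mathrm{Ext}^1(Y,X)$. Two indecomposable objects of $\mathcal{C}_\pi^\psi$ are compatible if the objects of $\mathcal{C}_b^\psi$ with the same names ($SM(x,y)$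 or $Z_\epsilon(x)$) are compatible for all $b<\pi$ sufficiently close to $\pi$. A lamination in $\mathcal{C}_\pi^\psi$ is a maximal set of pairwise compatible nonisomorphic indecomposable objects. **The space $\mathcal{H}$.** $\mathcal{H}=\tilde{\mathcal{H}}/\sim$ with the quotient topology, where $\tilde{\mathcal{H}}=\{(x,y,\epsilon)\in\mathbb{R}^2\times\{+,-\}: x<y\le x+\pi\}$ and $\sim$ is generated by $(x,y,+)\sim(x,y,-)$ if $y<x+\pi$, and $(x,y,\epsilon)\sim(x+\pi,y+\pi,\epsilon)$ for all $x,y,\epsilon$. The class of $(x,y,\epsilon)$ is $[x,y]_\epsilon$ (written $[x,y]$ when $y<x+\pi$). For indecomposable objects of $\mathcal{C}_\pi^\psi$ define $h(SE(x,y))=[x,y]$ if $x<y<x+\pi$, $h(SE(x,y))=[y,x+2\pi]$ if $x+\pi<y<x+2\pi$, and $h(Z_\epsilon(x))=[x,x+\pi]_\epsilon$; $h$ is a bijection from isomorphism classes of indecomposable objects of $\mathcal{C}_\pi^\psi$ to $\mathcal{H}$. *)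

theory Defs
  imports "HOL-Analysis.Product_Topology" "Jordan_Normal_Form.Matrix"
begin

section \<open>Discrete valuation rings\<close>

definition is_ring_ideal :: "'r::comm_ring_1 set \<Rightarrow> bool" where
  "is_ring_ideal I \<longleftrightarrow> 0 \<in> I \<and> (\<forall>a\<in>I. \<forall>b\<in>I. a + b \<in> I) \<and> (\<forall>a\<in>I. \<forall>r. r * a \<in> I)"

definition is_maximal_ideal :: "'r::comm_ring_1 set \<Rightarrow> bool" where
  "is_maximal_ideal I \<longleftrightarrow> is_ring_ideal I \<and> I \<noteq> UNIV \<and>
     (\<forall>J. is_ring_ideal J \<and> I \<subseteq> J \<longrightarrow> J = I \<or> J = UNIV)"

definition principal_ideal :: "'r::comm_ring_1 \<Rightarrow> 'r set" where
  "principal_ideal a = range (\<lambda>r. r * a)"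

text \<open>The type \<open>'r\<close> is a discrete valuation ring with uniformizer \<open>u\<close>: it is a local principal
  ideal domain whose maximal ideal is \<open>(u)\<close>, and \<open>u \<noteq> 0\<close> says that it is not a field.\<close>

definition dvr_with_uniformizer :: "'r::idom \<Rightarrow> bool" where
  "dvr_with_uniformizer u \<longleftrightarrow>
     (\<forall>I::'r set. is_ring_ideal I \<longrightarrow> (\<exists>a. I = principal_ideal a)) \<and>
     (\<exists>!I::'r set. is_maximal_ideal I) \<and>
     is_maximal_ideal (principal_ideal u) \<and> u \<noteq> 0"

text \<open>The characteristic of the residue ring by \<open>(u)\<close>: the nonnegative generator of the kernel of
  the map from the integers to it (compare the definition of \<open>CHAR\<close>).\<close>

definition residue_char :: "'r::idom \<Rightarrow> nat" where
  "residue_char u = Gcd {n. of_nat n \<in> principal_ideal u}"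


section \<open>Preadditive categories\<close>

record ('o, 'a) precat =
  Ob :: "'o set"
  Arr :: "'a set"
  Dom :: "'a \<Rightarrow> 'o"
  Cod :: "'a \<Rightarrow> 'o"
  Id :: "'o \<Rightarrow> 'a"
  Cmp :: "'a \<Rightarrow> 'a \<Rightarrow> 'a"
  Add :: "'a \<Rightarrow> 'a \<Rightarrow> 'a"
  Zer :: "'o \<Rightarrow> 'o \<Rightarrow> 'a"

text \<open>\<open>Cmp C g f\<close> is the composite of \<open>f\<close> followed by \<open>g\<close>.\<close>

definition homs :: "('o, 'a) precat \<Rightarrow> 'o \<Rightarrow> 'o \<Rightarrow> 'a set" where
  "homs C X Y = {f \<in> Arr C. Dom C f = X \<and> Cod C f = Y}"

definition is_isomorphism :: "('o, 'a) precat \<Rightarrow> 'a \<Rightarrow> bool" where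
  "is_isomorphism C f \<longleftrightarrow> f \<in> Arr C \<and>
     (\<exists>g \<in> homs C (Cod C f) (Dom C f). Cmp C g f = Id C (Dom C f) \<and> Cmp C f g = Id C (Cod C f))"

definition isomorphic :: "('o, 'a) precat \<Rightarrow> 'o \<Rightarrow> 'o \<Rightarrow> bool" where
  "isomorphic C X Y \<longleftrightarrow> X \<in> Ob C \<and> Y \<in> Ob C \<and> (\<exists>f \<in> homs C X Y. is_isomorphism C f)"

definition zero_object :: "('o, 'a) precat \<Rightarrow> 'o \<Rightarrow> bool" where
  "zero_object C X \<longleftrightarrow> X \<in> Ob C \<and> Id C X = Zer C X X"

definition is_biproduct :: "('o, 'a) precat \<Rightarrow> 'o \<Rightarrow> 'o \<Rightarrow> 'o \<Rightarrow> bool" where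
  "is_biproduct C X A B \<longleftrightarrow> X \<in> Ob C \<and> A \<in> Ob C \<and> B \<in> Ob C \<and>
     (\<exists>iA \<in> homs C A X. \<exists>iB \<in> homs C B X. \<exists>pA \<in> homs C X A. \<exists>pB \<in> homs C X B.
        Cmp C pA iA = Id C A \<and> Cmp C pB iB = Id C B \<and>
        Cmp C pA iB = Zer C B A \<and> Cmp C pB iA = Zer C A B \<and>
        Add C (Cmp C iA pA) (Cmp C iB pB) = Id C X)"

definition indecomposable :: "('o, 'a) precat \<Rightarrow> 'o \<Rightarrow> bool" where
  "indecomposable C X \<longleftrightarrow> X \<in> Ob C \<and> \<not> zero_object C X \<and>
     (\<forall>A B. is_biproduct C X A B \<longrightarrow> zero_object C A \<or> zero_object C B)"


section \<open>Exact structures and Frobenius categories\<close>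

definition composable :: "('o, 'a) precat \<Rightarrow> 'a \<Rightarrow> 'a \<Rightarrow> bool" where
  "composable C g f \<longleftrightarrow> g \<in> Arr C \<and> f \<in> Arr C \<and> Cod C f = Dom C g"

definition kernel_cokernel_pair :: "('o, 'a) precat \<Rightarrow> 'a \<Rightarrow> 'a \<Rightarrow> bool" where
  "kernel_cokernel_pair C i p \<longleftrightarrow> composable C p i \<and> Cmp C p i = Zer C (Dom C i) (Cod C p) \<and>
     (\<forall>f \<in> Arr C. Cod C f = Dom C p \<and> Cmp C p f = Zer C (Dom C f) (Cod C p) \<longrightarrow>
        (\<exists>!g. g \<in> homs C (Dom C f) (Dom C i) \<and> Cmp C i g = f)) \<and>
     (\<forall>f \<in> Arr C. Dom C f = Cod C i \<and> Cmp C f i = Zer C (Dom C i) (Cod C f) \<longrightarrow>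
        (\<exists>!g. g \<in> homs C (Cod C p) (Cod C f) \<and> Cmp C g p = f))"

text \<open>Pushout squares: \<open>i' \<circ> f = f' \<circ> i\<close>, with \<open>i, f\<close> having common domain.\<close>

definition is_pushout :: "('o, 'a) precat \<Rightarrow> 'a \<Rightarrow> 'a \<Rightarrow> 'a \<Rightarrow> 'a \<Rightarrow> bool" where
  "is_pushout C i f i' f' \<longleftrightarrow>
     composable C i' f \<and> composable C f' i \<and> Dom C i = Dom C f \<and> Cod C i' = Cod C f' \<and>
     Cmp C i' f = Cmp C f' i \<and>
     (\<forall>a b. composable C a f \<and> composable C b i \<and> Cod C a = Cod C b \<and> Cmp C a f = Cmp C b i \<longrightarrow>
        (\<exists>!c. c \<in> homs C (Cod C i') (Cod C a) \<and> Cmp C c i' = a \<and> Cmp C c f' = b))"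

text \<open>Pullback squares: \<open>f \<circ> p' = p \<circ> f'\<close>, with \<open>p, f\<close> having common codomain.\<close>

definition is_pullback :: "('o, 'a) precat \<Rightarrow> 'a \<Rightarrow> 'a \<Rightarrow> 'a \<Rightarrow> 'a \<Rightarrow> bool" where
  "is_pullback C p f p' f' \<longleftrightarrow>
     composable C f p' \<and> composable C p f' \<and> Cod C p = Cod C f \<and> Dom C p' = Dom C f' \<and>
     Cmp C f p' = Cmp C p f' \<and>
     (\<forall>a b. composable C f a \<and> composable C p b \<and> Dom C a = Dom C b \<and> Cmp C f a = Cmp C p b \<longrightarrow>
        (\<exists>!c. c \<in> homs C (Dom C a) (Dom C p') \<and> Cmp C p' c = a \<and> Cmp C f' c = b))"

definition admissible_mono :: "('a \<times> 'a) set \<Rightarrow> 'a \<Rightarrow> bool" where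
  "admissible_mono E i \<longleftrightarrow> (\<exists>p. (i, p) \<in> E)"

definition admissible_epi :: "('a \<times> 'a) set \<Rightarrow> 'a \<Rightarrow> bool" where
  "admissible_epi E p \<longleftrightarrow> (\<exists>i. (i, p) \<in> E)"

text \<open>Exact structures in the sense of Quillen, given by the class \<open>E\<close> of short exact sequences
  \<open>(i, p)\<close>.\<close>

definition exact_structure :: "('o, 'a) precat \<Rightarrow> ('a \<times> 'a) set \<Rightarrow> bool" where
  "exact_structure C E \<longleftrightarrow>
     (\<forall>(i, p) \<in> E. kernel_cokernel_pair C i p) \<and>
     (\<forall>(i, p) \<in> E. \<forall>i' p' a b c.
        composable C p' i' \<and>
        is_isomorphism C a \<and> is_isomorphism C b \<and> is_isomorphism C c \<and>
        a \<in> homs C (Dom C i) (Dom C i') \<and> b \<in> homs C (Cod C i) (Cod C i') \<and>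
        c \<in> homs C (Cod C p) (Cod C p') \<and>
        Cmp C i' a = Cmp C b i \<and> Cmp C p' b = Cmp C c p \<longrightarrow> (i', p') \<in> E) \<and>
     (\<forall>X \<in> Ob C. admissible_mono E (Id C X) \<and> admissible_epi E (Id C X)) \<and>
     (\<forall>i j. admissible_mono E i \<and> admissible_mono E j \<and> composable C j i \<longrightarrow>
        admissible_mono E (Cmp C j i)) \<and>
     (\<forall>p q. admissible_epi E p \<and> admissible_epi E q \<and> composable C q p \<longrightarrow>
        admissible_epi E (Cmp C q p)) \<and>
     (\<forall>i f. admissible_mono E i \<and> f \<in> Arr C \<and> Dom C f = Dom C i \<longrightarrow>
        (\<exists>i' f'. is_pushout C i f i' f' \<and> admissible_mono E i')) \<and>
     (\<forall>p f. admissible_epi E p \<and> f \<in> Arr C \<and> Cod C f = Cod C p \<longrightarrow>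
        (\<exists>p' f'. is_pullback C p f p' f' \<and> admissible_epi E p'))"

definition is_projective :: "('o, 'a) precat \<Rightarrow> ('a \<times> 'a) set \<Rightarrow> 'o \<Rightarrow> bool" where
  "is_projective C E P \<longleftrightarrow> P \<in> Ob C \<and>
     (\<forall>p f. admissible_epi E p \<and> f \<in> homs C P (Cod C p) \<longrightarrow>
        (\<exists>g \<in> homs C P (Dom C p). Cmp C p g = f))"

definition is_injective :: "('o, 'a) precat \<Rightarrow> ('a \<times> 'a) set \<Rightarrow> 'o \<Rightarrow> bool" where
  "is_injective C E P \<longleftrightarrow> P \<in> Ob C \<and>
     (\<forall>i f. admissible_mono E i \<and> f \<in> homs C (Dom C i) P \<longrightarrow>
        (\<exists>g \<in> homs C (Cod C i) P. Cmp C g i = f))"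

definition projective_injective :: "('o, 'a) precat \<Rightarrow> ('a \<times> 'a) set \<Rightarrow> 'o \<Rightarrow> bool" where
  "projective_injective C E P \<longleftrightarrow> is_projective C E P \<and> is_injective C E P"

definition frobenius_structure :: "('o, 'a) precat \<Rightarrow> ('a \<times> 'a) set \<Rightarrow> bool" where
  "frobenius_structure C E \<longleftrightarrow> exact_structure C E \<and>
     (\<forall>X \<in> Ob C. \<exists>(i, p) \<in> E. Cod C p = X \<and> is_projective C E (Dom C p)) \<and>
     (\<forall>X \<in> Ob C. \<exists>(i, p) \<in> E. Dom C i = X \<and> is_injective C E (Cod C i)) \<and>
     (\<forall>X. is_projective C E X \<longleftrightarrow> is_injective C E X)"


section \<open>Stable categories and extensions\<close>

definition factors_through_proj_inj :: "('o, 'a) precat \<Rightarrow> ('a \<times> 'a) set \<Rightarrow> 'a \<Rightarrow> bool" where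
  "factors_through_proj_inj C E f \<longleftrightarrow>
     (\<exists>g h. composable C h g \<and> projective_injective C E (Cod C g) \<and> f = Cmp C h g)"

definition stable_class :: "('o, 'a) precat \<Rightarrow> ('a \<times> 'a) set \<Rightarrow> 'a \<Rightarrow> 'a set" where
  "stable_class C E f = {g. \<exists>h \<in> homs C (Dom C f) (Cod C f).
     factors_through_proj_inj C E h \<and> g = Add C f h}"

definition stable_category :: "('o, 'a) precat \<Rightarrow> ('a \<times> 'a) set \<Rightarrow> ('o, 'a set) precat" where
  "stable_category C E =
     \<lparr> Ob = Ob C,
       Arr = stable_class C E ` Arr C,
       Dom = (\<lambda>F. Dom C (SOME f. f \<in> F)),
       Cod = (\<lambda>F. Cod C (SOME f. f \<in> F)),
       Id = (\<lambda>X. stable_class C E (Id C X)),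
       Cmp = (\<lambda>G F. stable_class C E (Cmp C (SOME g. g \<in> G) (SOME f. f \<in> F))),
       Add = (\<lambda>G F. stable_class C E (Add C (SOME g. g \<in> G) (SOME f. f \<in> F))),
       Zer = (\<lambda>X Y. stable_class C E (Zer C X Y)) \<rparr>"

text \<open>The shift of \<open>B\<close> in the stable category of a Frobenius category is the cokernel of a chosen
  admissible monomorphism from \<open>B\<close> to a projective-injective object.\<close>

definition shift :: "('o, 'a) precat \<Rightarrow> ('a \<times> 'a) set \<Rightarrow> 'o \<Rightarrow> 'o" where
  "shift C E B = (SOME W. \<exists>(i, p) \<in> E.
     Dom C i = B \<and> projective_injective C E (Cod C i) \<and> Cod C p = W)"

definition Ext1 :: "('o, 'a) precat \<Rightarrow> ('a \<times> 'a) set \<Rightarrow> 'o \<Rightarrow> 'o \<Rightarrow> 'a set set" where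
  "Ext1 C E A B = homs (stable_category C E) A (shift C E B)"

definition Ext1_vanishes :: "('o, 'a) precat \<Rightarrow> ('a \<times> 'a) set \<Rightarrow> 'o \<Rightarrow> 'o \<Rightarrow> bool" where
  "Ext1_vanishes C E A B \<longleftrightarrow> Ext1 C E A B = {Zer (stable_category C E) A (shift C E B)}"


section \<open>The orbit space\<close>

datatype sign = Plus | Minus

fun flip :: "sign \<Rightarrow> sign" where
  "flip Plus = Minus"
| "flip Minus = Plus"

lemma flip_flip [simp]: "flip (flip e) = e"
  by (cases e) auto

fun sign_val :: "sign \<Rightarrow> 'r::comm_ring_1" where
  "sign_val Plus = 1"
| "sign_val Minus = - 1"

type_synonym point = "real \<times> real \<times> sign"

text \<open>The order does not compare the signs.\<close>

fun point_le :: "point \<Rightarrow> point \<Rightarrow> bool" where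
  "point_le (x, y, e) (x', y', e') \<longleftrightarrow> x \<le> x' \<and> y \<le> y'"

fun sigma :: "point \<Rightarrow> point" where
  "sigma (x, y, e) = (y + pi, x + pi, flip e)"

definition sigma_pow :: "int \<Rightarrow> point \<Rightarrow> point" where
  "sigma_pow i = (if 0 \<le> i then sigma ^^ nat i else inv_into UNIV sigma ^^ nat (- i))"

definition same_orbit :: "point \<Rightarrow> point \<Rightarrow> bool" where
  "same_orbit p q \<longleftrightarrow> (\<exists>i. q = sigma_pow i p)"

lemma inv_sigma: "inv_into UNIV sigma (x, y, e) = (y - pi, x - pi, flip e)"
proof -
  have "inj sigma"
    by (auto simp: inj_on_def) (metis flip_flip)
  moreover have "sigma (y - pi, x - pi, flip e) = (x, y, e)"
    by simp
  ultimately show ?thesis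
    by (metis inv_f_f)
qed

lemma sigma_pow_closed_form:
  "sigma_pow i (x, y, e) =
     (if even i then (x + of_int i * pi, y + of_int i * pi, e)
      else (y + of_int i * pi, x + of_int i * pi, flip e))"
proof -
  have pos: "(sigma ^^ n) (x, y, e) =
      (if even n then (x + real n * pi, y + real n * pi, e)
       else (y + real n * pi, x + real n * pi, flip e))" for n
    by (induction n) (auto simp: algebra_simps)
  have neg: "(inv_into UNIV sigma ^^ n) (x, y, e) =
      (if even n then (x - real n * pi, y - real n * pi, e)
       else (y - real n * pi, x - real n * pi, flip e))" for n
    by (induction n) (auto simp: algebra_simps inv_sigma)
  show ?thesis
  proof (cases "0 \<le> i")
    case True
    then show ?thesis
      using pos[of "nat i"] by (simp add: sigma_pow_def even_nat_iff)
  next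
    case False
    then show ?thesis
      using neg[of "nat (- i)"] by (simp add: sigma_pow_def even_nat_iff)
  qed
qed

lemma sigma_pow_0 [simp]: "sigma_pow 0 p = p"
  by (simp add: sigma_pow_def)

lemma sigma_pow_add: "sigma_pow i (sigma_pow j p) = sigma_pow (i + j) p"
  by (cases p) (auto simp: sigma_pow_closed_form algebra_simps)

lemma point_le_sigma_pow: "point_le (sigma_pow i p) (sigma_pow i q) \<longleftrightarrow> point_le p q"
  by (cases p; cases q) (auto simp: sigma_pow_closed_form)

lemma equivp_same_orbit: "equivp same_orbit"
proof (rule equivpI)
  show "reflp same_orbit"
    unfolding reflp_def same_orbit_def by (metis sigma_pow_0)
  show "symp same_orbit"
    unfolding symp_def same_orbit_def
    by (metis add.left_inverse sigma_pow_0 sigma_pow_add)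
  show "transp same_orbit"
    unfolding transp_def same_orbit_def by (metis sigma_pow_add)
qed

quotient_type orbit = point / same_orbit
  by (rule equivp_same_orbit)

lift_definition obj_M :: "real \<Rightarrow> real \<Rightarrow> orbit" is "\<lambda>x y. (x, y, Plus)" .

lift_definition width :: "orbit \<Rightarrow> real" is "\<lambda>(x, y, e). \<bar>x - y\<bar>"
  by (auto simp: same_orbit_def sigma_pow_closed_form abs_minus_commute split: if_splits)

lift_definition psi_orbit :: "orbit \<Rightarrow> orbit" is "\<lambda>(x, y, e). (x + pi, y + pi, e)"
  by (auto simp: same_orbit_def sigma_pow_closed_form algebra_simps split: if_splits)

definition min_exponent :: "point \<Rightarrow> point \<Rightarrow> int" where
  "min_exponent p q = (LEAST i. point_le p (sigma_pow i q))"

lemma min_exponent_exists: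
  "\<exists>m. point_le p (sigma_pow m q) \<and> (\<forall>i. point_le p (sigma_pow i q) \<longrightarrow> m \<le> i)"
proof -
  obtain x y e where p: "p = (x, y, e)" by (cases p)
  obtain x' y' e' where q: "q = (x', y', e')" by (cases q)
  define lo where "lo = \<lfloor>(x - max x' y') / pi\<rfloor>"
  define hi where "hi = \<lceil>(max x y - min x' y') / pi\<rceil>"
  have lo: "lo \<le> i" if "point_le p (sigma_pow i q)" for i
  proof -
    have "x \<le> max x' y' + of_int i * pi"
      using that by (auto simp: p q sigma_pow_closed_form split: if_splits)
    then have "(x - max x' y') / pi \<le> of_int i"
      by (simp add: pos_divide_le_eq)
    then show ?thesis
      unfolding lo_def by linarith
  qed
  have "(max x y - min x' y') / pi \<le> of_int hi"
    unfolding hi_def by linarith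
  then have "max x y - min x' y' \<le> of_int hi * pi"
    by (simp only: pos_divide_le_eq[OF pi_gt_zero])
  then have "x \<le> x' + of_int hi * pi" "x \<le> y' + of_int hi * pi"
    "y \<le> x' + of_int hi * pi" "y \<le> y' + of_int hi * pi"
    by linarith+
  then have hi: "point_le p (sigma_pow hi q)"
    by (auto simp: p q sigma_pow_closed_form)
  define n where "n = (LEAST n::nat. point_le p (sigma_pow (lo + int n) q))"
  have "point_le p (sigma_pow (lo + int (nat (hi - lo))) q)"
    using hi lo[OF hi] by simp
  then have n: "point_le p (sigma_pow (lo + int n) q)"
    unfolding n_def by (rule LeastI)
  moreover have "lo + int n \<le> i" if i: "point_le p (sigma_pow i q)" for i
  proof -
    have "point_le p (sigma_pow (lo + int (nat (i - lo))) q)"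
      using i lo[OF i] by simp
    then have "n \<le> nat (i - lo)"
      unfolding n_def by (rule Least_le)
    then show ?thesis
      using lo[OF i] by linarith
  qed
  ultimately show ?thesis by blast
qed

lemma min_exponent_point_le: "point_le p (sigma_pow (min_exponent p q) q)"
  and min_exponent_least: "point_le p (sigma_pow i q) \<Longrightarrow> min_exponent p q \<le> i"
proof -
  obtain m where m: "point_le p (sigma_pow m q)" "\<And>i. point_le p (sigma_pow i q) \<Longrightarrow> m \<le> i"
    using min_exponent_exists by blast
  then have "min_exponent p q = m"
    unfolding min_exponent_def by (intro Least_equality) auto
  with m show "point_le p (sigma_pow (min_exponent p q) q)"
    and "point_le p (sigma_pow i q) \<Longrightarrow> min_exponent p q \<le> i"
    by auto
qed

lemma min_exponent_sigma_pow:
  "min_exponent (sigma_pow m p) (sigma_pow n q) = min_exponent p q + m - n"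
proof -
  have *: "point_le (sigma_pow m p) (sigma_pow i (sigma_pow n q)) \<longleftrightarrow>
      point_le p (sigma_pow (i + n - m) q)" for i
    using point_le_sigma_pow[of m p "sigma_pow (i + n - m) q"] by (simp add: sigma_pow_add)
  show ?thesis
    unfolding min_exponent_def[of "sigma_pow m p"] *
  proof (rule Least_equality)
    show "point_le p (sigma_pow (min_exponent p q + m - n + n - m) q)"
      by (simp add: min_exponent_point_le)
    show "min_exponent p q + m - n \<le> i" if "point_le p (sigma_pow (i + n - m) q)" for i
      using min_exponent_least[OF that] by linarith
  qed
qed

lift_definition c_exp :: "orbit \<Rightarrow> orbit \<Rightarrow> orbit \<Rightarrow> int" is
  "\<lambda>p q r. min_exponent p q + min_exponent q r - min_exponent p r"
  unfolding same_orbit_def by (auto simp: min_exponent_sigma_pow)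

lemma c_exp_nonneg: "0 \<le> c_exp X Y Z"
proof (transfer, goal_cases)
  case (1 p q r)
  have le_trans: "point_le a b \<Longrightarrow> point_le b c \<Longrightarrow> point_le a c" for a b c
    by (cases a; cases b; cases c) auto
  have "point_le (sigma_pow (min_exponent p q) q)
      (sigma_pow (min_exponent p q) (sigma_pow (min_exponent q r) r))"
    by (simp add: point_le_sigma_pow min_exponent_point_le)
  then have "point_le p (sigma_pow (min_exponent p q + min_exponent q r) r)"
    using le_trans[OF min_exponent_point_le] by (simp add: sigma_pow_add)
  from min_exponent_least[OF this] show ?case by simp
qed

lemma psi_orbit_M: "psi_orbit (obj_M x y) = obj_M (x + pi) (y + pi)"
  by transfer (auto simp: same_orbit_def intro: exI[of _ 0])

lemma psi_orbit_psi_orbit: "psi_orbit (psi_orbit X) = X"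
proof (transfer, goal_cases)
  case (1 p)
  then show ?case
    by (cases p) (auto simp: same_orbit_def sigma_pow_closed_form intro!: exI[of _ "- 2"])
qed


section \<open>The categories \<open>F\<^sub>b\<close> and their involutions\<close>

text \<open>An object is the list of the summands of a finite direct sum. A morphism \<open>X \<rightarrow> Y\<close> is a
  triple \<open>(X, f, Y)\<close> where \<open>f\<close> is a matrix whose \<open>(i, j)\<close> entry is the coefficient of the basic
  morphism from the \<open>j\<close>th summand of \<open>X\<close> to the \<open>i\<close>th summand of \<open>Y\<close>. Only the objects depend on
  \<open>b\<close>.\<close>

type_synonym 'r farrow = "orbit list \<times> 'r mat \<times> orbit list"

fun F_cmp :: "'r::idom \<Rightarrow> 'r farrow \<Rightarrow> 'r farrow \<Rightarrow> 'r farrow" where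
  "F_cmp u (Y, g, Z) (X, f, Y') =
     (X,
      mat (length Z) (length X) (\<lambda>(k, i). \<Sum>j<length Y.
        g $$ (k, j) * f $$ (j, i) * u ^ nat (c_exp (X ! i) (Y ! j) (Z ! k))),
      Z)"

fun F_add :: "'r::idom farrow \<Rightarrow> 'r farrow \<Rightarrow> 'r farrow" where
  "F_add (X, f, Y) (X', g, Y') = (X, f + g, Y)"

definition cat_F :: "'r::idom \<Rightarrow> real \<Rightarrow> (orbit list, 'r farrow) precat" where
  "cat_F u b =
     \<lparr> Ob = {X. \<forall>m \<in> set X. width m \<le> b},
       Arr = {(X, f, Y). (\<forall>m \<in> set X. width m \<le> b) \<and> (\<forall>m \<in> set Y. width m \<le> b) \<and>
                f \<in> carrier_mat (length Y) (length X)},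
       Dom = fst,
       Cod = snd \<circ> snd,
       Id = (\<lambda>X. (X, 1\<^sub>m (length X), X)),
       Cmp = F_cmp u,
       Add = F_add,
       Zer = (\<lambda>X Y. (X, 0\<^sub>m (length Y) (length X), Y)) \<rparr>"

text \<open>The condition that characterizes the exact structure of \<open>F\<^sub>b\<close> uniquely.\<close>

definition F_exact_structure :: "'r::idom \<Rightarrow> real \<Rightarrow> ('r farrow \<times> 'r farrow) set \<Rightarrow> bool" where
  "F_exact_structure u b E \<longleftrightarrow> frobenius_structure (cat_F u b) E \<and>
     (\<forall>P. indecomposable (cat_F u b) P \<and> projective_injective (cat_F u b) E P \<longleftrightarrow>
        (\<exists>x y. \<bar>x - y\<bar> = b \<and> isomorphic (cat_F u b) P [obj_M x y]))"

fun psi_arrow :: "'r farrow \<Rightarrow> 'r farrow" where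
  "psi_arrow (X, f, Y) = (map psi_orbit X, f, map psi_orbit Y)"

type_synonym 'r fpobj = "orbit list \<times> 'r farrow"
type_synonym 'r fparrow = "'r fpobj \<times> 'r farrow \<times> 'r fpobj"

definition F_psi_objects :: "'r::idom \<Rightarrow> real \<Rightarrow> 'r fpobj set" where
  "F_psi_objects u b = {(X, \<xi>). X \<in> Ob (cat_F u b) \<and> \<xi> \<in> homs (cat_F u b) (map psi_orbit X) X \<and>
     is_isomorphism (cat_F u b) \<xi> \<and> Cmp (cat_F u b) \<xi> (psi_arrow \<xi>) = Id (cat_F u b) X}"

definition F_psi :: "'r::idom \<Rightarrow> real \<Rightarrow> ('r fpobj, 'r fparrow) precat" where
  "F_psi u b =
     \<lparr> Ob = F_psi_objects u b,
       Arr = {((X, \<xi>), f, (Y, \<eta>)). (X, \<xi>) \<in> F_psi_objects u b \<and> (Y, \<eta>) \<in> F_psi_objects u b \<and>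
                f \<in> homs (cat_F u b) X Y \<and> Cmp (cat_F u b) f \<xi> = Cmp (cat_F u b) \<eta> (psi_arrow f)},
       Dom = fst,
       Cod = snd \<circ> snd,
       Id = (\<lambda>(X, \<xi>). ((X, \<xi>), Id (cat_F u b) X, (X, \<xi>))),
       Cmp = (\<lambda>(Y, g, Z) (X, f, Y'). (X, Cmp (cat_F u b) g f, Z)),
       Add = (\<lambda>(X, f, Y) (X', g, Y'). (X, Add (cat_F u b) f g, Y)),
       Zer = (\<lambda>(X, \<xi>) (Y, \<eta>). ((X, \<xi>), Zer (cat_F u b) X Y, (Y, \<eta>))) \<rparr>"

definition F_psi_exact ::
    "'r::idom \<Rightarrow> real \<Rightarrow> ('r farrow \<times> 'r farrow) set \<Rightarrow> ('r fparrow \<times> 'r fparrow) set" where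
  "F_psi_exact u b E =
     {(i, p). composable (F_psi u b) p i \<and> (fst (snd i), fst (snd p)) \<in> E}"

definition C_psi ::
    "'r::idom \<Rightarrow> real \<Rightarrow> ('r farrow \<times> 'r farrow) set \<Rightarrow> ('r fpobj, 'r fparrow set) precat" where
  "C_psi u b E = stable_category (F_psi u b) (F_psi_exact u b E)"


section \<open>Regular and singular objects\<close>

definition obj_S :: "orbit list \<Rightarrow> 'r::idom fpobj" where
  "obj_S X = (let n = length X; X2 = X @ map psi_orbit X in
     (X2, (map psi_orbit X2, four_block_mat (0\<^sub>m n n) (1\<^sub>m n) (1\<^sub>m n) (0\<^sub>m n n), X2)))"

definition obj_E :: "real \<Rightarrow> real \<Rightarrow> orbit" where
  "obj_E x y = obj_M x (y - pi)"

definition obj_Z :: "sign \<Rightarrow> real \<Rightarrow> 'r::idom fpobj" where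
  "obj_Z \<epsilon> x = ([obj_M x x], ([psi_orbit (obj_M x x)], mat 1 1 (\<lambda>_. sign_val \<epsilon>), [obj_M x x]))"

text \<open>\<open>Regular x y\<close> is the name of \<open>SM(x, y)\<close> and \<open>Singular \<epsilon> x\<close> is the name of \<open>Z\<^sub>\<epsilon>(x)\<close>.\<close>

datatype name = Regular real real | Singular sign real

fun valid_name :: "real \<Rightarrow> name \<Rightarrow> bool" where
  "valid_name b (Regular x y) \<longleftrightarrow> 0 < \<bar>x - y\<bar> \<and> \<bar>x - y\<bar> < b"
| "valid_name b (Singular \<epsilon> x) \<longleftrightarrow> True"

fun named :: "name \<Rightarrow> 'r::idom fpobj" where
  "named (Regular x y) = obj_S [obj_M x y]"
| "named (Singular \<epsilon> x) = obj_Z \<epsilon> x"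


section \<open>Compatibility and laminations\<close>

definition compatible ::
    "'r::idom \<Rightarrow> real \<Rightarrow> ('r farrow \<times> 'r farrow) set \<Rightarrow> 'r fpobj \<Rightarrow> 'r fpobj \<Rightarrow> bool" where
  "compatible u b E X Y \<longleftrightarrow>
     Ext1_vanishes (F_psi u b) (F_psi_exact u b E) X Y \<and>
     Ext1_vanishes (F_psi u b) (F_psi_exact u b E) Y X"

text \<open>From here on \<open>E\<close> is a family of exact structures, \<open>E b\<close> being the one on \<open>cat_F u b\<close>.\<close>

definition compatible_pi ::
    "'r::idom \<Rightarrow> (real \<Rightarrow> ('r farrow \<times> 'r farrow) set) \<Rightarrow> 'r fpobj \<Rightarrow> 'r fpobj \<Rightarrow> bool" where
  "compatible_pi u E X Y \<longleftrightarrow>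
     (\<exists>m n. valid_name pi m \<and> valid_name pi n \<and>
        isomorphic (C_psi u pi (E pi)) X (named m) \<and> isomorphic (C_psi u pi (E pi)) Y (named n) \<and>
        (\<forall>\<^sub>F b in at_left pi. compatible u b (E b) (named m) (named n)))"

definition pairwise_compatible ::
    "'r::idom \<Rightarrow> (real \<Rightarrow> ('r farrow \<times> 'r farrow) set) \<Rightarrow> 'r fpobj set \<Rightarrow> bool" where
  "pairwise_compatible u E L \<longleftrightarrow>
     (\<forall>X \<in> L. indecomposable (C_psi u pi (E pi)) X) \<and>
     (\<forall>X \<in> L. \<forall>Y \<in> L. X \<noteq> Y \<longrightarrow>
        compatible_pi u E X Y \<and> \<not> isomorphic (C_psi u pi (E pi)) X Y)"

definition lamination ::
    "'r::idom \<Rightarrow> (real \<Rightarrow> ('r farrow \<times> 'r farrow) set) \<Rightarrow> 'r fpobj set \<Rightarrow> bool" where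
  "lamination u E L \<longleftrightarrow> pairwise_compatible u E L \<and>
     (\<forall>L'. pairwise_compatible u E L' \<and> L \<subseteq> L' \<longrightarrow> L' = L)"


section \<open>The space \<open>H\<close>\<close>

definition H_tilde :: "point set" where
  "H_tilde = {(x, y, \<epsilon>). x < y \<and> y \<le> x + pi}"

inductive H_gen :: "point \<Rightarrow> point \<Rightarrow> bool" where
  "(x, y, Plus) \<in> H_tilde \<Longrightarrow> y < x + pi \<Longrightarrow> H_gen (x, y, Plus) (x, y, Minus)"
| "(x, y, \<epsilon>) \<in> H_tilde \<Longrightarrow> H_gen (x, y, \<epsilon>) (x + pi, y + pi, \<epsilon>)"

definition H_class :: "point \<Rightarrow> point set" where
  "H_class p = {q. equivclp H_gen p q}"

definition H_space :: "point set set" where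
  "H_space = H_class ` H_tilde"

definition H_tilde_topology :: "point topology" where
  "H_tilde_topology = subtopology
     (prod_topology euclidean (prod_topology euclidean (discrete_topology UNIV))) H_tilde"

definition H_topology :: "point set topology" where
  "H_topology = topology (\<lambda>U. U \<subseteq> H_space \<and>
     openin H_tilde_topology {p \<in> H_tilde. H_class p \<in> U})"

lemma topspace_H_tilde_topology [simp]: "topspace H_tilde_topology = H_tilde"
  by (simp add: H_tilde_topology_def)

lemma openin_H_topology:
  "openin H_topology U \<longleftrightarrow>
     U \<subseteq> H_space \<and> openin H_tilde_topology {p \<in> H_tilde. H_class p \<in> U}"
proof -
  have "istopology (\<lambda>U. U \<subseteq> H_space \<and> openin H_tilde_topology {p \<in> H_tilde. H_class p \<in> U})"
    unfolding istopology_def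
  proof (intro conjI allI impI; (elim conjE)?)
    fix U V :: "point set set"
    assume "openin H_tilde_topology {p \<in> H_tilde. H_class p \<in> U}"
      and "openin H_tilde_topology {p \<in> H_tilde. H_class p \<in> V}"
    then have "openin H_tilde_topology
        ({p \<in> H_tilde. H_class p \<in> U} \<inter> {p \<in> H_tilde. H_class p \<in> V})"
      by (rule openin_Int)
    then show "openin H_tilde_topology {p \<in> H_tilde. H_class p \<in> U \<inter> V}"
      by (rule back_subst) auto
  next
    fix \<U> :: "point set set set"
    assume "\<forall>U\<in>\<U>. U \<subseteq> H_space \<and> openin H_tilde_topology {p \<in> H_tilde. H_class p \<in> U}"
    then have "openin H_tilde_topology (\<Union>U\<in>\<U>. {p \<in> H_tilde. H_class p \<in> U})"
      by (intro openin_Union) auto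
    then show "openin H_tilde_topology {p \<in> H_tilde. H_class p \<in> \<Union>\<U>}"
      by (rule back_subst) auto
  qed auto
  then show ?thesis
    by (simp add: H_topology_def)
qed

lemma topspace_H_topology [simp]: "topspace H_topology = H_space"
proof -
  have "{p \<in> H_tilde. H_class p \<in> H_space} = topspace H_tilde_topology"
    by (auto simp: H_space_def)
  then have "openin H_topology H_space"
    by (simp only: openin_H_topology openin_topspace subset_refl simp_thms)
  then show ?thesis
    by (meson openin_H_topology openin_subset openin_topspace subset_antisym)
qed

lemma quotient_map_H_class: "quotient_map H_tilde_topology H_topology H_class"
  by (simp add: quotient_map_def openin_H_topology H_space_def)

definition h_map ::
    "'r::idom \<Rightarrow> ('r farrow \<times> 'r farrow) set \<Rightarrow> 'r fpobj \<Rightarrow> point set" where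
  "h_map u E X = (THE p.
     (\<exists>x y. x < y \<and> y < x + pi \<and> isomorphic (C_psi u pi E) X (obj_S [obj_E x y]) \<and>
        p = H_class (x, y, Plus)) \<or>
     (\<exists>x y. x + pi < y \<and> y < x + 2 * pi \<and> isomorphic (C_psi u pi E) X (obj_S [obj_E x y]) \<and>
        p = H_class (y, x + 2 * pi, Plus)) \<or>
     (\<exists>\<epsilon> x. isomorphic (C_psi u pi E) X (obj_Z \<epsilon> x) \<and> p = H_class (x, x + pi, \<epsilon>)))"

end

theory Submission
  imports Defs "HOL-Library.Poly_Mapping"
begin

text \<open>Forgetting signs, the basic morphisms compose as powers of \<open>u\<close>, so extensions in \<open>F\<^sub>b\<close> are read
  off from rectangles. The square \<open>(x, y) \<rightarrow> (y + b, y) \<oplus> (x, x + b) \<rightarrow> (y + b, x + b)\<close> is a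
  boundary-approximation of \<open>M(x, y)\<close> followed by its cokernel, and a Schanuel argument shows that its
  last term computes the shift, whatever the exact structure is. Averaging over the involution (2 is
  invertible) transfers this to \<open>F\<^sub>b\<^sup>\<psi>\<close>: an extension between named objects is nonzero iff a rectangle
  contains no boundary point, except that \<open>Z\<^sub>\<epsilon>(x)\<close> and \<open>Z\<^sub>\<epsilon>(x')\<close> with equal signs have no extensions
  because the shift changes the sign. As \<open>b\<close> tends to \<open>\<pi>\<close>, incompatibility becomes the crossing of
  arcs, given by strict inequalities, hence open on \<open>H\<close>.

  Splitting off summands \<open>SM(x, y)\<close> and \<open>Z\<^sub>\<epsilon>(x)\<close> shows that every indecomposable object is named. A
  point outside \<open>h(L)\<close> therefore is \<open>h(Y)\<close> for a named \<open>Y\<close>, and by maximality of \<open>L\<close> some \<open>X\<close> in \<open>L\<close>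
  crosses \<open>Y\<close>. The points crossing \<open>X\<close> form a neighbourhood of \<open>h(Y)\<close> that misses \<open>h(L)\<close>.\<close>


section \<open>Discrete valuation rings\<close>

text \<open>The exact structure is known only through its axioms and its indecomposable
  projective-injectives, so no list of short exact sequences is available. Two facts are extracted
  from it: a single orbit is projective-injective iff its width is \<open>b\<close>, and every
  object embeds admissibly into a list of such orbits. The null maps of the stable category are then
  the maps that factor through boundary lists, and this is a statement about powers of
  \<open>u\<close>.

  Decomposition arguments rest on the locality of \<open>R\<close>: a sum is a unit only if some
  summand is. This takes the place of Krull-Schmidt and also decides nullity, since a factorization
  with unit coefficient must pass through one boundary orbit without a power of \<open>u\<close>.

  Extensions are computed for \<open>b < pi\<close>, where the exponents in the square vanish; at
  \<open>b = pi\<close> the corner \<open>(y + b, x + b)\<close> is the translate of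
  \<open>(x, y)\<close> by \<open>sigma\<close>. The category at \<open>pi\<close> contributes the
  classification of indecomposables and their isomorphisms. For \<open>b < pi\<close> the two
  directions of Ext give different conditions; only in the limit does crossing become symmetric and
  invariant on classes in H.\<close>

lemma is_ring_ideal_principal: "is_ring_ideal (principal_ideal a)"
  unfolding is_ring_ideal_def principal_ideal_def
proof (intro conjI ballI allI)
  show "0 \<in> range (\<lambda>r. r * a)" by (auto intro: range_eqI[of _ _ 0])
next
  fix b c assume "b \<in> range (\<lambda>r. r * a)" "c \<in> range (\<lambda>r. r * a)"
  then obtain r s where "b = r * a" "c = s * a" by auto
  then show "b + c \<in> range (\<lambda>r. r * a)" by (intro range_eqI[of _ _ "r + s"]) (simp add: algebra_simps)
next
  fix b r assume "b \<in> range (\<lambda>r. r * a)"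
  then obtain s where "b = s * a" by auto
  then show "r * b \<in> range (\<lambda>r. r * a)" by (intro range_eqI[of _ _ "r * s"]) (simp add: algebra_simps)
qed

lemma mem_principal_ideal: "b \<in> principal_ideal a \<longleftrightarrow> a dvd b"
  by (auto simp: principal_ideal_def dvd_def mult.commute)

lemma ideal_eq_UNIV: "is_ring_ideal I \<Longrightarrow> I = UNIV \<longleftrightarrow> 1 \<in> I"
  unfolding is_ring_ideal_def by (metis UNIV_I UNIV_eq_I mult.right_neutral)

lemma exists_maximal_ideal:
  assumes "is_ring_ideal I" "1 \<notin> I"
  shows "\<exists>M. is_maximal_ideal M \<and> I \<subseteq> M"
proof -
  let ?A = "{J. is_ring_ideal J \<and> 1 \<notin> J \<and> I \<subseteq> J}"
  have "\<exists>M\<in>?A. \<forall>X\<in>?A. M \<subseteq> X \<longrightarrow> X = M"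
  proof (rule subset_Zorn_nonempty)
    show "?A \<noteq> {}" using assms by auto
  next
    fix C assume C: "C \<noteq> {}" "subset.chain ?A C"
    have add: "a + b \<in> \<Union>C" if "a \<in> \<Union>C" "b \<in> \<Union>C" for a b
    proof -
      from that obtain J K where "J \<in> C" "K \<in> C" "a \<in> J" "b \<in> K" by auto
      moreover from this C have "J \<subseteq> K \<or> K \<subseteq> J" by (auto simp: subset_chain_def)
      ultimately obtain L where "L \<in> C" "a \<in> L" "b \<in> L" by blast
      moreover from this C have "is_ring_ideal L" by (auto simp: subset_chain_def)
      ultimately show ?thesis unfolding is_ring_ideal_def by blast
    qed
    have J: "is_ring_ideal J \<and> 1 \<notin> J \<and> I \<subseteq> J" if "J \<in> C" for J
      using C that by (auto simp: subset_chain_def)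
    have "r * a \<in> \<Union>C" if "a \<in> \<Union>C" for a r
      using that J unfolding is_ring_ideal_def by blast
    moreover obtain J0 where "J0 \<in> C" using C(1) by blast
    ultimately show "\<Union>C \<in> ?A"
      using J[of J0] J add unfolding is_ring_ideal_def mem_Collect_eq by blast
  qed
  then obtain M where M: "M \<in> ?A" and max: "\<forall>X\<in>?A. M \<subseteq> X \<longrightarrow> X = M" ..
  have "J = M \<or> J = UNIV" if "is_ring_ideal J" "M \<subseteq> J" for J
  proof (cases "1 \<in> J")
    case False
    then have "J \<in> ?A" using that M by auto
    then show ?thesis using max that by auto
  qed (use that ideal_eq_UNIV in auto)
  then have "is_maximal_ideal M" using M by (auto simp: is_maximal_ideal_def)
  then show ?thesis using M by auto
qed

locale dvr =
  fixes u :: "'r::idom"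
  assumes dvr_u: "dvr_with_uniformizer u"
    and residue_char_u: "residue_char u \<noteq> 2"
begin

text \<open>A nonunit generates a proper ideal, which Zorn's lemma puts inside the one maximal ideal
  \<open>(u)\<close>. This is the form in which locality is used throughout.\<close>

lemma u_dvd_iff: "u dvd a \<longleftrightarrow> \<not> a dvd 1"
proof
  have M: "is_maximal_ideal (principal_ideal u)" and
    uq: "\<And>I J. is_maximal_ideal I \<Longrightarrow> is_maximal_ideal J \<Longrightarrow> I = (J::'r set)"
    using dvr_u unfolding dvr_with_uniformizer_def by auto
  have u1: "\<not> u dvd 1"
    using M ideal_eq_UNIV[of "principal_ideal u"] unfolding is_maximal_ideal_def
    by (simp add: mem_principal_ideal)
  show "\<not> a dvd 1" if "u dvd a" using that u1 dvd_trans by blast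
  show "u dvd a" if "\<not> a dvd 1"
  proof -
    have "1 \<notin> principal_ideal a" using that by (simp add: mem_principal_ideal)
    then obtain N where "is_maximal_ideal N" "principal_ideal a \<subseteq> N"
      using exists_maximal_ideal[OF is_ring_ideal_principal] by blast
    with uq M have "principal_ideal a \<subseteq> principal_ideal u" by blast
    then show ?thesis using mem_principal_ideal dvd_refl by blast
  qed
qed

text \<open>If 2 were a nonunit, \<open>u\<close> would divide it and hence all even numbers, but no
  odd one, since otherwise it would divide 1. The gcd that defines \<open>residue_char\<close> would
  then be 2.\<close>

lemma two_unit: "(2::'r) dvd 1"
proof (rule ccontr)
  assume "\<not> (2::'r) dvd 1"
  then have 2: "u dvd 2" by (simp add: u_dvd_iff)
  have odd: "\<not> u dvd of_nat n" if "odd n" for n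
  proof
    assume "u dvd of_nat n"
    moreover from that obtain k where "n = 2 * k + 1" by (auto elim: oddE)
    ultimately have "u dvd 2 * of_nat k + 1" by (simp add: add.commute)
    moreover have "u dvd 2 * of_nat k" using 2 by simp
    ultimately have "u dvd 1" using dvd_add_right_iff by blast
    then show False using u_dvd_iff by simp
  qed
  have "Gcd {n. of_nat n \<in> principal_ideal u} = 2"
  proof (rule dvd_antisym)
    show "Gcd {n. of_nat n \<in> principal_ideal u} dvd 2"
      using 2 by (intro Gcd_dvd) (simp add: mem_principal_ideal)
    show "2 dvd Gcd {n. of_nat n \<in> principal_ideal u}"
      using odd by (intro Gcd_greatest) (auto simp: mem_principal_ideal)
  qed
  then show False using residue_char_u by (simp add: residue_char_def)
qed

definition half :: 'r where "half = (SOME h. 2 * h = 1)"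

lemma half: "2 * half = 1"
proof -
  from two_unit obtain h where "2 * h = (1::'r)" by (metis dvd_def)
  then show ?thesis unfolding half_def by (rule someI)
qed

lemma half_add_half: "half * a + half * a = a"
  using half by (metis mult.assoc mult.left_neutral mult_2)

text \<open>Multiples of \<open>u\<close> are closed under sums. Applied to an entry of a matrix
  product, and combined with \<open>unit_mult\<close> and \<open>unit_u_power\<close>, this yields a
  middle index at which both coefficients are units and the exponent of \<open>u\<close> is
  0.\<close>

lemma nonunit_sum:
  fixes f :: "'i \<Rightarrow> 'r"
  assumes "finite S" "(\<Sum>i\<in>S. f i) dvd 1"
  shows "\<exists>i\<in>S. f i dvd 1"
proof (rule ccontr)
  assume "\<not> ?thesis"
  then have "\<forall>i\<in>S. u dvd f i" by (simp add: u_dvd_iff)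
  then have "u dvd (\<Sum>i\<in>S. f i)" by (simp add: dvd_sum)
  then show False using assms u_dvd_iff by blast
qed

lemma unit_mult: "a * b dvd 1 \<longleftrightarrow> a dvd 1 \<and> b dvd (1::'r)"
  by (metis dvd_mult_left dvd_mult_right dvd_def mult_dvd_mono mult_1)

lemma unit_u_power: "u ^ n dvd 1 \<longleftrightarrow> n = 0"
proof
  assume "u ^ n dvd 1"
  show "n = 0"
  proof (rule ccontr)
    assume "n \<noteq> 0" then have "u dvd u ^ n" by simp
    then show False using \<open>u ^ n dvd 1\<close> u_dvd_iff by blast
  qed
qed simp

lemma unit_sub: "u dvd t \<Longrightarrow> (1 - t) dvd 1"
  by (metis diff_add_cancel dvd_add dvd_refl u_dvd_iff)

lemma u_nonzero: "u \<noteq> 0"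
  using dvr_u by (auto simp: dvr_with_uniformizer_def)

end


section \<open>Orbits\<close>

lemma min_exponent_self: "min_exponent p p = 0"
proof -
  obtain x y e where p: "p = (x, y, e)" by (cases p)
  have "0 \<le> i" if "point_le p (sigma_pow i p)" for i :: int
  proof -
    have "0 \<le> of_int i * pi"
      using that by (auto simp: p sigma_pow_closed_form split: if_splits)
    then show ?thesis using pi_gt_zero by (simp add: zero_le_mult_iff)
  qed
  then have "0 \<le> min_exponent p p" using min_exponent_point_le by blast
  moreover have "min_exponent p p \<le> 0" by (rule min_exponent_least) (simp add: p)
  ultimately show ?thesis by simp
qed

lemma c_exp_left: "c_exp X X Y = 0" and c_exp_right: "c_exp X Y Y = 0"
  by (transfer; simp add: min_exponent_self)+

lemma c_exp_cocycle: "c_exp X Y Z + c_exp X Z W = c_exp Y Z W + c_exp X Y W"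
  by transfer simp

lemma c_exp_psi: "c_exp (psi_orbit X) (psi_orbit Y) (psi_orbit Z) = c_exp X Y Z"
proof -
  have "min_exponent (case p of (x, y, e) \<Rightarrow> (x + pi, y + pi, e))
     (case q of (x, y, e) \<Rightarrow> (x + pi, y + pi, e)) = min_exponent p q" for p q
  proof -
    have "point_le (case p of (x, y, e) \<Rightarrow> (x + pi, y + pi, e))
     (sigma_pow i (case q of (x, y, e) \<Rightarrow> (x + pi, y + pi, e))) = point_le p (sigma_pow i q)" for i
      by (cases p; cases q) (auto simp: sigma_pow_closed_form)
    then show ?thesis unfolding min_exponent_def by simp
  qed
  then show ?thesis by transfer simp
qed

definition cc :: "orbit \<Rightarrow> orbit \<Rightarrow> orbit \<Rightarrow> nat" where "cc X Y Z = nat (c_exp X Y Z)"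

lemma cc_left [simp]: "cc X X Y = 0" and cc_right [simp]: "cc X Y Y = 0"
  by (simp_all add: cc_def c_exp_left c_exp_right)

lemma cc_cocycle: "cc X Y Z + cc X Z W = cc Y Z W + cc X Y W"
  unfolding cc_def using c_exp_cocycle[of X Y Z W] c_exp_nonneg
  by (metis nat_add_distrib)

lemma cc_psi [simp]: "cc (psi_orbit X) (psi_orbit Y) (psi_orbit Z) = cc X Y Z"
  by (simp add: cc_def c_exp_psi)

lemma cc_sym: "cc X Y X = cc Y X Y"
  using cc_cocycle[of X Y X Y] by simp

text \<open>\<open>cc X Y X = 0\<close> means that the basic morphisms between \<open>X\<close> and
  \<open>Y\<close> are mutually inverse. Composing with such an isomorphism produces no factor
  \<open>u\<close>, because the exponents in the cocycle identity are natural numbers.\<close>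

lemma cc_iso_left: "cc X Y X = 0 \<Longrightarrow> cc X Y Z = 0"
  using cc_cocycle[of X Y Z X] cc_cocycle[of X Y X Z] by simp

lemma cc_iso_right: "cc X Y X = 0 \<Longrightarrow> cc Z X Y = 0"
  using cc_cocycle[of Z X Y X] by simp

lemma orbit_obj_M: "\<exists>x y. X = obj_M x y"
proof (transfer, goal_cases)
  case (1 p)
  obtain x y e where p: "p = (x, y, e)" by (cases p)
  show ?case
  proof (cases e)
    case Plus
    then show ?thesis using p
      unfolding same_orbit_def by (metis sigma_pow_0)
  next
    case Minus
    then show ?thesis using p
      by (intro exI[of _ "y + pi"] exI[of _ "x + pi"], unfold same_orbit_def, intro exI[of _ 1])
        (simp add: sigma_pow_closed_form)
  qed
qed

lemma width_obj_M [simp]: "width (obj_M x y) = \<bar>x - y\<bar>"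
  by transfer simp

lemma width_psi [simp]: "width (psi_orbit X) = width X"
  by transfer auto

declare psi_orbit_psi_orbit [simp]

text \<open>Every orbit has a representative with sign \<open>Plus\<close>
  (\<open>orbit_obj_M\<close>), and the order ignores signs, so exponents can be computed from pairs
  of reals.\<close>

definition dM :: "real \<Rightarrow> real \<Rightarrow> real \<Rightarrow> real \<Rightarrow> int" where
  "dM x y x' y' = min_exponent (x, y, Plus) (x', y', Plus)"

lemma c_exp_obj_M:
  "c_exp (obj_M x y) (obj_M x' y') (obj_M x'' y'') = dM x y x' y' + dM x' y' x'' y'' - dM x y x'' y''"
  unfolding dM_def by transfer simp

definition le_at :: "int \<Rightarrow> real \<Rightarrow> real \<Rightarrow> real \<Rightarrow> real \<Rightarrow> bool" where
  "le_at i x y x' y' \<longleftrightarrow> (if even i then x \<le> x' + of_int i * pi \<and> y \<le> y' + of_int i * pi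
     else x \<le> y' + of_int i * pi \<and> y \<le> x' + of_int i * pi)"

lemma le_at_point_le: "le_at i x y x' y' \<longleftrightarrow> point_le (x, y, Plus) (sigma_pow i (x', y', Plus))"
  by (auto simp: le_at_def sigma_pow_closed_form)

lemma le_at_dM: "le_at (dM x y x' y') x y x' y'"
  unfolding le_at_point_le dM_def by (rule min_exponent_point_le)

lemma dM_least: "le_at i x y x' y' \<Longrightarrow> dM x y x' y' \<le> i"
  unfolding le_at_point_le dM_def by (rule min_exponent_least)

text \<open>Width at most \<open>pi\<close> says that a point lies below its image under
  \<open>sigma\<close>. So the exponents that satisfy \<open>le_at\<close> form an up-set, and a
  minimal exponent is certified by success at \<open>i\<close> and failure at
  \<open>i - 1\<close>.\<close>

lemma le_at_Suc:
  assumes "le_at i x y x' y'" "\<bar>x' - y'\<bar> \<le> pi"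
  shows "le_at (i + 1) x y x' y'"
  using assms by (auto simp: le_at_def algebra_simps split: if_splits)

lemma le_at_mono:
  assumes "le_at i x y x' y'" "\<bar>x' - y'\<bar> \<le> pi" "i \<le> j"
  shows "le_at j x y x' y'"
  using assms(3,1) by (induction j rule: int_ge_induct) (auto intro: le_at_Suc assms(2))

lemma dM_le_iff: "\<bar>x' - y'\<bar> \<le> pi \<Longrightarrow> dM x y x' y' \<le> i \<longleftrightarrow> le_at i x y x' y'"
  using dM_least le_at_mono le_at_dM by blast

lemma dM_eq:
  assumes "\<bar>x' - y'\<bar> \<le> pi" "le_at i x y x' y'" "\<not> le_at (i - 1) x y x' y'"
  shows "dM x y x' y' = i"
  using assms dM_le_iff[of x' y' x y i] dM_le_iff[of x' y' x y "i - 1"] by linarith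

text \<open>If the two minimal exponents add up to 0, the inequalities in the two directions become
  equalities, so the pairs differ by a power of \<open>sigma\<close>, up to sign.\<close>

lemma cc_obj_M_zero:
  "cc (obj_M x y) (obj_M x' y') (obj_M x y) = 0 \<longleftrightarrow>
    (\<exists>k::int. if even k then x = x' + of_int k * pi \<and> y = y' + of_int k * pi
       else x = y' + of_int k * pi \<and> y = x' + of_int k * pi)" (is "?L \<longleftrightarrow> (\<exists>k. ?R k)")
proof
  have dd: "dM x y x y = 0" by (simp add: dM_def min_exponent_self)
  define k where "k = dM x y x' y'"
  define l where "l = dM x' y' x y"
  have le: "le_at k x y x' y'" "le_at l x' y' x y" by (simp_all add: k_def l_def le_at_dM)
  {
    assume ?L
    then have kl: "l = - k"
      using c_exp_nonneg[of "obj_M x y" "obj_M x' y'" "obj_M x y"]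
      by (simp add: cc_def c_exp_obj_M dd k_def l_def)
    show "\<exists>k. ?R k"
      using le unfolding kl by (intro exI[of _ k]) (auto simp: le_at_def split: if_splits)
  }
  assume "\<exists>k. ?R k"
  then obtain m where m: "?R m" by blast
  have "le_at m x y x' y'" "le_at (- m) x' y' x y" using m by (auto simp: le_at_def split: if_splits)
  then have "k \<le> m" "l \<le> - m" by (auto simp: k_def l_def intro: dM_least)
  then show ?L by (simp add: cc_def c_exp_obj_M dd k_def[symmetric] l_def[symmetric])
qed

lemma cc_zero_width:
  assumes "cc X Y X = 0" shows "width X = width Y"
proof -
  obtain x y where X: "X = obj_M x y" using orbit_obj_M by blast
  obtain x' y' where Y: "Y = obj_M x' y'" using orbit_obj_M by blast
  obtain k :: int where "if even k then x = x' + of_int k * pi \<and> y = y' + of_int k * pi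
       else x = y' + of_int k * pi \<and> y = x' + of_int k * pi"
    using assms unfolding X Y cc_obj_M_zero by blast
  then show ?thesis by (cases "even k") (simp_all add: X Y abs_minus_commute)
qed

text \<open>An even exponent would translate \<open>x\<close> to itself by an odd multiple of
  \<open>pi\<close>. An odd one exchanges the coordinates and forces \<open>x = y\<close>. This
  separates singular from regular summands.\<close>

lemma cc_obj_M_psi:
  "cc (obj_M x y) (psi_orbit (obj_M x y)) (obj_M x y) = 0 \<longleftrightarrow> x = y"
proof -
  have 1: "\<not> (x = x + pi + of_int k * pi)" if "even k" for k :: int
  proof
    assume "x = x + pi + of_int k * pi"
    then have "(1 + of_int k) * pi = 0" by (simp add: algebra_simps)
    then have "1 + real_of_int k = 0" using pi_neq_zero by (metis mult_eq_0_iff)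
    then have "k = -1" by linarith
    then show False using that by simp
  qed
  show ?thesis
    unfolding psi_orbit_M cc_obj_M_zero
  proof
    assume "x = y"
    then show "\<exists>k::int. if even k then x = x + pi + of_int k * pi \<and> y = y + pi + of_int k * pi
       else x = y + pi + of_int k * pi \<and> y = x + pi + of_int k * pi"
      by (intro exI[of _ "-1"]) simp
  next
    assume "\<exists>k::int. if even k then x = x + pi + of_int k * pi \<and> y = y + pi + of_int k * pi
       else x = y + pi + of_int k * pi \<and> y = x + pi + of_int k * pi"
    then obtain k :: int where k: "if even k then x = x + pi + of_int k * pi \<and> y = y + pi + of_int k * pi
       else x = y + pi + of_int k * pi \<and> y = x + pi + of_int k * pi" ..
    show "x = y"
    proof (cases "even k")
      case True
      have "x = x + pi + of_int k * pi" using k unfolding if_P[OF True] by (rule conjunct1)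
      with 1[OF True] show ?thesis by (rule notE)
    next
      case False
      have "x = y + pi + of_int k * pi \<and> y = x + pi + of_int k * pi"
        using k unfolding if_not_P[OF False] .
      then show ?thesis by linarith
    qed
  qed
qed


section \<open>The ring of finitely supported matrices\<close>

text \<open>A morphism between lists of orbits becomes a finitely supported matrix indexed by (position,
  orbit). As an index carries its orbit, the composition twisted by the powers of \<open>u\<close> is a total
  associative operation that does not mention domains and codomains.\<close>

type_synonym idx = "nat \<times> orbit"
type_synonym 'r fm = "(idx \<times> idx) \<Rightarrow>\<^sub>0 'r"

abbreviation lookup where "lookup \<equiv> Poly_Mapping.lookup"
abbreviation keys where "keys \<equiv> Poly_Mapping.keys"
abbreviation single where "single \<equiv> Poly_Mapping.single"

definition smul :: "'r::idom \<Rightarrow> 'r fm \<Rightarrow> 'r fm" (infixr "*s" 75) where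
  "r *s a = Poly_Mapping.map ((*) r) a"

lemma lookup_smul [simp]: "lookup (r *s a) k = r * lookup a k"
  by (simp add: smul_def Poly_Mapping.map.rep_eq when_def)

lemma smul_simps:
  "r *s (a + b) = r *s a + r *s b" "(r + s) *s a = r *s a + s *s a"
  "r *s (s *s a) = (r * s) *s a" "1 *s a = a" "0 *s a = 0" "r *s 0 = 0" "(- r) *s a = - (r *s a)"
  "r *s (- a) = - (r *s a)" "r *s (a - b) = r *s a - r *s b" "(r - s) *s a = r *s a - s *s a"
  by (rule poly_mapping_eqI; simp add: lookup_add lookup_minus algebra_simps)+

lemma smul_single [simp]: "r *s single p a = single p (r * a)"
  by (rule poly_mapping_eqI) (simp add: lookup_single when_def)

definition pj :: "idx \<Rightarrow> idx" where "pj p = (fst p, psi_orbit (snd p))"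

lemma pj_pj [simp]: "pj (pj p) = p" by (simp add: pj_def)
lemma pj_eq_iff: "pj p = q \<longleftrightarrow> p = pj q" by auto
lemma snd_pj [simp]: "snd (pj p) = psi_orbit (snd p)" by (simp add: pj_def)

definition psi :: "'r::idom fm \<Rightarrow> 'r fm" where
  "psi a = Poly_Mapping.map_key (\<lambda>(p, q). (pj p, pj q)) a"

lemma lookup_psi [simp]: "lookup (psi a) (p, q) = lookup a (pj p, pj q)"
proof -
  have "inj (\<lambda>(p, q). (pj p, pj q))" by (auto simp: inj_def pj_def) (metis psi_orbit_psi_orbit)+
  then show ?thesis by (simp add: psi_def Poly_Mapping.map_key.rep_eq)
qed

lemma psi_psi [simp]: "psi (psi a) = a"
  and psi_add [simp]: "psi (a + b) = psi a + psi b"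
  and psi_diff [simp]: "psi (a - b) = psi a - psi b"
  and psi_uminus [simp]: "psi (- a) = - psi a"
  and psi_zero [simp]: "psi 0 = 0"
  and psi_smul [simp]: "psi (r *s a) = r *s psi a"
  by (rule poly_mapping_eqI; auto simp: lookup_add lookup_minus)+

lemma psi_single [simp]: "psi (single (p, q) a) = single (pj p, pj q) a"
  by (rule poly_mapping_eqI) (auto simp: lookup_single when_def pj_eq_iff split: if_splits)

definition cmp_single :: "'r::idom \<Rightarrow> idx \<times> idx \<Rightarrow> 'r \<Rightarrow> idx \<times> idx \<Rightarrow> 'r \<Rightarrow> 'r fm" where
  "cmp_single u p a q b = (if snd p = fst q
     then single (fst p, snd q) (a * b * u ^ cc (snd (snd q)) (snd (fst q)) (snd (fst p))) else 0)"

definition fm_cmp :: "'r::idom \<Rightarrow> 'r fm \<Rightarrow> 'r fm \<Rightarrow> 'r fm" where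
  "fm_cmp u g f = (\<Sum>p\<in>keys g. \<Sum>q\<in>keys f. cmp_single u p (lookup g p) q (lookup f q))"

lemma cmp_single_0 [simp]: "cmp_single u p 0 q b = 0" "cmp_single u p a q 0 = 0"
  by (simp_all add: cmp_single_def)

lemma cmp_single_add:
  "cmp_single u p (a + a') q b = cmp_single u p a q b + cmp_single u p a' q b"
  "cmp_single u p a q (b + b') = cmp_single u p a q b + cmp_single u p a q b'"
  by (simp_all add: cmp_single_def algebra_simps single_add)

text \<open>Zero coefficients contribute nothing. Additivity compares matrices with different
  supports and therefore needs common index sets.\<close>

lemma fm_cmp_superset:
  assumes "finite S" "finite T" "keys g \<subseteq> S" "keys f \<subseteq> T"
  shows "fm_cmp u g f = (\<Sum>p\<in>S. \<Sum>q\<in>T. cmp_single u p (lookup g p) q (lookup f q))"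
proof -
  have "fm_cmp u g f = (\<Sum>p\<in>keys g. \<Sum>q\<in>T. cmp_single u p (lookup g p) q (lookup f q))"
    unfolding fm_cmp_def using assms
    by (intro sum.cong refl sum.mono_neutral_left) (auto simp: in_keys_iff)
  also have "\<dots> = (\<Sum>p\<in>S. \<Sum>q\<in>T. cmp_single u p (lookup g p) q (lookup f q))"
    using assms by (intro sum.mono_neutral_left) (auto simp: in_keys_iff)
  finally show ?thesis .
qed

lemma fm_cmp_add_left: "fm_cmp u (g + g') f = fm_cmp u g f + fm_cmp u g' f"
proof -
  let ?S = "keys g \<union> keys g'"
  have "keys (g + g') \<subseteq> ?S" by (rule Poly_Mapping.keys_add)
  then show ?thesis
    by (simp add: fm_cmp_superset[of ?S "keys f"] lookup_add cmp_single_add sum.distrib)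
qed

lemma fm_cmp_add_right: "fm_cmp u g (f + f') = fm_cmp u g f + fm_cmp u g f'"
proof -
  let ?S = "keys f \<union> keys f'"
  have "keys (f + f') \<subseteq> ?S" by (rule Poly_Mapping.keys_add)
  then show ?thesis
    by (simp add: fm_cmp_superset[of "keys g" ?S] lookup_add cmp_single_add sum.distrib)
qed

lemma fm_cmp_zero: "fm_cmp u 0 f = 0" "fm_cmp u g 0 = 0"
  by (simp_all add: fm_cmp_def)

lemma fm_cmp_single: "fm_cmp u (single p a) (single q b) = cmp_single u p a q b"
  by (cases "a = 0"; cases "b = 0") (simp_all add: fm_cmp_def)

text \<open>Additive identities are thereby reduced to single entries, where all operations are
  explicit.\<close>

lemma fm_induct [case_names single sum]:
  assumes "\<And>k v. P (single k v)" "\<And>f g. P f \<Longrightarrow> P g \<Longrightarrow> P (f + g)"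
  shows "P (a :: 'r::idom fm)"
proof -
  have *: "P (\<Sum>k\<in>S. single k (h k))" if "finite S" for S h
    using that
  proof (induction S rule: finite_induct)
    case empty
    then show ?case using assms(1)[of undefined 0] by simp
  qed (auto intro: assms)
  have "a = (\<Sum>k\<in>keys a. single k (lookup a k))"
    by (rule poly_mapping_eqI) (auto simp: lookup_sum lookup_single when_def in_keys_iff)
  then show ?thesis using *[of "keys a" "lookup a"] by simp
qed

text \<open>On three single entries both bracketings give the same entry, and the exponents of
  \<open>u\<close> agree by \<open>cc_cocycle\<close>.\<close>

lemma fm_cmp_assoc: "fm_cmp u (fm_cmp u h g) f = fm_cmp u h (fm_cmp u g f)"
proof (induction h rule: fm_induct)
  case (single p a)
  show ?case
  proof (induction g rule: fm_induct)
    case (single q b)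
    show ?case
    proof (induction f rule: fm_induct)
      case (single r c)
      have "cc (snd (snd r)) (snd (fst q)) (snd (fst p)) + cc (snd (snd r)) (snd (fst r)) (snd (fst q))
         = cc (snd (fst r)) (snd (fst q)) (snd (fst p)) + cc (snd (snd r)) (snd (fst r)) (snd (fst p))"
        using cc_cocycle[of "snd (snd r)" "snd (fst r)" "snd (fst q)" "snd (fst p)"] by linarith
      then have *: "u ^ cc (snd (snd r)) (snd (fst q)) (snd (fst p)) * u ^ cc (snd (snd r)) (snd (fst r)) (snd (fst q))
         = u ^ cc (snd (fst r)) (snd (fst q)) (snd (fst p)) * u ^ cc (snd (snd r)) (snd (fst r)) (snd (fst p))"
        (is "?W * ?V = ?X * ?Y") by (metis power_add)
      have "a * b * ?X * c * ?Y = a * b * c * (?X * ?Y)" by (simp add: ac_simps)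
      also have "\<dots> = a * (b * c * ?V) * ?W" unfolding *[symmetric] by (simp add: ac_simps)
      finally have eq: "a * b * ?X * c * ?Y = a * (b * c * ?V) * ?W" .
      show ?case
        by (simp add: fm_cmp_single cmp_single_def fm_cmp_zero eq)
    qed (simp add: fm_cmp_add_right)
  qed (simp add: fm_cmp_add_right fm_cmp_add_left)
qed (simp add: fm_cmp_add_left)

lemma fm_cmp_smul: "fm_cmp u (r *s g) f = r *s fm_cmp u g f" "fm_cmp u g (r *s f) = r *s fm_cmp u g f"
proof -
  show "fm_cmp u (r *s g) f = r *s fm_cmp u g f"
  proof (induction g rule: fm_induct)
    case (single p a)
    show ?case
      by (induction f rule: fm_induct)
        (auto simp: fm_cmp_single cmp_single_def smul_simps fm_cmp_add_right algebra_simps)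
  qed (simp add: fm_cmp_add_left smul_simps)
  show "fm_cmp u g (r *s f) = r *s fm_cmp u g f"
  proof (induction g rule: fm_induct)
    case (single p a)
    show ?case
      by (induction f rule: fm_induct)
        (auto simp: fm_cmp_single cmp_single_def smul_simps fm_cmp_add_right algebra_simps)
  qed (simp add: fm_cmp_add_left smul_simps)
qed

lemma fm_cmp_uminus: "fm_cmp u (- g) f = - fm_cmp u g f" "fm_cmp u g (- f) = - fm_cmp u g f"
  using fm_cmp_smul(1)[where r = "-1" and u = u and g = g and f = f]
    fm_cmp_smul(2)[where r = "-1" and u = u and g = g and f = f] by (simp_all add: smul_simps)

lemma fm_cmp_diff: "fm_cmp u (g - g') f = fm_cmp u g f - fm_cmp u g' f"
  "fm_cmp u g (f - f') = fm_cmp u g f - fm_cmp u g f'"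
  using fm_cmp_add_left[of u g "- g'" f] fm_cmp_add_right[of u g f "- f'"]
  by (simp_all add: fm_cmp_uminus)

lemma psi_fm_cmp: "psi (fm_cmp u g f) = fm_cmp u (psi g) (psi f)"
proof (induction g rule: fm_induct)
  case (single p a)
  show ?case
  proof (induction f rule: fm_induct)
    case (single q b)
    show ?case
      by (cases p; cases q) (auto simp: fm_cmp_single cmp_single_def pj_eq_iff)
  qed (simp add: fm_cmp_add_right)
qed (simp add: fm_cmp_add_left)


text \<open>\<open>S\<close> need only contain the middle indices that contribute. In general it is
  the index set of the middle list; when a factor is an inclusion, a projection or an identity, a
  singleton will do and the sum has one term.\<close>

lemma lookup_fm_cmp:
  assumes "finite S" "\<And>j. lookup g (k, j) \<noteq> 0 \<Longrightarrow> lookup f (j, i) \<noteq> 0 \<Longrightarrow> j \<in> S"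
  shows "lookup (fm_cmp u g f) (k, i) =
    (\<Sum>j\<in>S. lookup g (k, j) * lookup f (j, i) * u ^ cc (snd i) (snd j) (snd k))"
proof -
  \<comment> \<open>The supports are put into products with one common middle set \<open>?T\<close>,
    so that the double sum can be contracted along equal middle indices.\<close>
  let ?T = "S \<union> fst ` keys f \<union> snd ` keys g"
  let ?K = "insert k (fst ` keys g)" and ?I = "insert i (snd ` keys f)"
  let ?v = "\<lambda>j. lookup g (k, j) * lookup f (j, i) * u ^ cc (snd i) (snd j) (snd k)"
  have fin: "finite ?T" "finite ?K" "finite ?I" using assms by auto
  have "keys g \<subseteq> ?K \<times> ?T" "keys f \<subseteq> ?T \<times> ?I"
    by (auto simp del: in_keys_iff intro: rev_image_eqI)
  then have "lookup (fm_cmp u g f) (k, i) = (\<Sum>p\<in>?K \<times> ?T. \<Sum>q\<in>?T \<times> ?I.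
      lookup (cmp_single u p (lookup g p) q (lookup f q)) (k, i))"
    using fin by (subst fm_cmp_superset[of "?K \<times> ?T" "?T \<times> ?I"]) (auto simp: lookup_sum)
  also have "\<dots> = (\<Sum>p\<in>?K \<times> ?T. \<Sum>q\<in>?T \<times> ?I.
      if q = (snd p, i) then (if fst p = k then ?v (snd p) else 0) else 0)"
    by (intro sum.cong refl) (auto simp: cmp_single_def lookup_single when_def)
  also have "\<dots> = (\<Sum>p\<in>?K \<times> ?T. if fst p = k then ?v (snd p) else 0)"
  proof (intro sum.cong refl)
    fix p assume "p \<in> ?K \<times> ?T"
    then have "(snd p, i) \<in> ?T \<times> ?I" by (metis SigmaE insertI1 mem_Sigma_iff snd_conv)
    moreover have "finite (?T \<times> ?I)" using fin by blast
    ultimately show "(\<Sum>q\<in>?T \<times> ?I. if q = (snd p, i) then (if fst p = k then ?v (snd p) else 0) else 0)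
        = (if fst p = k then ?v (snd p) else 0)"
      by (simp only: sum.delta if_True)
  qed
  also have "\<dots> = (\<Sum>k'\<in>?K. \<Sum>j\<in>?T. if k' = k then ?v j else 0)"
    by (simp only: sum.cartesian_product' fst_conv snd_conv)
  also have "\<dots> = (\<Sum>k'\<in>?K. if k' = k then \<Sum>j\<in>?T. ?v j else 0)"
    by (intro sum.cong refl) auto
  also have "\<dots> = (\<Sum>j\<in>?T. ?v j)"
    using fin by (subst sum.delta) auto
  also have "\<dots> = (\<Sum>j\<in>S. ?v j)"
  proof (rule sum.mono_neutral_right[OF fin(1)])
    show "\<forall>j\<in>?T - S. ?v j = 0" using assms(2) by (metis DiffD2 mult_zero_left mult_zero_right)
    show "S \<subseteq> ?T" by blast
  qed
  finally show ?thesis .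
qed


section \<open>Supports, identities and zero-one matrices\<close>

definition idx :: "orbit list \<Rightarrow> idx set" where "idx X = (\<lambda>i. (i, X ! i)) ` {..<length X}"

text \<open>Composition ignores domains, so a list only enters as a bound on the support. There is
  no global identity: \<open>one X\<close> acts as one only on matrices supported on
  \<open>X\<close>, whence the \<open>hom\<close> hypotheses wherever identities are
  cancelled.\<close>

definition hom :: "orbit list \<Rightarrow> orbit list \<Rightarrow> 'r::idom fm \<Rightarrow> bool" where
  "hom X Y a \<longleftrightarrow> keys a \<subseteq> idx Y \<times> idx X"

abbreviation psl :: "orbit list \<Rightarrow> orbit list" where "psl \<equiv> map psi_orbit"

lemma psi_orbit_comp [simp]: "psi_orbit \<circ> psi_orbit = id" by (simp add: fun_eq_iff)

lemma pj_inject [simp]: "pj p = pj q \<longleftrightarrow> p = q" by (metis pj_pj)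

lemma finite_idx [simp]: "finite (idx X)" by (simp add: idx_def)

lemma idx_psl: "pj p \<in> idx X \<longleftrightarrow> p \<in> idx (psl X)"
  by (cases p) (auto simp: idx_def pj_def image_iff, metis psi_orbit_psi_orbit)

lemma hom_iff: "hom X Y a \<longleftrightarrow> (\<forall>p q. lookup a (p, q) \<noteq> 0 \<longrightarrow> p \<in> idx Y \<and> q \<in> idx X)"
  unfolding hom_def by (auto simp: subset_iff in_keys_iff)

lemma homI: "(\<And>p q. lookup a (p, q) \<noteq> 0 \<Longrightarrow> p \<in> idx Y \<and> q \<in> idx X) \<Longrightarrow> hom X Y a"
  unfolding hom_iff by blast

lemma homD:
  assumes "hom X Y a" "lookup a (p, q) \<noteq> 0" shows "p \<in> idx Y" "q \<in> idx X"
  using assms unfolding hom_iff by blast+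

lemma hom_zero [simp]: "hom X Y 0" by (rule homI) simp
lemma hom_add: "hom X Y a \<Longrightarrow> hom X Y b \<Longrightarrow> hom X Y (a + b)"
  unfolding hom_iff lookup_add by (metis add_0)
lemma hom_sum: "(\<And>i. i \<in> S \<Longrightarrow> hom X Y (f i)) \<Longrightarrow> hom X Y (sum f S)"
  by (induction S rule: infinite_finite_induct) (auto intro: hom_add)
lemma hom_uminus: "hom X Y a \<Longrightarrow> hom X Y (- a)"
  by (rule homI) (use homD in fastforce)
lemma hom_diff: "hom X Y a \<Longrightarrow> hom X Y b \<Longrightarrow> hom X Y (a - b)"
  using hom_add[of X Y a "- b"] hom_uminus[of X Y b] by simp
lemma hom_smul: "hom X Y a \<Longrightarrow> hom X Y (r *s a)"
  by (rule homI) (use homD in fastforce)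
lemma hom_psi: "hom X Y a \<Longrightarrow> hom (psl X) (psl Y) (psi a)"
  by (rule homI) (metis homD idx_psl lookup_psi)

lemma hom_cmp: "hom Y Z g \<Longrightarrow> hom X Y f \<Longrightarrow> hom X Z (fm_cmp u g f)"
proof -
  assume g: "hom Y Z g" and f: "hom X Y f"
  {
    fix p q assume *: "lookup (fm_cmp u g f) (p, q) \<noteq> 0"
    have l: "lookup (fm_cmp u g f) (p, q) =
       (\<Sum>j\<in>idx Y. lookup g (p, j) * lookup f (j, q) * u ^ cc (snd q) (snd j) (snd p))"
      by (rule lookup_fm_cmp) (rule finite_idx, rule homD(2)[OF g])
    obtain j where "lookup g (p, j) * lookup f (j, q) * u ^ cc (snd q) (snd j) (snd p) \<noteq> 0"
      using *[unfolded l] by (rule sum.not_neutral_contains_not_neutral)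
    then have "lookup g (p, j) \<noteq> 0" "lookup f (j, q) \<noteq> 0" by auto
    then have "p \<in> idx Z \<and> q \<in> idx X" using homD(1)[OF g] homD(2)[OF f] by blast
  }
  then show ?thesis by (rule homI)
qed

definition pm :: "(idx \<times> idx) set \<Rightarrow> 'r::idom fm" where "pm R = (\<Sum>p\<in>R. single p 1)"

lemma lookup_pm: "finite R \<Longrightarrow> lookup (pm R) p = (if p \<in> R then 1 else 0)"
  by (simp add: pm_def lookup_sum lookup_single when_def)

lemma keys_pm: "finite R \<Longrightarrow> keys (pm R :: 'r::idom fm) = R"
  by (auto simp: in_keys_iff lookup_pm split: if_splits)

text \<open>Related indices carry the same orbit, so no power of \<open>u\<close> appears. Each
  column of the right factor has at most one nonzero entry, so every sum over middle indices has at
  most one term.\<close>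

lemma pm_cmp:
  assumes "finite R" "finite R'" "\<And>p q. (p, q) \<in> R \<Longrightarrow> snd p = snd q"
    and "\<And>p q. (p, q) \<in> R' \<Longrightarrow> snd p = snd q"
    and sv: "\<And>p q i. (p, i) \<in> R' \<Longrightarrow> (q, i) \<in> R' \<Longrightarrow> p = q"
  shows "fm_cmp u (pm R) (pm R') = pm (R O R')"
proof (rule poly_mapping_eqI)
  fix ki :: "idx \<times> idx"
  obtain k i where ki: "ki = (k, i)" by (cases ki)
  have fin: "finite (R O R')" using assms by (simp add: finite_relcomp)
  show "lookup (fm_cmp u (pm R) (pm R')) ki = lookup (pm (R O R')) ki"
  proof (cases "\<exists>j. (j, i) \<in> R'")
    case True
    then obtain j where j: "(j, i) \<in> R'" ..
    then have "lookup (fm_cmp u (pm R) (pm R')) (k, i) =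
      (\<Sum>j\<in>{j}. lookup (pm R) (k, j) * lookup (pm R') (j, i) * u ^ cc (snd i) (snd j) (snd k))"
      by (intro lookup_fm_cmp) (auto simp: lookup_pm assms(1,2) dest: sv split: if_splits)
    moreover have "(k, i) \<in> R O R' \<longleftrightarrow> (k, j) \<in> R" using j sv by blast
    ultimately show ?thesis using j assms(3)[of k j] assms(4)[of j i]
      by (simp add: ki lookup_pm assms(1,2) fin)
  next
    case False
    then have "lookup (fm_cmp u (pm R) (pm R')) (k, i) =
      (\<Sum>j\<in>{}. lookup (pm R) (k, j) * lookup (pm R') (j, i) * u ^ cc (snd i) (snd j) (snd k))"
      by (intro lookup_fm_cmp) (auto simp: lookup_pm assms(1,2) split: if_splits)
    then show ?thesis using False by (auto simp: ki lookup_pm fin)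
  qed
qed

lemma psi_pm: "finite R \<Longrightarrow> psi (pm R) = pm ((\<lambda>(p, q). (pj p, pj q)) ` R)"
proof (rule poly_mapping_eqI)
  fix k :: "idx \<times> idx" assume fin: "finite R"
  obtain p q where k: "k = (p, q)" by (cases k)
  have "(pj p, pj q) \<in> R \<longleftrightarrow> (p, q) \<in> (\<lambda>(p, q). (pj p, pj q)) ` R"
    by (auto intro: rev_image_eqI[of "(pj p, pj q)"])
  then show "lookup (psi (pm R)) k = lookup (pm ((\<lambda>(p, q). (pj p, pj q)) ` R)) k"
    by (simp add: k lookup_pm fin)
qed

definition one :: "orbit list \<Rightarrow> 'r::idom fm" where "one X = pm (Id_on (idx X))"

lemma lookup_one': "lookup (one X) (p, q) = (if p = q \<and> p \<in> idx X then 1 else 0)"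
  by (auto simp: one_def lookup_pm Id_on_def)

lemma hom_one [simp]: "hom X X (one X)"
  by (rule homI) (simp add: lookup_one' split: if_splits)

lemma psi_one [simp]: "psi (one X) = one (psl X)"
  by (rule poly_mapping_eqI) (auto simp: lookup_one' idx_psl split: if_splits)

lemma one_cmp: "hom X Y a \<Longrightarrow> fm_cmp u (one Y) a = a"
proof (rule poly_mapping_eqI, goal_cases)
  case (1 ki)
  obtain k i where ki: "ki = (k, i)" by (cases ki)
  have "lookup (fm_cmp u (one Y) a) (k, i) =
     (\<Sum>j\<in>{k}. lookup (one Y) (k, j) * lookup a (j, i) * u ^ cc (snd i) (snd j) (snd k))"
    by (rule lookup_fm_cmp) (auto simp: lookup_one' split: if_splits)
  then show ?case using homD[OF 1] by (cases "lookup a ki = 0") (auto simp: ki lookup_one')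
qed

lemma cmp_one: "hom X Y a \<Longrightarrow> fm_cmp u a (one X) = a"
proof (rule poly_mapping_eqI, goal_cases)
  case (1 ki)
  obtain k i where ki: "ki = (k, i)" by (cases ki)
  have "lookup (fm_cmp u a (one X)) (k, i) =
     (\<Sum>j\<in>{i}. lookup a (k, j) * lookup (one X) (j, i) * u ^ cc (snd i) (snd j) (snd k))"
    by (rule lookup_fm_cmp) (auto simp: lookup_one' split: if_splits)
  then show ?case using homD[OF 1] by (cases "lookup a ki = 0") (auto simp: ki lookup_one')
qed

section \<open>Inclusions and projections of selected summands\<close>

definition sub :: "orbit list \<Rightarrow> nat list \<Rightarrow> orbit list" where "sub X ks = map ((!) X) ks"

definition inc_rel :: "orbit list \<Rightarrow> nat list \<Rightarrow> (idx \<times> idx) set" where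
  "inc_rel X ks = (\<lambda>t. ((ks ! t, X ! (ks ! t)), (t, X ! (ks ! t)))) ` {..<length ks}"

definition inc :: "orbit list \<Rightarrow> nat list \<Rightarrow> 'r::idom fm" where "inc X ks = pm (inc_rel X ks)"
definition prj :: "orbit list \<Rightarrow> nat list \<Rightarrow> 'r::idom fm" where "prj X ks = pm (converse (inc_rel X ks))"

lemma finite_inc_rel [simp]: "finite (inc_rel X ks)" by (simp add: inc_rel_def)

lemma hom_pm: "finite R \<Longrightarrow> hom X Y (pm R) \<longleftrightarrow> R \<subseteq> idx Y \<times> idx X"
  by (simp add: hom_def keys_pm)

lemma hom_inc: "set ks \<subseteq> {..<length X} \<Longrightarrow> hom (sub X ks) X (inc X ks)"
  by (auto simp: inc_def hom_pm inc_rel_def idx_def sub_def image_iff subset_iff)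

lemma hom_prj: "set ks \<subseteq> {..<length X} \<Longrightarrow> hom X (sub X ks) (prj X ks)"
  by (auto simp: prj_def hom_pm inc_rel_def idx_def sub_def image_iff subset_iff)

lemma prj_inc: "distinct ks \<Longrightarrow> fm_cmp u (prj X ks) (inc X ks) = one (sub X ks)"
  unfolding prj_def inc_def one_def
  by (subst pm_cmp) (auto simp: inc_rel_def idx_def sub_def relcomp_unfold image_iff Id_on_def
      nth_eq_iff_index_eq intro!: arg_cong[where f = pm])

lemma prj_inc_disjoint: "set ks \<inter> set ks' = {} \<Longrightarrow> fm_cmp u (prj X ks') (inc X ks) = 0"
proof -
  assume "set ks \<inter> set ks' = {}"
  then have "converse (inc_rel X ks') O inc_rel X ks = {}"
    by (auto simp: inc_rel_def) (metis IntI empty_iff nth_mem)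
  then show ?thesis unfolding prj_def inc_def
    by (subst pm_cmp) (auto simp: inc_rel_def pm_def)
qed

lemma inc_prj: "distinct ks \<Longrightarrow>
    fm_cmp u (inc X ks) (prj X ks) = pm ((\<lambda>i. ((i, X ! i), (i, X ! i))) ` set ks)"
  unfolding prj_def inc_def
  by (subst pm_cmp) (auto simp: inc_rel_def relcomp_unfold image_iff in_set_conv_nth
      nth_eq_iff_index_eq intro!: arg_cong[where f = pm])

lemma inc_prj_sum:
  assumes "distinct ks" "distinct ks'" "set ks \<inter> set ks' = {}" "set ks \<union> set ks' = {..<length X}"
  shows "fm_cmp u (inc X ks) (prj X ks) + fm_cmp u (inc X ks') (prj X ks') = one X"
proof -
  have "one X = pm ((\<lambda>i. ((i, X ! i), (i, X ! i))) ` (set ks \<union> set ks'))"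
    unfolding one_def assms(4) idx_def by (intro arg_cong[where f = pm]) auto
  also have "\<dots> = pm ((\<lambda>i. ((i, X ! i), (i, X ! i))) ` set ks) + pm ((\<lambda>i. ((i, X ! i), (i, X ! i))) ` set ks')"
    unfolding pm_def image_Un using assms(3) by (intro sum.union_disjoint) auto
  finally show ?thesis unfolding inc_prj[OF assms(1)] inc_prj[OF assms(2)] by (rule sym)
qed

lemma pj_inc_rel: "set ks \<subseteq> {..<length X} \<Longrightarrow>
    (\<lambda>(p, q). (pj p, pj q)) ` inc_rel X ks = inc_rel (psl X) ks"
  by (auto simp: inc_rel_def image_image pj_def subset_iff intro!: image_cong)

lemma pj_converse: "(\<lambda>(p, q). (pj p, pj q)) ` converse R = converse ((\<lambda>(p, q). (pj p, pj q)) ` R)"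
  by force

lemma psi_inc: "set ks \<subseteq> {..<length X} \<Longrightarrow> psi (inc X ks) = inc (psl X) ks"
  and psi_prj: "set ks \<subseteq> {..<length X} \<Longrightarrow> psi (prj X ks) = prj (psl X) ks"
  by (simp_all add: inc_def prj_def psi_pm pj_converse pj_inc_rel)

definition in1 :: "orbit list \<Rightarrow> orbit list \<Rightarrow> 'r::idom fm" where "in1 X Y = inc (X @ Y) [0..<length X]"
definition in2 :: "orbit list \<Rightarrow> orbit list \<Rightarrow> 'r::idom fm" where
  "in2 X Y = inc (X @ Y) [length X..<length X + length Y]"
definition pr1 :: "orbit list \<Rightarrow> orbit list \<Rightarrow> 'r::idom fm" where "pr1 X Y = prj (X @ Y) [0..<length X]"
definition pr2 :: "orbit list \<Rightarrow> orbit list \<Rightarrow> 'r::idom fm" where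
  "pr2 X Y = prj (X @ Y) [length X..<length X + length Y]"

lemma sub_append: "sub (X @ Y) [0..<length X] = X" "sub (X @ Y) [length X..<length X + length Y] = Y"
  by (rule nth_equalityI; simp add: sub_def nth_append)+

lemma hom_in1 [simp]: "hom X (X @ Y) (in1 X Y)" and hom_in2 [simp]: "hom Y (X @ Y) (in2 X Y)"
  and hom_pr1 [simp]: "hom (X @ Y) X (pr1 X Y)" and hom_pr2 [simp]: "hom (X @ Y) Y (pr2 X Y)"
  using hom_inc[of "[0..<length X]" "X @ Y"] hom_inc[of "[length X..<length X + length Y]" "X @ Y"]
    hom_prj[of "[0..<length X]" "X @ Y"] hom_prj[of "[length X..<length X + length Y]" "X @ Y"]
  by (simp_all add: in1_def in2_def pr1_def pr2_def sub_append subset_iff)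

lemma pr_in:
  "fm_cmp u (pr1 X Y) (in1 X Y) = one X" "fm_cmp u (pr2 X Y) (in2 X Y) = one Y"
  "fm_cmp u (pr1 X Y) (in2 X Y) = 0" "fm_cmp u (pr2 X Y) (in1 X Y) = 0"
  by (simp_all add: in1_def in2_def pr1_def pr2_def prj_inc sub_append prj_inc_disjoint ivl_disj_int)

lemma in_pr: "fm_cmp u (in1 X Y) (pr1 X Y) + fm_cmp u (in2 X Y) (pr2 X Y) = one (X @ Y)"
  unfolding in1_def in2_def pr1_def pr2_def by (rule inc_prj_sum) auto

lemma psi_in_pr [simp]: "psi (in1 X Y) = in1 (psl X) (psl Y)" "psi (in2 X Y) = in2 (psl X) (psl Y)"
  "psi (pr1 X Y) = pr1 (psl X) (psl Y)" "psi (pr2 X Y) = pr2 (psl X) (psl Y)"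
  by (simp_all add: in1_def in2_def pr1_def pr2_def psi_inc psi_prj subset_iff)

section \<open>Basic morphisms and matrix coefficients\<close>

definition bas :: "orbit \<Rightarrow> orbit \<Rightarrow> 'r::idom fm" where "bas m n = single ((0, n), (0, m)) 1"

lemma idx_single [simp]: "idx [m] = {(0, m)}" by (auto simp: idx_def)

lemma hom_bas [simp]: "hom [m] [n] (bas m n)" by (simp add: bas_def hom_def)

lemma hom_single_iff: "hom [m] [n] a \<longleftrightarrow> (\<exists>r. a = r *s bas m n)"
proof
  assume "hom [m] [n] a"
  then have "a = lookup a ((0, n), (0, m)) *s bas m n"
    by (intro poly_mapping_eqI) (auto simp: bas_def lookup_single when_def dest: homD)
  then show "\<exists>r. a = r *s bas m n" ..
qed (auto intro: hom_smul)

lemma bas_cmp: "fm_cmp u (bas n k) (bas m n) = u ^ cc m n k *s bas m k"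
  by (simp add: bas_def fm_cmp_single cmp_single_def)

lemma bas_cmp_assoc: "fm_cmp u (bas n k) (fm_cmp u (bas m n) a) = u ^ cc m n k *s fm_cmp u (bas m k) a"
  by (simp add: fm_cmp_assoc[symmetric] bas_cmp fm_cmp_smul)

lemma one_single: "one [m] = bas m m"
  by (rule poly_mapping_eqI) (auto simp: lookup_one' bas_def lookup_single when_def split: if_splits)

lemma psi_bas [simp]: "psi (bas m n) = bas (psi_orbit m) (psi_orbit n)"
  by (simp add: bas_def pj_def)

lemma smul_bas_eq_iff: "r *s bas m n = s *s bas m n \<longleftrightarrow> r = s"
  unfolding bas_def by (metis lookup_single_eq mult.right_neutral smul_single)

lemma bas_eq_0_iff: "r *s bas m n = 0 \<longleftrightarrow> r = 0"
  using smul_bas_eq_iff[of r m n 0] by (simp add: smul_simps)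

definition ent :: "orbit list \<Rightarrow> orbit list \<Rightarrow> 'r::idom fm \<Rightarrow> nat \<Rightarrow> nat \<Rightarrow> 'r" where
  "ent X Y a j i = lookup a ((j, Y ! j), (i, X ! i))"

lemma lookup_fm_cmp_hom:
  "hom Y Z g \<or> hom X Y f \<Longrightarrow> lookup (fm_cmp u g f) (k, i) =
     (\<Sum>j\<in>idx Y. lookup g (k, j) * lookup f (j, i) * u ^ cc (snd i) (snd j) (snd k))"
  by (elim disjE; rule lookup_fm_cmp) (simp, erule (1) homD | simp)+

lemma sum_idx: "(\<Sum>p\<in>idx X. f p) = (\<Sum>i<length X. f (i, X ! i))"
  unfolding idx_def by (subst sum.reindex) (auto simp: inj_on_def)

lemma ent_cmp: "hom Y Z g \<or> hom X Y f \<Longrightarrow> ent X Z (fm_cmp u g f) k i =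
    (\<Sum>j<length Y. ent Y Z g k j * ent X Y f j i * u ^ cc (X ! i) (Y ! j) (Z ! k))"
  unfolding ent_def by (simp add: lookup_fm_cmp_hom sum_idx)

text \<open>Composing with the inclusion and projection of single summands turns a coefficient into
  a multiple of a basic morphism, which the algebra of composition can handle.\<close>

lemma ent_prj_inc:
  assumes "hom X Y a" "i < length X" "j < length Y"
  shows "fm_cmp u (prj Y [j]) (fm_cmp u a (inc X [i])) = ent X Y a j i *s bas (X ! i) (Y ! j)"
proof -
  have r: "inc_rel X [i] = {((i, X ! i), (0, X ! i))}" for X i by (auto simp: inc_rel_def)
  have c: "converse {(p, q)} = {(q, p)}" for p q :: idx by auto
  have "hom [X ! i] [Y ! j] (fm_cmp u (prj Y [j]) (fm_cmp u a (inc X [i])))"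
    using hom_inc[of "[i]" X] hom_prj[of "[j]" Y] assms by (auto simp: sub_def intro!: hom_cmp)
  then obtain r where r': "fm_cmp u (prj Y [j]) (fm_cmp u a (inc X [i])) = r *s bas (X ! i) (Y ! j)"
    by (auto simp: hom_single_iff)
  have i: "inc X [i] = single ((i, X ! i), (0, X ! i)) 1" "prj Y [j] = single ((0, Y ! j), (j, Y ! j)) 1"
    by (simp_all add: inc_def prj_def r pm_def c)
  have "lookup (fm_cmp u (prj Y [j]) (fm_cmp u a (inc X [i]))) ((0, Y ! j), (0, X ! i))
     = (\<Sum>k\<in>{(j, Y ! j)}. lookup (prj Y [j]) ((0, Y ! j), k) * lookup (fm_cmp u a (inc X [i])) (k, (0, X ! i))
         * u ^ cc (X ! i) (snd k) (Y ! j))"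
    by (subst lookup_fm_cmp[where S = "{(j, Y ! j)}"]) (auto simp: i lookup_single when_def split: if_splits)
  also have "\<dots> = lookup (fm_cmp u a (inc X [i])) ((j, Y ! j), (0, X ! i))"
    by (simp add: i)
  also have "\<dots> = (\<Sum>k\<in>{(i, X ! i)}. lookup a ((j, Y ! j), k) * lookup (inc X [i]) (k, (0, X ! i))
         * u ^ cc (X ! i) (snd k) (Y ! j))"
    by (subst lookup_fm_cmp[where S = "{(i, X ! i)}"]) (auto simp: i lookup_single when_def split: if_splits)
  finally have "lookup (fm_cmp u (prj Y [j]) (fm_cmp u a (inc X [i]))) ((0, Y ! j), (0, X ! i)) = ent X Y a j i"
    by (simp add: i ent_def)
  then show ?thesis unfolding r' by (simp add: bas_def)
qed

lemma ent_one: "i < length X \<Longrightarrow> ent X X (one X) i i = 1"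
  by (simp add: ent_def lookup_one' idx_def)

lemma ent_psi: "i < length X \<Longrightarrow> j < length Y \<Longrightarrow> ent (psl X) (psl Y) (psi a) j i = ent X Y a j i"
  by (simp add: ent_def pj_def)


section \<open>The arrows of \<open>F\<^sub>b\<close> as matrices\<close>

definition Tr :: "orbit list \<Rightarrow> 'r::idom fm \<Rightarrow> orbit list \<Rightarrow> 'r farrow" where
  "Tr X a Y = (X, mat (length Y) (length X) (\<lambda>(j, i). ent X Y a j i), Y)"

text \<open>\<open>Tr\<close> records only the entries at positions of \<open>X\<close> and
  \<open>Y\<close>; the support conditions guarantee that nothing else is lost. With
  \<open>Tr_surj\<close>, every arrow of \<open>cat_F\<close> may be replaced by a matrix.\<close>

lemma Tr_inj: "hom X Y a \<Longrightarrow> hom X Y b \<Longrightarrow> Tr X a Y = Tr X b Y \<longleftrightarrow> a = b"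
proof
  assume h: "hom X Y a" "hom X Y b" and eq: "Tr X a Y = Tr X b Y"
  have e: "ent X Y a j i = ent X Y b j i" if "i < length X" "j < length Y" for i j
  proof -
    have "mat (length Y) (length X) (\<lambda>(j, i). ent X Y a j i) $$ (j, i)
        = mat (length Y) (length X) (\<lambda>(j, i). ent X Y b j i) $$ (j, i)"
      using eq by (simp add: Tr_def)
    then show ?thesis using that by simp
  qed
  show "a = b"
  proof (rule poly_mapping_eqI)
    fix pq :: "idx \<times> idx"
    obtain p q where pq: "pq = (p, q)" by (cases pq)
    show "lookup a pq = lookup b pq"
    proof (cases "p \<in> idx Y \<and> q \<in> idx X")
      case True
      then obtain i j where "p = (j, Y ! j)" "q = (i, X ! i)" "i < length X" "j < length Y"
        by (auto simp: idx_def)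
      then show ?thesis using e[of i j] by (simp add: pq ent_def)
    next
      case False
      then show ?thesis using h by (metis hom_iff pq)
    qed
  qed
qed simp

lemma Tr_surj:
  assumes "f \<in> carrier_mat (length Y) (length X)"
  shows "\<exists>a. hom X Y a \<and> (X, f, Y) = Tr X a Y"
proof -
  define a where "a = (\<Sum>(j, i)\<in>{..<length Y} \<times> {..<length X}. single ((j, Y ! j), (i, X ! i)) (f $$ (j, i)))"
  have "hom X Y a" unfolding a_def
    by (rule hom_sum) (auto simp: hom_def idx_def split: if_splits)
  moreover have "ent X Y a j i = f $$ (j, i)" if "i < length X" "j < length Y" for i j
  proof -
    have "ent X Y a j i = (\<Sum>x\<in>{..<length Y} \<times> {..<length X}. if x = (j, i) then f $$ (j, i) else 0)"
      unfolding a_def ent_def lookup_sum by (rule sum.cong) (auto simp: lookup_single when_def split: if_splits)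
    also have "\<dots> = f $$ (j, i)" using that by (subst sum.delta) auto
    finally show ?thesis .
  qed
  ultimately show ?thesis using assms unfolding Tr_def
    by (intro exI[of _ a]) (auto intro!: eq_matI)
qed

lemma Tr_cmp: "hom Y Z g \<Longrightarrow> F_cmp u (Tr Y g Z) (Tr X f Y) = Tr X (fm_cmp u g f) Z"
  unfolding Tr_def by (auto intro!: eq_matI simp: ent_cmp[where Y = Y] cc_def)

lemma Tr_add: "F_add (Tr X a Y) (Tr X b Y) = Tr X (a + b) Y"
  unfolding Tr_def by (auto intro!: eq_matI simp: ent_def lookup_add)

lemma Tr_psi: "psi_arrow (Tr X a Y) = Tr (psl X) (psi a) (psl Y)"
  unfolding Tr_def by (auto intro!: eq_matI simp: ent_psi)

lemma Tr_one: "Tr X (one X) X = (X, 1\<^sub>m (length X), X)"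
  unfolding Tr_def by (auto intro!: eq_matI simp: ent_def lookup_one' idx_def)

lemma Tr_zero: "Tr X 0 Y = (X, 0\<^sub>m (length Y) (length X), Y)"
  unfolding Tr_def by (auto intro!: eq_matI simp: ent_def)

definition ob :: "real \<Rightarrow> orbit list \<Rightarrow> bool" where "ob b X \<longleftrightarrow> (\<forall>m\<in>set X. width m \<le> b)"

lemma Ob_F: "X \<in> Ob (cat_F u b) \<longleftrightarrow> ob b X" by (simp add: cat_F_def ob_def)

lemma Arr_F: "f \<in> Arr (cat_F u b) \<longleftrightarrow> (\<exists>X a Y. f = Tr X a Y \<and> hom X Y a \<and> ob b X \<and> ob b Y)"
proof
  assume "f \<in> Arr (cat_F u b)"
  then obtain X m Y where "f = (X, m, Y)" "ob b X" "ob b Y" "m \<in> carrier_mat (length Y) (length X)"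
    by (auto simp: cat_F_def ob_def)
  then show "\<exists>X a Y. f = Tr X a Y \<and> hom X Y a \<and> ob b X \<and> ob b Y" using Tr_surj by metis
qed (auto simp: cat_F_def ob_def Tr_def)

lemma Dom_Cod_F [simp]: "Dom (cat_F u b) (Tr X a Y) = X" "Cod (cat_F u b) (Tr X a Y) = Y"
  by (simp_all add: cat_F_def Tr_def)

lemma Tr_mem_Arr [simp]: "hom X Y a \<Longrightarrow> ob b X \<Longrightarrow> ob b Y \<Longrightarrow> Tr X a Y \<in> Arr (cat_F u b)"
  by (auto simp: Arr_F)

lemma Tr_homs [simp]: "hom X Y a \<Longrightarrow> ob b X \<Longrightarrow> ob b Y \<Longrightarrow> Tr X a Y \<in> homs (cat_F u b) X Y"
  by (auto simp: homs_def)

lemma homs_F: "f \<in> homs (cat_F u b) X Y \<longleftrightarrow> (\<exists>a. f = Tr X a Y \<and> hom X Y a \<and> ob b X \<and> ob b Y)"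
  by (auto simp: homs_def Arr_F)

lemma Cmp_F: "hom Y Z g \<Longrightarrow> Cmp (cat_F u b) (Tr Y g Z) (Tr X f Y) = Tr X (fm_cmp u g f) Z"
  by (simp add: cat_F_def Tr_cmp)

lemma Id_F: "Id (cat_F u b) X = Tr X (one X) X" by (simp add: cat_F_def Tr_one)
lemma Zer_F: "Zer (cat_F u b) X Y = Tr X 0 Y" by (simp add: cat_F_def Tr_zero)
lemma Add_F: "Add (cat_F u b) (Tr X a Y) (Tr X b' Y) = Tr X (a + b') Y" by (simp add: cat_F_def Tr_add)

lemma ob_append [simp]: "ob b (X @ Y) \<longleftrightarrow> ob b X \<and> ob b Y" by (auto simp: ob_def)
lemma ob_psl [simp]: "ob b (psl X) \<longleftrightarrow> ob b X" by (auto simp: ob_def)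
lemma ob_Nil [simp]: "ob b []" by (auto simp: ob_def)


section \<open>Boundary objects and exact structures\<close>

definition bd :: "real \<Rightarrow> orbit list \<Rightarrow> bool" where "bd b P \<longleftrightarrow> (\<forall>m\<in>set P. width m = b)"

lemma bd_append [simp]: "bd b (P @ Q) \<longleftrightarrow> bd b P \<and> bd b Q" by (auto simp: bd_def)
lemma bd_psl [simp]: "bd b (psl P) \<longleftrightarrow> bd b P" by (auto simp: bd_def)
lemma bd_Nil [simp]: "bd b []" by (simp add: bd_def)
lemma bd_ob: "bd b P \<Longrightarrow> ob b P" by (simp add: bd_def ob_def)

lemma hom_Nil: "hom X [] a \<longleftrightarrow> a = 0" "hom [] X a \<longleftrightarrow> a = 0"
  by (auto simp: hom_def idx_def)

lemma admissible_monoI: "(i, p) \<in> E \<Longrightarrow> admissible_mono E i"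
  unfolding admissible_mono_def by (rule exI)

context dvr
begin

abbreviation cmp :: "'r fm \<Rightarrow> 'r fm \<Rightarrow> 'r fm" (infixl "\<star>" 70) where "g \<star> f \<equiv> fm_cmp u g f"

lemmas cmps = fm_cmp_assoc fm_cmp_add_left fm_cmp_add_right fm_cmp_diff fm_cmp_smul fm_cmp_uminus
  fm_cmp_zero

text \<open>The versions with a trailing factor \<open>c\<close> match the right-nested form into
  which \<open>fm_cmp_assoc\<close> rewrites composites.\<close>

lemma ones:
  assumes "hom X Y a"
  shows "one Y \<star> a = a" "one Y \<star> (a \<star> c) = a \<star> c" "a \<star> one X = a" "a \<star> (one X \<star> c) = a \<star> c"
  using one_cmp[OF assms, of u] cmp_one[OF assms, of u] by (simp_all add: fm_cmp_assoc[symmetric])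

lemma one_one [simp]: "one X \<star> one X = one X" using ones[OF hom_one] by simp

lemma one_in_pr [simp]:
  "one (X @ Y) \<star> in1 X Y = in1 X Y" "in1 X Y \<star> one X = in1 X Y"
  "one (X @ Y) \<star> in2 X Y = in2 X Y" "in2 X Y \<star> one Y = in2 X Y"
  "one X \<star> pr1 X Y = pr1 X Y" "pr1 X Y \<star> one (X @ Y) = pr1 X Y"
  "one Y \<star> pr2 X Y = pr2 X Y" "pr2 X Y \<star> one (X @ Y) = pr2 X Y"
  "in1 X Y \<star> (one X \<star> a) = in1 X Y \<star> a" "in2 X Y \<star> (one Y \<star> a) = in2 X Y \<star> a"
  "one X \<star> (pr1 X Y \<star> a) = pr1 X Y \<star> a" "one Y \<star> (pr2 X Y \<star> a) = pr2 X Y \<star> a"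
  by (simp_all add: ones[OF hom_in1] ones[OF hom_in2] ones[OF hom_pr1] ones[OF hom_pr2])

lemmas [simp] = pr_in

lemma pr_in' [simp]:
  "pr1 X Y \<star> (in1 X Y \<star> a) = one X \<star> a" "pr2 X Y \<star> (in2 X Y \<star> a) = one Y \<star> a"
  "pr1 X Y \<star> (in2 X Y \<star> a) = 0" "pr2 X Y \<star> (in1 X Y \<star> a) = 0"
  by (simp_all add: fm_cmp_assoc[symmetric] fm_cmp_zero)

lemma split_left: "hom Z (X @ Y) a \<Longrightarrow> a = in1 X Y \<star> (pr1 X Y \<star> a) + in2 X Y \<star> (pr2 X Y \<star> a)"
  using one_cmp[of Z "X @ Y" a u] by (simp add: in_pr[symmetric, of _ _ u] cmps)

lemma split_right: "hom (X @ Y) Z a \<Longrightarrow> a = a \<star> (in1 X Y \<star> pr1 X Y) + a \<star> (in2 X Y \<star> pr2 X Y)"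
  using cmp_one[of "X @ Y" Z a u] by (simp add: in_pr[symmetric, of _ _ u] cmps)

text \<open>The maps that become 0 in the stable category. The definition lives in
  \<open>cat_F\<close>; for equivariant maps the involution on the middle object is supplied by
  \<open>factors_FP\<close>.\<close>

definition NN :: "real \<Rightarrow> orbit list \<Rightarrow> orbit list \<Rightarrow> 'r fm \<Rightarrow> bool" where
  "NN b X Y a \<longleftrightarrow> (\<exists>P g h. bd b P \<and> hom X P g \<and> hom P Y h \<and> a = h \<star> g)"

lemma NN_add: assumes "NN b X Y a" "NN b X Y c" shows "NN b X Y (a + c)"
proof -
  obtain P g h where 1: "bd b P" "hom X P g" "hom P Y h" "a = h \<star> g" using assms(1) by (auto simp: NN_def)
  obtain Q g' h' where 2: "bd b Q" "hom X Q g'" "hom Q Y h'" "c = h' \<star> g'" using assms(2) by (auto simp: NN_def)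
  show ?thesis unfolding NN_def
  proof (intro exI conjI)
    show "bd b (P @ Q)" using 1 2 by simp
    show "hom X (P @ Q) (in1 P Q \<star> g + in2 P Q \<star> g')"
      using 1 2 by (intro hom_add) (auto intro: hom_cmp hom_in1 hom_in2)
    show "hom (P @ Q) Y (h \<star> pr1 P Q + h' \<star> pr2 P Q)"
      using 1 2 by (intro hom_add) (auto intro: hom_cmp hom_pr1 hom_pr2)
    show "a + c = (h \<star> pr1 P Q + h' \<star> pr2 P Q) \<star> (in1 P Q \<star> g + in2 P Q \<star> g')"
      using 1 2 by (simp add: cmps ones[OF 1(2)] ones[OF 2(2)])
  qed
qed

lemma NN_smul: "NN b X Y a \<Longrightarrow> NN b X Y (r *s a)"
  unfolding NN_def by (elim exE conjE) (intro exI conjI, assumption, assumption, rule hom_smul, assumption, simp add: fm_cmp_smul)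
lemma NN_uminus: "NN b X Y a \<Longrightarrow> NN b X Y (- a)"
  using NN_smul[of b X Y a "-1"] by (simp add: smul_simps)
lemma NN_diff: "NN b X Y a \<Longrightarrow> NN b X Y c \<Longrightarrow> NN b X Y (a - c)"
  using NN_add[of b X Y a "- c"] NN_uminus by simp
lemma NN_zero: "NN b X Y 0"
  unfolding NN_def by (intro exI[of _ "[]"] exI[of _ 0]) (simp add: fm_cmp_zero)
lemma NNI: "bd b P \<Longrightarrow> hom X P g \<Longrightarrow> hom P Y h \<Longrightarrow> NN b X Y (h \<star> g)"
  unfolding NN_def by blast
lemma NNE:
  assumes "NN b X Y a"
  obtains P g h where "bd b P" "hom X P g" "hom P Y h" "a = h \<star> g"
  using assms unfolding NN_def by blast
lemma NN_left: "NN b X Y a \<Longrightarrow> hom Y Z h \<Longrightarrow> NN b X Z (h \<star> a)"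
  by (erule NNE) (simp add: fm_cmp_assoc[symmetric] NNI hom_cmp)
lemma NN_right: "NN b X Y a \<Longrightarrow> hom Z X h \<Longrightarrow> NN b Z Y (a \<star> h)"
  by (erule NNE) (simp add: fm_cmp_assoc NNI hom_cmp)
lemma NN_psi: "NN b X Y a \<Longrightarrow> NN b (psl X) (psl Y) (psi a)"
  by (erule NNE) (auto simp: psi_fm_cmp intro: hom_psi NNI[of b "psl P" for P])

text \<open>The coefficient of a composite through \<open>P\<close> is a sum over the positions of
  \<open>P\<close>. If it is a unit, so is some term, and the orbit in that term contributes
  \<open>u\<close> to the power 0.\<close>

lemma NN_bas_iff: "NN b [m] [n] (r *s bas m n) \<Longrightarrow> r dvd 1 \<Longrightarrow> \<exists>q. width q = b \<and> cc m q n = 0"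
proof -
  assume "NN b [m] [n] (r *s bas m n)" and r: "r dvd 1"
  then obtain P g h where P: "bd b P" "hom [m] P g" "hom P [n] h" "r *s bas m n = h \<star> g" by (auto simp: NN_def)
  have "ent [m] [n] (r *s bas m n) 0 0 = r" by (simp add: ent_def bas_def)
  moreover have "ent [m] [n] (h \<star> g) 0 0 = (\<Sum>j<length P. ent P [n] h 0 j * ent [m] P g j 0 * u ^ cc m (P ! j) n)"
    using ent_cmp[of P "[n]" h "[m]" g u 0 0] P by simp
  ultimately have "(\<Sum>j<length P. ent P [n] h 0 j * ent [m] P g j 0 * u ^ cc m (P ! j) n) dvd 1"
    using P r by simp
  then obtain j where "j < length P" "u ^ cc m (P ! j) n dvd 1"
    using nonunit_sum[of "{..<length P}"] unit_mult by blast
  then show ?thesis using P(1) unit_u_power by (auto simp: bd_def intro!: exI[of _ "P ! j"])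
qed

lemma NN_bas: "width q = b \<Longrightarrow> cc m q n = 0 \<Longrightarrow> NN b [m] [n] (bas m n)"
  unfolding NN_def
  by (intro exI[of _ "[q]"] exI[of _ "bas m q"] exI[of _ "bas q n"]) (simp add: bd_def bas_cmp smul_simps)

lemma is_iso_Tr:
  assumes "hom X Y f" "hom Y X g" "g \<star> f = one X" "f \<star> g = one Y" "ob b X" "ob b Y"
  shows "is_isomorphism (cat_F u b) (Tr X f Y)"
  unfolding is_isomorphism_def using assms
  by (auto simp: Id_F Cmp_F intro!: bexI[of _ "Tr Y g X"])

lemma is_iso_one: "ob b X \<Longrightarrow> is_isomorphism (cat_F u b) (Tr X (one X) X)"
  by (rule is_iso_Tr[of X X "one X" "one X"]) simp_all

lemma is_iso_TrD:
  assumes "is_isomorphism (cat_F u b) (Tr X f Y)" "hom X Y f"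
  shows "\<exists>g. hom Y X g \<and> g \<star> f = one X \<and> f \<star> g = one Y \<and> ob b X \<and> ob b Y"
proof -
  obtain g where "g \<in> homs (cat_F u b) Y X" "Cmp (cat_F u b) g (Tr X f Y) = Id (cat_F u b) X"
    "Cmp (cat_F u b) (Tr X f Y) g = Id (cat_F u b) Y"
    using assms unfolding is_isomorphism_def by auto
  moreover then obtain g' where "g = Tr Y g' X" "hom Y X g'" "ob b X" "ob b Y" by (auto simp: homs_F)
  ultimately show ?thesis using assms(2)
    by (auto simp: Cmp_F Id_F Tr_inj hom_cmp[of _ X] hom_cmp[of _ Y] intro!: exI[of _ g']
      dest: Tr_inj[THEN iffD1, rotated 2])
qed

lemma idem_smul: "r *s bas m m \<star> (r *s bas m m) = r *s bas m m \<Longrightarrow> r = 0 \<or> r = (1::'r)"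
  by (simp add: fm_cmp_smul bas_cmp smul_simps smul_bas_eq_iff)

lemma one_nonzero: "one [m] \<noteq> (0 :: 'r fm)"
  using bas_eq_0_iff[of 1 m m] by (simp add: one_single smul_simps)

text \<open>The endomorphisms of \<open>[m]\<close> are multiples of the identity by elements of a
  domain, so the idempotent \<open>i p\<close> is 0 or 1, and one of the two summands has zero
  identity.\<close>

lemma indecomposable_single:
  assumes "width m \<le> b"
  shows "indecomposable (cat_F u b) [m]"
  unfolding indecomposable_def
proof (intro conjI allI impI)
  let ?C = "cat_F u b"
  have m: "ob b [m]" using assms by (simp add: ob_def)
  show "[m] \<in> Ob ?C" by (simp add: Ob_F m)
  show "\<not> zero_object ?C [m]"
    using one_nonzero by (simp add: zero_object_def Id_F Zer_F Tr_inj)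
  fix A B assume "is_biproduct ?C [m] A B"
  then obtain iA iB pA pB where AB: "ob b A" "ob b B" and *:
    "iA \<in> homs ?C A [m]" "iB \<in> homs ?C B [m]" "pA \<in> homs ?C [m] A" "pB \<in> homs ?C [m] B"
    "Cmp ?C pA iA = Id ?C A" "Cmp ?C pB iB = Id ?C B"
    "Add ?C (Cmp ?C iA pA) (Cmp ?C iB pB) = Id ?C [m]"
    unfolding is_biproduct_def Ob_F by blast
  then obtain i j p q where h: "hom A [m] i" "hom B [m] j" "hom [m] A p" "hom [m] B q"
    and t: "iA = Tr A i [m]" "iB = Tr B j [m]" "pA = Tr [m] p A" "pB = Tr [m] q B"
    unfolding homs_F by blast
  have hh: "hom A A (p \<star> i)" "hom B B (q \<star> j)" "hom [m] [m] (i \<star> p + j \<star> q)" "hom [m] [m] (i \<star> p)"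
    using h by (auto intro: hom_cmp hom_add)
  have "Tr A (p \<star> i) A = Tr A (one A) A" "Tr B (q \<star> j) B = Tr B (one B) B"
    "Tr [m] (i \<star> p + j \<star> q) [m] = Tr [m] (one [m]) [m]"
    using *(5-7) h by (simp_all add: t Cmp_F Id_F Add_F)
  then have e: "p \<star> i = one A" "q \<star> j = one B" "i \<star> p + j \<star> q = one [m]"
    using hh by (simp_all add: Tr_inj)
  obtain r where r: "i \<star> p = r *s bas m m" using hh(4) by (auto simp: hom_single_iff)
  have "(i \<star> p) \<star> (i \<star> p) = i \<star> ((p \<star> i) \<star> p)" by (simp add: cmps)
  then have "(i \<star> p) \<star> (i \<star> p) = i \<star> p" unfolding e(1) using h by (simp add: ones)
  then consider "r = 0" | "r = 1" using idem_smul r by metis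
  then show "zero_object ?C A \<or> zero_object ?C B"
  proof cases
    case 1
    then have "i \<star> p = 0" using r by (simp add: smul_simps)
    then have "(p \<star> i) \<star> (p \<star> i) = 0" by (simp add: cmps fm_cmp_assoc[symmetric, of _ i p])
    then have "one A = (0 :: 'r fm)" unfolding e(1) by simp
    then show ?thesis using AB by (simp add: zero_object_def Id_F Zer_F Ob_F)
  next
    case 2
    then have "j \<star> q = 0" using r e(3) by (simp add: one_single smul_simps)
    then have "(q \<star> j) \<star> (q \<star> j) = 0" by (simp add: cmps fm_cmp_assoc[symmetric, of _ j q])
    then have "one B = (0 :: 'r fm)" unfolding e(2) by simp
    then show ?thesis using AB by (simp add: zero_object_def Id_F Zer_F Ob_F)
  qed
qed

end

section \<open>Consequences of the axioms of the Frobenius structure on \<open>cat_F\<close>\<close>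

locale frob = dvr u for u :: "'r::idom" +
  fixes b :: real and E :: "('r farrow \<times> 'r farrow) set"
  assumes b_pos: "0 < b" and F_exact: "F_exact_structure u b E"
begin

abbreviation C :: "(orbit list, 'r farrow) precat" where "C \<equiv> cat_F u b"

lemma exact_C: "exact_structure C E"
  using F_exact by (simp add: F_exact_structure_def frobenius_structure_def)

lemma E_ker_coker: "(i, p) \<in> E \<Longrightarrow> kernel_cokernel_pair C i p"
  using exact_C unfolding exact_structure_def by blast

lemma E_pairE:
  assumes "(i, p) \<in> E"
  obtains Y j I q W where "i = Tr Y j I" "p = Tr I q W" "hom Y I j" "hom I W q"
    "ob b Y" "ob b I" "ob b W" "q \<star> j = 0"
proof -
  have k: "composable C p i" "Cmp C p i = Zer C (Dom C i) (Cod C p)"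
    using E_ker_coker[OF assms] by (auto simp: kernel_cokernel_pair_def)
  then obtain Y j I I' q W where i: "i = Tr Y j I" "hom Y I j" "ob b Y" "ob b I"
    and p: "p = Tr I' q W" "hom I' W q" "ob b W"
    unfolding composable_def Arr_F by blast
  then have "I' = I" using k(1) by (simp add: composable_def)
  moreover from this have "Tr Y (q \<star> j) W = Tr Y 0 W" using k(2) i p by (simp add: Cmp_F Zer_F)
  then have "q \<star> j = 0" using i p \<open>I' = I\<close> by (simp add: Tr_inj[OF hom_cmp hom_zero])
  ultimately show ?thesis using that i p by blast
qed

lemma Tr_eqD: "Tr X a Y = Tr X' a' Y' \<Longrightarrow> X = X' \<and> Y = Y'"
  by (simp add: Tr_def)

lemma adm_mono_ob: "admissible_mono E (Tr Y i Z) \<Longrightarrow> ob b Y \<and> ob b Z"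
  unfolding admissible_mono_def by (elim exE E_pairE) (auto dest!: Tr_eqD)

lemma adm_epi_ob: "admissible_epi E (Tr Y i Z) \<Longrightarrow> ob b Y \<and> ob b Z"
  unfolding admissible_epi_def by (elim exE E_pairE) (auto dest!: Tr_eqD)

lemma adm_monoE:
  assumes "admissible_mono E i"
  obtains Y j Z where "i = Tr Y j Z" "hom Y Z j" "ob b Y" "ob b Z"
  using assms unfolding admissible_mono_def by (elim exE E_pairE) blast

lemma adm_epiE:
  assumes "admissible_epi E i"
  obtains Y j Z where "i = Tr Y j Z" "hom Y Z j" "ob b Y" "ob b Z"
  using assms unfolding admissible_epi_def by (elim exE E_pairE) blast

lemma inj_iff: "is_injective C E P \<longleftrightarrow> ob b P \<and> (\<forall>Y i Z f. admissible_mono E (Tr Y i Z) \<and> hom Y Z i \<and>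
    hom Y P f \<longrightarrow> (\<exists>g. hom Z P g \<and> g \<star> i = f))"
proof (intro iffI conjI allI impI)
  assume inj: "is_injective C E P"
  then show P: "ob b P" by (simp add: is_injective_def Ob_F)
  fix Y Z and i f :: "'r fm" assume a: "admissible_mono E (Tr Y i Z) \<and> hom Y Z i \<and> hom Y P f"
  then have "ob b Y \<and> ob b Z" using adm_mono_ob by blast
  then have "Tr Y f P \<in> homs C (Dom C (Tr Y i Z)) P" using a P by simp
  then have "\<exists>g\<in>homs C (Cod C (Tr Y i Z)) P. Cmp C g (Tr Y i Z) = Tr Y f P"
    using inj a unfolding is_injective_def by blast
  then obtain g where "g \<in> homs C Z P" "Cmp C g (Tr Y i Z) = Tr Y f P"
    unfolding Dom_Cod_F by blast
  moreover from this(1) obtain g' where "g = Tr Z g' P" "hom Z P g'" by (auto simp: homs_F)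
  ultimately show "\<exists>g. hom Z P g \<and> g \<star> i = f"
    using a by (auto simp: Cmp_F Tr_inj[OF hom_cmp])
next
  assume r: "ob b P \<and> (\<forall>Y i Z f. admissible_mono E (Tr Y i Z) \<and> hom Y Z i \<and> hom Y P f
      \<longrightarrow> (\<exists>g. hom Z P g \<and> g \<star> i = f))"
  show "is_injective C E P" unfolding is_injective_def
  proof (intro conjI allI impI)
    show "P \<in> Ob C" using r by (simp add: Ob_F)
    fix i f assume a: "admissible_mono E i \<and> f \<in> homs C (Dom C i) P"
    then obtain Y j Z where i: "i = Tr Y j Z" "hom Y Z j" "ob b Y" "ob b Z"
      using adm_monoE by metis
    with a obtain f' where f: "f = Tr Y f' P" "hom Y P f'" by (auto simp: homs_F)
    obtain g where "hom Z P g" "g \<star> j = f'" using r a i f by blast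
    then show "\<exists>g\<in>homs C (Cod C i) P. Cmp C g i = f"
      using i f r by (intro bexI[of _ "Tr Z g P"]) (auto simp: Cmp_F)
  qed
qed

lemma proj_iff: "is_projective C E P \<longleftrightarrow> ob b P \<and> (\<forall>Z p W f. admissible_epi E (Tr Z p W) \<and> hom Z W p \<and>
    hom P W f \<longrightarrow> (\<exists>g. hom P Z g \<and> p \<star> g = f))"
proof (intro iffI conjI allI impI)
  assume inj: "is_projective C E P"
  then show P: "ob b P" by (simp add: is_projective_def Ob_F)
  fix Z W and p f :: "'r fm" assume a: "admissible_epi E (Tr Z p W) \<and> hom Z W p \<and> hom P W f"
  then have "ob b W \<and> ob b Z" using adm_epi_ob by blast
  then have "Tr P f W \<in> homs C P (Cod C (Tr Z p W))" using a P by simp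
  then have "\<exists>g\<in>homs C P (Dom C (Tr Z p W)). Cmp C (Tr Z p W) g = Tr P f W"
    using inj a unfolding is_projective_def by blast
  then obtain g where "g \<in> homs C P Z" "Cmp C (Tr Z p W) g = Tr P f W"
    unfolding Dom_Cod_F by blast
  moreover from this(1) obtain g' where "g = Tr P g' Z" "hom P Z g'" by (auto simp: homs_F)
  ultimately show "\<exists>g. hom P Z g \<and> p \<star> g = f"
    using a by (auto simp: Cmp_F Tr_inj[OF hom_cmp])
next
  assume r: "ob b P \<and> (\<forall>Z p W f. admissible_epi E (Tr Z p W) \<and> hom Z W p \<and> hom P W f
      \<longrightarrow> (\<exists>g. hom P Z g \<and> p \<star> g = f))"
  show "is_projective C E P" unfolding is_projective_def
  proof (intro conjI allI impI)
    show "P \<in> Ob C" using r by (simp add: Ob_F)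
    fix p f assume a: "admissible_epi E p \<and> f \<in> homs C P (Cod C p)"
    then obtain Z q W where p: "p = Tr Z q W" "hom Z W q" "ob b Z" "ob b W"
      using adm_epiE by metis
    with a obtain f' where f: "f = Tr P f' W" "hom P W f'" by (auto simp: homs_F)
    obtain g where "hom P Z g" "q \<star> g = f'" using r a p f by blast
    then show "\<exists>g\<in>homs C P (Dom C p). Cmp C p g = f"
      using p f r by (intro bexI[of _ "Tr P g Z"]) (auto simp: Cmp_F)
  qed
qed

lemma proj_inj_same: "is_projective C E P \<longleftrightarrow> is_injective C E P"
  using F_exact by (simp add: F_exact_structure_def frobenius_structure_def)

lemma inj_append: "is_injective C E P \<Longrightarrow> is_injective C E Q \<Longrightarrow> is_injective C E (P @ Q)"
proof -
  assume P: "is_injective C E P" and Q: "is_injective C E Q"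
  have "\<exists>g. hom Z (P @ Q) g \<and> g \<star> i = f"
    if a: "admissible_mono E (Tr Y i Z)" "hom Y Z i" "hom Y (P @ Q) f" for Y i Z f
  proof -
    have "hom Y P (pr1 P Q \<star> f)" "hom Y Q (pr2 P Q \<star> f)" using a by (auto intro: hom_cmp hom_pr1 hom_pr2)
    with a P Q obtain g h where g: "hom Z P g" "g \<star> i = pr1 P Q \<star> f" "hom Z Q h" "h \<star> i = pr2 P Q \<star> f"
      unfolding inj_iff by meson
    then have "(in1 P Q \<star> g + in2 P Q \<star> h) \<star> i = f"
      using split_left[OF a(3)] by (simp add: cmps)
    moreover have "hom Z (P @ Q) (in1 P Q \<star> g + in2 P Q \<star> h)"
      using g by (intro hom_add) (auto intro: hom_cmp hom_in1 hom_in2)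
    ultimately show ?thesis by blast
  qed
  moreover have "ob b (P @ Q)" using P Q unfolding inj_iff ob_append by blast
  ultimately show ?thesis unfolding inj_iff by blast
qed

lemma inj_Nil: "is_injective C E []"
  unfolding inj_iff by (auto simp: hom_Nil fm_cmp_zero)

lemma iso_refl: "ob b X \<Longrightarrow> isomorphic C X X"
  unfolding isomorphic_def Ob_F
  by (auto intro!: bexI[of _ "Tr X (one X) X"] is_iso_Tr[of X X "one X" "one X"])

lemma iso_single: "isomorphic C [m] [n] \<Longrightarrow> cc m n m = 0"
proof -
  assume "isomorphic C [m] [n]"
  then obtain f where "hom [m] [n] f" "is_isomorphism C (Tr [m] f [n])"
    by (auto simp: isomorphic_def homs_F)
  then obtain g where "hom [m] [n] f" "hom [n] [m] g" "g \<star> f = one [m]" using is_iso_TrD by blast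
  then obtain r s where "(s *s bas n m) \<star> (r *s bas m n) = one [m]" by (auto simp: hom_single_iff)
  then have "(r * s * u ^ cc m n m) *s bas m m = 1 *s bas m m"
    by (simp add: fm_cmp_smul bas_cmp smul_simps one_single ac_simps)
  then have "r * s * u ^ cc m n m = 1" using smul_bas_eq_iff by blast
  then show ?thesis by (metis dvd_refl unit_mult unit_u_power)
qed

text \<open>Indecomposability of \<open>[m]\<close> lets the prescribed list of
  projective-injectives apply, and an isomorphism with a boundary orbit preserves the width by
  \<open>cc_zero_width\<close>.\<close>

lemma proj_inj_single_iff:
  assumes "width m \<le> b"
  shows "projective_injective C E [m] \<longleftrightarrow> width m = b"
proof -
  have m: "ob b [m]" using assms by (simp add: ob_def)
  have "projective_injective C E [m] \<longleftrightarrow> (\<exists>x y. \<bar>x - y\<bar> = b \<and> isomorphic C [m] [obj_M x y])"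
    using F_exact indecomposable_single[OF assms] unfolding F_exact_structure_def by blast
  also have "\<dots> \<longleftrightarrow> width m = b"
  proof
    assume "\<exists>x y. \<bar>x - y\<bar> = b \<and> isomorphic C [m] [obj_M x y]"
    then show "width m = b" using iso_single cc_zero_width by (metis width_obj_M)
  next
    assume w: "width m = b"
    obtain x y where "m = obj_M x y" using orbit_obj_M by blast
    then show "\<exists>x y. \<bar>x - y\<bar> = b \<and> isomorphic C [m] [obj_M x y]"
      using w iso_refl[OF m] by auto
  qed
  finally show ?thesis .
qed

lemma bd_inj: "bd b P \<Longrightarrow> is_injective C E P"
proof (induction P)
  case (Cons m P)
  then have "is_injective C E [m]"
    using proj_inj_single_iff[of m] by (auto simp: bd_def projective_injective_def)
  then have "is_injective C E ([m] @ P)" using Cons by (intro inj_append) (auto simp: bd_def)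
  then show ?case by simp
qed (simp add: inj_Nil)

text \<open>A summand of an injective object is injective: include \<open>[m]\<close> into
  \<open>P\<close>, extend there, and project back. This reduces the claim to a single
  orbit.\<close>

lemma inj_bd: assumes "is_injective C E P" shows "bd b P"
  unfolding bd_def
proof
  fix m assume "m \<in> set P"
  then obtain t where t: "t < length P" "m = P ! t" by (metis in_set_conv_nth)
  have P: "ob b P" using assms inj_iff by blast
  then have w: "width m \<le> b" using \<open>m \<in> set P\<close> by (auto simp: ob_def)
  have s: "sub P [t] = [m]" by (simp add: sub_def t)
  have h: "hom [m] P (inc P [t])" "hom P [m] (prj P [t])"
    using hom_inc[of "[t]" P] hom_prj[of "[t]" P] t s by auto
  have pi: "prj P [t] \<star> inc P [t] = one [m]" using prj_inc[of "[t]" u P] s by simp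
  have "\<exists>g. hom Z [m] g \<and> g \<star> i = f"
    if a: "admissible_mono E (Tr Y i Z)" "hom Y Z i" "hom Y [m] f" for Y i Z f
  proof -
    obtain g where g: "hom Z P g" "g \<star> i = inc P [t] \<star> f"
      using assms a hom_cmp[OF h(1) a(3)] unfolding inj_iff by blast
    moreover have "prj P [t] \<star> (inc P [t] \<star> f) = f"
      using a(3) by (simp add: fm_cmp_assoc[symmetric] pi ones)
    ultimately have "(prj P [t] \<star> g) \<star> i = f" by (simp add: fm_cmp_assoc)
    then show ?thesis using hom_cmp[OF h(2) g(1)] by blast
  qed
  moreover have "ob b [m]" using w by (simp add: ob_def)
  ultimately have "is_injective C E [m]" unfolding inj_iff by blast
  then show "width m = b"
    using proj_inj_single_iff[OF w] proj_inj_same by (simp add: projective_injective_def)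
qed

lemma bd_proj: "bd b P \<Longrightarrow> is_projective C E P" using bd_inj proj_inj_same by blast

lemma inj_extend:
  "bd b P \<Longrightarrow> admissible_mono E (Tr Y i Z) \<Longrightarrow> hom Y Z i \<Longrightarrow> hom Y P f \<Longrightarrow> \<exists>g. hom Z P g \<and> g \<star> i = f"
  using bd_inj inj_iff by meson

lemma proj_lift:
  "bd b P \<Longrightarrow> admissible_epi E (Tr Z p W) \<Longrightarrow> hom Z W p \<Longrightarrow> hom P W f \<Longrightarrow> \<exists>g. hom P Z g \<and> p \<star> g = f"
  using bd_proj proj_iff by meson

lemma E_iso:
  assumes "(i, p) \<in> E" "composable C p' i'"
    "is_isomorphism C a" "is_isomorphism C b'" "is_isomorphism C c"
    "a \<in> homs C (Dom C i) (Dom C i')" "b' \<in> homs C (Cod C i) (Cod C i')"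
    "c \<in> homs C (Cod C p) (Cod C p')"
    "Cmp C i' a = Cmp C b' i" "Cmp C p' b' = Cmp C c p"
  shows "(i', p') \<in> E"
proof -
  have iso: "\<forall>(i, p) \<in> E. \<forall>i' p' a b' c. composable C p' i' \<and>
      is_isomorphism C a \<and> is_isomorphism C b' \<and> is_isomorphism C c \<and>
      a \<in> homs C (Dom C i) (Dom C i') \<and> b' \<in> homs C (Cod C i) (Cod C i') \<and>
      c \<in> homs C (Cod C p) (Cod C p') \<and>
      Cmp C i' a = Cmp C b' i \<and> Cmp C p' b' = Cmp C c p \<longrightarrow> (i', p') \<in> E"
    using exact_C unfolding exact_structure_def by blast
  show ?thesis using bspec[OF iso assms(1)] assms(2-) unfolding prod.case by blast
qed

lemma ex1_eq: "\<exists>!x. P x \<Longrightarrow> P a \<Longrightarrow> P c \<Longrightarrow> a = c" by blast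

lemma adm_mono_iso:
  assumes "admissible_mono E (Tr Y i Z)" "hom Y Z i" "hom Z Z' f" "hom Z' Z g" "g \<star> f = one Z"
    "f \<star> g = one Z'" "ob b Z'"
  shows "admissible_mono E (Tr Y (f \<star> i) Z')"
proof -
  obtain p where "(Tr Y i Z, p) \<in> E" using assms(1) by (auto simp: admissible_mono_def)
  moreover then obtain q W where p: "p = Tr Z q W" "hom Z W q" and obs: "ob b Y" "ob b Z" "ob b W"
    by (elim E_pairE) (auto dest!: Tr_eqD)
  ultimately have E: "(Tr Y i Z, Tr Z q W) \<in> E" by simp
  have h: "hom Y Z' (f \<star> i)" "hom Z' W (q \<star> g)" using assms p by (auto intro: hom_cmp)
  have qgf: "q \<star> (g \<star> f) = q" using assms(5) p(2) by (simp add: ones)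
  have "(Tr Y (f \<star> i) Z', Tr Z' (q \<star> g) W) \<in> E"
  proof -
    show ?thesis
    proof (rule E_iso[OF E, where a = "Tr Y (one Y) Y" and b' = "Tr Z f Z'" and c = "Tr W (one W) W"])
      show "composable C (Tr Z' (q \<star> g) W) (Tr Y (f \<star> i) Z')"
        using h obs assms by (simp add: composable_def)
      show "is_isomorphism C (Tr Y (one Y) Y)" "is_isomorphism C (Tr W (one W) W)"
        "is_isomorphism C (Tr Z f Z')"
        using obs assms by (auto intro: is_iso_one is_iso_Tr[of Z Z' f g])
      show "Cmp C (Tr Y (f \<star> i) Z') (Tr Y (one Y) Y) = Cmp C (Tr Z f Z') (Tr Y i Z)"
        using h assms by (simp add: Cmp_F ones)
      show "Cmp C (Tr Z' (q \<star> g) W) (Tr Z f Z') = Cmp C (Tr W (one W) W) (Tr Z q W)"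
        using h assms p by (simp add: Cmp_F ones cmps qgf)
    qed (use obs assms in auto)
  qed
  then show ?thesis by (rule admissible_monoI)
qed

text \<open>The axioms provide the identity of \<open>T\<close> as an admissible epimorphism. Its
  kernel map is 0, so by uniqueness in the kernel property the identity of the kernel object is 0,
  and that object is the empty list.\<close>

lemma adm_mono_Nil: assumes "ob b T" shows "admissible_mono E (Tr [] 0 T)"
proof -
  have "T \<in> Ob C" using assms by (simp add: Ob_F)
  then have "admissible_epi E (Id C T)" using exact_C unfolding exact_structure_def by blast
  then obtain i where i: "(i, Tr T (one T) T) \<in> E" by (auto simp: admissible_epi_def Id_F)
  then obtain Z z where z: "i = Tr Z z T" "hom Z T z" "ob b Z" "one T \<star> z = 0"
  proof (rule E_pairE)
    fix Y j I q W assume a: "i = Tr Y j I" "Tr T (one T) T = Tr I q W" "hom Y I j" "hom I W q"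
      "ob b Y" "ob b I" "ob b W" "q \<star> j = 0"
    then have "I = T" "W = T" by (auto dest: Tr_eqD)
    with a have "q = one T" using Tr_inj[of T T "one T" q] by simp
    then show thesis using a that[of Y j] \<open>I = T\<close> by simp
  qed
  then have z0: "z = 0" by (simp add: ones)
  have "\<exists>!g. g \<in> homs C (Dom C (Tr Z 0 T)) (Dom C i) \<and> Cmp C i g = Tr Z 0 T"
  proof -
    have "\<forall>f \<in> Arr C. Cod C f = Dom C (Tr T (one T) T) \<and>
        Cmp C (Tr T (one T) T) f = Zer C (Dom C f) (Cod C (Tr T (one T) T)) \<longrightarrow>
        (\<exists>!g. g \<in> homs C (Dom C f) (Dom C i) \<and> Cmp C i g = f)"
      using E_ker_coker[OF i] unfolding kernel_cokernel_pair_def by blast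
    from this[rule_format, of "Tr Z 0 T"] show ?thesis using assms z by (simp add: Cmp_F Zer_F fm_cmp_zero)
  qed
  then have "Tr Z (one Z) Z = (Tr Z 0 Z :: 'r farrow)"
    by (rule ex1_eq) (use z z0 in \<open>simp_all add: Cmp_F fm_cmp_zero\<close>)
  then have "one Z = (0 :: 'r fm)" by (simp add: Tr_inj)
  then have "Z = []"
    by (metis ent_def ent_one length_greater_0_conv lookup_zero zero_neq_one)
  then show ?thesis using admissible_monoI[OF i] z z0 by simp
qed

text \<open>Split inclusions are not admissible by axiom. The pushout of \<open>0 -> T\<close> along
  \<open>0 -> I\<close> is admissible, and its universal property identifies it with
  \<open>I @ T\<close> compatibly with the first inclusion.\<close>

lemma adm_mono_in1:
  assumes "ob b I" "ob b T" shows "admissible_mono E (Tr I (in1 I T) (I @ T))"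
proof -
  have "Tr [] 0 I \<in> Arr C" "Dom C (Tr [] 0 I) = Dom C (Tr [] 0 T)" using assms by auto
  then obtain i' f' where po: "is_pushout C (Tr [] 0 T) (Tr [] 0 I) i' f'" and ad: "admissible_mono E i'"
    using exact_C adm_mono_Nil[OF assms(2)] unfolding exact_structure_def by blast
  then have c: "composable C i' (Tr [] 0 I)" "composable C f' (Tr [] 0 T)" "Cod C i' = Cod C f'"
    and univ: "\<And>a c. composable C a (Tr [] 0 I) \<Longrightarrow> composable C c (Tr [] 0 T) \<Longrightarrow> Cod C a = Cod C c \<Longrightarrow>
        Cmp C a (Tr [] 0 I) = Cmp C c (Tr [] 0 T) \<Longrightarrow>
        \<exists>!d. d \<in> homs C (Cod C i') (Cod C a) \<and> Cmp C d i' = a \<and> Cmp C d f' = c"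
    unfolding is_pushout_def by blast+
  from c obtain W i f where i: "i' = Tr I i W" "f' = Tr T f W" "hom I W i" "hom T W f" "ob b W"
    unfolding composable_def by (auto simp: Arr_F) 
  have univ': "\<exists>d. hom W V d \<and> d \<star> i = a \<and> d \<star> f = c \<and> (\<forall>d'. hom W V d' \<and> d' \<star> i = a \<and> d' \<star> f = c \<longrightarrow> d' = d)"
    if "hom I V a" "hom T V c" "ob b V" for V a c
  proof -
    have "\<exists>!d. d \<in> homs C W V \<and> Cmp C d (Tr I i W) = Tr I a V \<and> Cmp C d (Tr T f W) = Tr T c V"
      using univ[of "Tr I a V" "Tr T c V"] that assms i
      by (simp add: composable_def Cmp_F fm_cmp_zero)
    then obtain d where d': "d \<in> homs C W V \<and> Cmp C d (Tr I i W) = Tr I a V \<and> Cmp C d (Tr T f W) = Tr T c V"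
      and d'': "\<forall>d'. d' \<in> homs C W V \<and> Cmp C d' (Tr I i W) = Tr I a V \<and> Cmp C d' (Tr T f W) = Tr T c V \<longrightarrow> d' = d"
      by (rule ex1E)
    have d: "d \<in> homs C W V" "Cmp C d (Tr I i W) = Tr I a V" "Cmp C d (Tr T f W) = Tr T c V"
      using d' by auto
    have d4: "d' = d" if "d' \<in> homs C W V" "Cmp C d' (Tr I i W) = Tr I a V" "Cmp C d' (Tr T f W) = Tr T c V" for d'
      using d'' that by blast
    from d obtain e where e: "d = Tr W e V" "hom W V e" by (auto simp: homs_F)
    show ?thesis
    proof (intro exI[of _ e] conjI allI impI)
      show "hom W V e" "e \<star> i = a" "e \<star> f = c" using e d(2,3) i that
        by (simp_all add: Cmp_F Tr_inj[OF hom_cmp])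
      fix d' assume "hom W V d' \<and> d' \<star> i = a \<and> d' \<star> f = c"
      then show "d' = e" using d4[of "Tr W d' V"] e i that by (simp add: Cmp_F Tr_inj)
    qed
  qed
  obtain \<phi> where \<phi>: "hom W (I @ T) \<phi>" "\<phi> \<star> i = in1 I T" "\<phi> \<star> f = in2 I T"
    using univ'[of "I @ T" "in1 I T" "in2 I T"] assms by auto
  define \<chi> where "\<chi> = i \<star> pr1 I T + f \<star> pr2 I T"
  have \<chi>: "hom (I @ T) W \<chi>" unfolding \<chi>_def using i by (intro hom_add) (auto intro: hom_cmp hom_pr1 hom_pr2)
  have 1: "\<phi> \<star> \<chi> = one (I @ T)"
    unfolding \<chi>_def by (simp add: fm_cmp_add_right fm_cmp_assoc[symmetric] \<phi> in_pr)
  have 2: "\<chi> \<star> in1 I T = i" "\<chi> \<star> in2 I T = f"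
    unfolding \<chi>_def using i by (simp_all add: cmps ones)
  obtain d where d: "\<And>d'. hom W W d' \<Longrightarrow> d' \<star> i = i \<Longrightarrow> d' \<star> f = f \<Longrightarrow> d' = d"
    using univ'[of W i f] i by blast
  have "\<chi> \<star> \<phi> = d" using hom_cmp[OF \<chi> \<phi>(1)] 2 by (intro d) (simp_all add: fm_cmp_assoc \<phi>)
  moreover have "one W = d" using i by (intro d) (simp_all add: ones)
  ultimately have "\<chi> \<star> \<phi> = one W" by simp
  then have "admissible_mono E (Tr I (\<phi> \<star> i) (I @ T))"
    using ad i \<phi> \<chi> 1 assms by (intro adm_mono_iso[where Z = W and g = \<chi>]) auto
  then show ?thesis by (simp add: \<phi>)
qed

text \<open>Injectivity of \<open>T\<close> extends \<open>t\<close> along \<open>i\<close> to some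
  \<open>t'\<close>. The shear \<open>1 + in2 t' pr1\<close> is an automorphism of
  \<open>I @ T\<close>, its nilpotent part having square 0, and it carries the admissible
  monomorphism \<open>in1 i\<close> to the pair of \<open>i\<close> and \<open>t\<close>.\<close>

lemma adm_mono_pair:
  assumes "admissible_mono E (Tr Y i I)" "hom Y I i" "ob b Y" "ob b I" "hom Y T t" "bd b T"
  shows "admissible_mono E (Tr Y (in1 I T \<star> i + in2 I T \<star> t) (I @ T))"
proof -
  have T: "ob b T" using assms bd_ob by blast
  have "admissible_mono E (Cmp C (Tr I (in1 I T) (I @ T)) (Tr Y i I))"
  proof -
    have "composable C (Tr I (in1 I T) (I @ T)) (Tr Y i I)"
      using assms T by (simp add: composable_def)
    then show ?thesis using exact_C adm_mono_in1[OF assms(4) T] assms(1) unfolding exact_structure_def by blast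
  qed
  then have ad: "admissible_mono E (Tr Y (in1 I T \<star> i) (I @ T))" by (simp add: Cmp_F)
  obtain t' where t: "hom I T t'" "t' \<star> i = t" using inj_extend assms by blast
  let ?n = "in2 I T \<star> (t' \<star> pr1 I T)"
  have n: "hom (I @ T) (I @ T) ?n" using t by (auto intro!: hom_cmp[OF hom_in2] hom_cmp[OF _ hom_pr1])
  have "?n \<star> ?n = 0" by (simp add: cmps)
  have "admissible_mono E (Tr Y ((one (I @ T) + ?n) \<star> (in1 I T \<star> i)) (I @ T))"
  proof (rule adm_mono_iso[OF ad])
    show "hom (I @ T) (I @ T) (one (I @ T) + ?n)" "hom (I @ T) (I @ T) (one (I @ T) - ?n)"
      using n by (auto intro: hom_add hom_diff)
    show "(one (I @ T) - ?n) \<star> (one (I @ T) + ?n) = one (I @ T)"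
      "(one (I @ T) + ?n) \<star> (one (I @ T) - ?n) = one (I @ T)"
      using \<open>?n \<star> ?n = 0\<close> by (simp_all only: fm_cmp_add_left fm_cmp_add_right fm_cmp_diff ones[OF n] one_one) simp_all
  qed (use assms T in \<open>auto intro: hom_cmp hom_in1\<close>)
  moreover have "(one (I @ T) + ?n) \<star> (in1 I T \<star> i) = in1 I T \<star> i + in2 I T \<star> t"
    using assms(2) t by (simp add: cmps ones ones[OF hom_cmp[OF hom_in1 assms(2)]])
  ultimately show ?thesis by simp
qed

lemma embedding: "ob b Y \<Longrightarrow> \<exists>I i. bd b I \<and> hom Y I i \<and> admissible_mono E (Tr Y i I)"
proof -
  assume "ob b Y"
  have "\<forall>X \<in> Ob C. \<exists>(i, p) \<in> E. Dom C i = X \<and> is_injective C E (Cod C i)"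
    using F_exact unfolding F_exact_structure_def frobenius_structure_def by (elim conjE)
  then have "\<exists>(i, p) \<in> E. Dom C i = Y \<and> is_injective C E (Cod C i)" using \<open>ob b Y\<close> by (simp add: Ob_F)
  then obtain i p where "(i, p) \<in> E" "Dom C i = Y" "is_injective C E (Cod C i)" by blast
  moreover from this(1) obtain Y' j I q W where i: "i = Tr Y' j I" "hom Y' I j" by (rule E_pairE) blast
  moreover have "admissible_mono E i" unfolding admissible_mono_def using \<open>(i, p) \<in> E\<close> by (rule exI)
  ultimately have "bd b I \<and> hom Y I j \<and> admissible_mono E (Tr Y j I)" using inj_bd by auto
  then show ?thesis by blast
qed

end

text \<open>A left approximation of \<open>Y\<close> by boundary objects, followed by its cokernel. By Schanuel's lemma
  this is all that the computation of extensions needs; no exactness is required.\<close>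

definition (in dvr) lc :: "real \<Rightarrow> orbit list \<Rightarrow> orbit list \<Rightarrow> orbit list \<Rightarrow> 'r fm \<Rightarrow> 'r fm \<Rightarrow> bool" where
  "lc b Y I W j p \<longleftrightarrow> bd b I \<and> ob b W \<and> hom Y I j \<and> hom I W p \<and> p \<star> j = 0 \<and>
     (\<forall>P f. bd b P \<and> hom Y P f \<longrightarrow> (\<exists>g. hom I P g \<and> f = g \<star> j)) \<and>
     (\<forall>T h. ob b T \<and> hom I T h \<and> h \<star> j = 0 \<longrightarrow> (\<exists>g. hom W T g \<and> h = g \<star> p)) \<and>
     (\<forall>T g. ob b T \<and> hom W T g \<and> g \<star> p = 0 \<longrightarrow> g = 0)"

text \<open>The approximation clause of \<open>lc\<close> is injectivity of boundary lists; its last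
  two clauses are existence and uniqueness in the cokernel property.\<close>

lemma (in frob) E_lc:
  assumes "(Tr Y j I, Tr I p W) \<in> E" "hom Y I j" "hom I W p" "bd b I"
  shows "lc b Y I W j p"
proof -
  have obs: "ob b Y" "ob b W" and pj: "p \<star> j = 0"
  proof -
    have "admissible_mono E (Tr Y j I)" using assms(1) unfolding admissible_mono_def by (rule exI)
    then show "ob b Y" using adm_mono_ob by blast
    have "admissible_epi E (Tr I p W)" using assms(1) unfolding admissible_epi_def by (rule exI)
    then show "ob b W" using adm_epi_ob by blast
    have "Cmp C (Tr I p W) (Tr Y j I) = Tr Y 0 W"
      using E_ker_coker[OF assms(1)] by (simp add: kernel_cokernel_pair_def Zer_F)
    then show "p \<star> j = 0" using assms by (simp add: Cmp_F Tr_inj[OF hom_cmp])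
  qed
  have cok: "\<exists>!g. g \<in> homs C W T \<and> Cmp C g (Tr I p W) = Tr I h T"
    if "ob b T" "hom I T h" "h \<star> j = 0" for T h
  proof -
    have "\<forall>f \<in> Arr C. Dom C f = I \<and> Cmp C f (Tr Y j I) = Zer C Y (Cod C f) \<longrightarrow>
        (\<exists>!g. g \<in> homs C W (Cod C f) \<and> Cmp C g (Tr I p W) = f)"
      using E_ker_coker[OF assms(1)] unfolding kernel_cokernel_pair_def Dom_Cod_F by blast
    from this[rule_format, of "Tr I h T"] that assms bd_ob show ?thesis by (simp add: Cmp_F Zer_F)
  qed
  have 1: "\<exists>g. hom W T g \<and> h = g \<star> p" if a: "ob b T" "hom I T h" "h \<star> j = 0" for T h
  proof -
    obtain g where "g \<in> homs C W T" "Cmp C g (Tr I p W) = Tr I h T" using cok[OF a] by blast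
    moreover from this(1) obtain g' where "g = Tr W g' T" "hom W T g'" by (auto simp: homs_F)
    ultimately show ?thesis using a assms by (auto simp: Cmp_F Tr_inj[OF hom_cmp])
  qed
  have 2: "g = 0" if a: "ob b T" "hom W T g" "g \<star> p = 0" for T g
  proof -
    have "Tr W g T = Tr W 0 T"
      by (rule ex1_eq[OF cok[of T 0]]) (use a assms obs in \<open>simp_all add: Cmp_F fm_cmp_zero\<close>)
    then show ?thesis using a by (simp add: Tr_inj)
  qed
  have 3: "\<exists>g. hom I P g \<and> f = g \<star> j" if "bd b P" "hom Y P f" for P f
    using inj_extend[OF that(1) admissible_monoI[OF assms(1)] assms(2) that(2)] by blast
  show ?thesis unfolding lc_def using assms obs pj 1 2 3 by blast
qed


section \<open>Objects with involution\<close>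

context dvr
begin

text \<open>In a pair \<open>(X, x)\<close> the matrix \<open>x\<close> represents the isomorphism \<open>\<xi>\<close> of an object of \<open>F\<^sub>b\<^sup>\<psi>\<close>.\<close>

definition pob :: "real \<Rightarrow> orbit list \<Rightarrow> 'r fm \<Rightarrow> bool" where
  "pob b X x \<longleftrightarrow> ob b X \<and> hom (psl X) X x \<and> x \<star> psi x = one X"

definition phom :: "orbit list \<Rightarrow> 'r fm \<Rightarrow> orbit list \<Rightarrow> 'r fm \<Rightarrow> 'r fm \<Rightarrow> bool" where
  "phom X x Y y a \<longleftrightarrow> hom X Y a \<and> a \<star> x = y \<star> psi a"

text \<open>Applying \<open>psi\<close> to \<open>x psi(x) = 1\<close> gives the inverse on the
  other side, so \<open>psi x\<close> is a two-sided inverse of \<open>x\<close>. This yields the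
  isomorphism required of objects of \<open>F_psi\<close>.\<close>

lemma pobD:
  assumes "pob b X x"
  shows "ob b X" "hom (psl X) X x" "x \<star> psi x = one X" "psi x \<star> x = one (psl X)" "hom X (psl X) (psi x)"
proof -
  show *: "ob b X" "hom (psl X) X x" "x \<star> psi x = one X" using assms by (auto simp: pob_def)
  from arg_cong[OF *(3), of psi] show "psi x \<star> x = one (psl X)" by (simp add: psi_fm_cmp)
  show "hom X (psl X) (psi x)" using hom_psi[OF *(2)] by simp
qed

lemma pob_cancel:
  assumes "pob b X x" shows "hom X Y a \<Longrightarrow> a \<star> (x \<star> psi x) = a" "hom Y X c \<Longrightarrow> x \<star> (psi x \<star> c) = c"
    "hom (psl X) Y a' \<Longrightarrow> a' \<star> (psi x \<star> x) = a'" "hom Y (psl X) c' \<Longrightarrow> psi x \<star> (x \<star> c') = c'"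
  using pobD[OF assms] by (simp_all add: ones fm_cmp_assoc[symmetric])

lemma phom_hom: "phom X x Y y a \<Longrightarrow> hom X Y a" by (simp add: phom_def)

lemma phom_eq: "phom X x Y y a \<Longrightarrow> a \<star> x = y \<star> psi a" "phom X x Y y a \<Longrightarrow> a \<star> (x \<star> c) = y \<star> (psi a \<star> c)"
  by (simp_all add: phom_def fm_cmp_assoc[symmetric])

lemma phom_cmp: "phom Y y Z z g \<Longrightarrow> phom X x Y y f \<Longrightarrow> phom X x Z z (g \<star> f)"
  unfolding phom_def by (auto intro: hom_cmp simp: psi_fm_cmp fm_cmp_assoc)
    (simp add: fm_cmp_assoc[symmetric])

lemma phom_add: "phom X x Y y a \<Longrightarrow> phom X x Y y c \<Longrightarrow> phom X x Y y (a + c)"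
  by (simp add: phom_def hom_add cmps)
lemma phom_diff: "phom X x Y y a \<Longrightarrow> phom X x Y y c \<Longrightarrow> phom X x Y y (a - c)"
  by (simp add: phom_def hom_diff cmps)
lemma phom_smul: "phom X x Y y a \<Longrightarrow> phom X x Y y (r *s a)"
  by (simp add: phom_def hom_smul cmps)
lemma phom_zero [simp]: "phom X x Y y 0" by (simp add: phom_def fm_cmp_zero)
lemma phom_one: "pob b X x \<Longrightarrow> phom X x X x (one X)"
  using pobD[of b X x] by (simp add: phom_def ones)

text \<open>\<open>f |-> y psi(f) psi(x)\<close> is the action of the involution on all maps from
  \<open>X\<close> to \<open>Y\<close>, with the equivariant maps as fixed points. The factor 1/2
  makes \<open>avg\<close> a projection onto them.\<close>

definition avg :: "'r fm \<Rightarrow> 'r fm \<Rightarrow> 'r fm \<Rightarrow> 'r fm" where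
  "avg y x f = half *s (f + y \<star> (psi f \<star> psi x))"

lemma half_add: "half *s (a + a) = a"
  by (rule poly_mapping_eqI) (simp only: lookup_smul lookup_add distrib_left half_add_half)

lemma phom_avg:
  assumes "pob b X x" "pob b Y y" "hom X Y f" shows "phom X x Y y (avg y x f)"
proof -
  have h: "hom (psl X) (psl Y) (psi f)" using assms hom_psi by blast
  have "hom X Y (y \<star> (psi f \<star> psi x))"
    using pobD[OF assms(1)] pobD[OF assms(2)] h by (blast intro: hom_cmp)
  moreover have "(f + y \<star> (psi f \<star> psi x)) \<star> x = y \<star> psi (f + y \<star> (psi f \<star> psi x))"
    using pob_cancel(3)[OF assms(1) h] pob_cancel(2)[OF assms(2) hom_cmp[OF assms(3) pobD(2)[OF assms(1)]]]
    by (simp add: cmps psi_fm_cmp add.commute)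
  ultimately show ?thesis
    unfolding avg_def using assms(3) by (intro phom_smul) (simp add: phom_def hom_add)
qed

lemma avg_id:
  assumes "pob b X x" "phom X x Y y f" shows "avg y x f = f"
proof -
  have "y \<star> (psi f \<star> psi x) = f \<star> (x \<star> psi x)" using assms(2) by (simp add: phom_eq(2))
  also have "\<dots> = f" using assms phom_hom pob_cancel(1) by blast
  finally show ?thesis by (simp add: avg_def half_add)
qed

text \<open>Averaging commutes with composition by equivariant maps. A lift or extension found in
  \<open>F\<^sub>b\<close> can therefore be averaged without spoiling the equation that it
  solves.\<close>

lemma avg_left: "phom Y y Z z p \<Longrightarrow> p \<star> avg y x f = avg z x (p \<star> f)"
  by (simp add: avg_def cmps psi_fm_cmp phom_eq)

lemma avg_right:
  assumes "pob b X x" "pob b W w" "phom W w X x g" shows "avg y x f \<star> g = avg y w (f \<star> g)"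
proof -
  have "psi x \<star> g = psi g \<star> psi w"
    using phom_eq(1)[OF assms(3), THEN arg_cong, of psi] by (simp add: psi_fm_cmp)
  then show ?thesis by (simp add: avg_def cmps psi_fm_cmp)
qed

text \<open>The structure matrix of \<open>SX\<close>. Since \<open>psi\<close> turns
  \<open>X @ psl X\<close> into \<open>psl X @ X\<close>, the swap consists of identities between
  equal orbits.\<close>

definition sw :: "orbit list \<Rightarrow> 'r fm" where
  "sw X = in1 X (psl X) \<star> pr2 (psl X) X + in2 X (psl X) \<star> pr1 (psl X) X"

lemma psi_sw: "psi (sw X) = in1 (psl X) X \<star> pr2 X (psl X) + in2 (psl X) X \<star> pr1 X (psl X)"
  by (simp add: sw_def psi_fm_cmp)

lemma hom_sw: "hom (psl X @ X) (X @ psl X) (sw X)"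
  unfolding sw_def by (intro hom_add) (rule hom_cmp[OF hom_in1 hom_pr2] hom_cmp[OF hom_in2 hom_pr1])+

lemma pob_sw: "ob b X \<Longrightarrow> pob b (X @ psl X) (sw X)"
proof -
  assume "ob b X"
  moreover have "sw X \<star> psi (sw X) = in2 X (psl X) \<star> pr2 X (psl X) + in1 X (psl X) \<star> pr1 X (psl X)"
    by (simp add: psi_sw) (simp add: sw_def cmps)
  ultimately show ?thesis
    unfolding pob_def using hom_sw[of X] in_pr[of u X "psl X"] by (simp add: add.commute)
qed

lemma sw_in: "sw X \<star> (in1 (psl X) X \<star> a) = in2 X (psl X) \<star> (one (psl X) \<star> a)"
  "sw X \<star> (in2 (psl X) X \<star> a) = in1 X (psl X) \<star> (one X \<star> a)"
  by (simp_all add: sw_def cmps)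

lemma pr_sw: "pr1 X (psl X) \<star> sw X = pr2 (psl X) X" "pr2 X (psl X) \<star> sw X = pr1 (psl X) X"
  by (simp_all add: sw_def cmps)

text \<open>\<open>psi\<close> is an involution that respects composition, so each problem about the
  image is moved back by \<open>psi\<close>, solved there, and moved forward again.\<close>

lemma lc_psi:
  assumes "lc b Y I W j p" shows "lc b (psl Y) (psl I) (psl W) (psi j) (psi p)"
proof -
  note a = assms[unfolded lc_def]
  have "hom (psl Y) (psl I) (psi j)" "hom (psl I) (psl W) (psi p)" using a hom_psi by blast+
  moreover have "psi p \<star> psi j = 0" using a by (simp add: psi_fm_cmp[symmetric])
  moreover have "\<exists>g. hom (psl I) P g \<and> f = g \<star> psi j" if "bd b P" "hom (psl Y) P f" for P f
  proof -
    have "bd b (psl P)" "hom Y (psl P) (psi f)" using that hom_psi[of "psl Y" P f] by auto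
    then obtain g where g: "hom I (psl P) g" "psi f = g \<star> j" using a by blast
    have "f = psi g \<star> psi j" using arg_cong[OF g(2), of psi] unfolding psi_psi psi_fm_cmp .
    then show ?thesis using hom_psi[OF g(1)] by auto
  qed
  moreover have "\<exists>g. hom (psl W) T g \<and> h = g \<star> psi p" if "ob b T" "hom (psl I) T h" "h \<star> psi j = 0" for T h
  proof -
    have "psi h \<star> j = 0" using arg_cong[OF that(3), of psi] unfolding psi_fm_cmp psi_psi psi_zero .
    moreover have "ob b (psl T)" "hom I (psl T) (psi h)"
      using that hom_psi[of "psl I" T h] by auto
    ultimately obtain g where g: "hom W (psl T) g" "psi h = g \<star> p" using a by blast
    have "h = psi g \<star> psi p" using arg_cong[OF g(2), of psi] unfolding psi_psi psi_fm_cmp .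
    then show ?thesis using hom_psi[OF g(1)] by auto
  qed
  moreover have "g = 0" if "ob b T" "hom (psl W) T g" "g \<star> psi p = 0" for T g
  proof -
    have "psi g \<star> p = 0" using arg_cong[OF that(3), of psi] unfolding psi_fm_cmp psi_psi psi_zero .
    moreover have "ob b (psl T)" "hom W (psl T) (psi g)"
      using that hom_psi[of "psl W" T g] by auto
    ultimately have "psi g = 0" using a by blast
    then have "psi (psi g) = psi 0" by (rule arg_cong)
    then show ?thesis by simp
  qed
  moreover have "bd b (psl I)" "ob b (psl W)" using a by simp_all
  ultimately show ?thesis unfolding lc_def by blast
qed

text \<open>A diagonal coefficient of the identity is 1, so one term of the factorization is a unit;
  the corresponding summand of \<open>X\<close> is isomorphic to a boundary orbit and has its
  width.\<close>

lemma NN_one_bd: assumes "NN b X X (one X)" shows "bd b X"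
  unfolding bd_def
proof
  fix m assume "m \<in> set X"
  then obtain i where i: "i < length X" "m = X ! i" by (metis in_set_conv_nth)
  obtain P g h where P: "bd b P" "hom X P g" "hom P X h" "one X = h \<star> g" using assms by (rule NNE)
  have "(\<Sum>j<length P. ent P X h i j * ent X P g j i * u ^ cc (X ! i) (P ! j) (X ! i)) = 1"
    using ent_cmp[of P X h X g u i i] P(2,3) ent_one[OF i(1), where 'a = 'r] unfolding P(4) by simp
  then obtain j where "j < length P" "u ^ cc (X ! i) (P ! j) (X ! i) dvd 1"
    using nonunit_sum[of "{..<length P}"] unit_mult by (metis (no_types, lifting) dvd_refl finite_lessThan lessThan_iff)
  then show "width m = b" using P(1) unit_u_power cc_zero_width i by (metis bd_def nth_mem)
qed

lemma bd_NN_one: "bd b X \<Longrightarrow> NN b X X (one X)"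
  using NNI[of b X X "one X" X "one X"] by simp

section \<open>The arrows of \<open>F_psi\<close> as matrices\<close>

definition PO :: "orbit list \<Rightarrow> 'r fm \<Rightarrow> 'r fpobj" where "PO X x = (X, Tr (psl X) x X)"
definition PT :: "orbit list \<Rightarrow> 'r fm \<Rightarrow> 'r fm \<Rightarrow> orbit list \<Rightarrow> 'r fm \<Rightarrow> 'r fparrow" where
  "PT X x a Y y = (PO X x, Tr X a Y, PO Y y)"

lemma PO_eq: "pob b X x \<Longrightarrow> pob b' X' x' \<Longrightarrow> PO X x = PO X' x' \<longleftrightarrow> X = X' \<and> x = x'"
  by (auto simp: PO_def Tr_inj pobD)

lemma PT_eq: "hom X Y a \<Longrightarrow> hom X Y a' \<Longrightarrow> PT X x a Y y = PT X x a' Y y \<longleftrightarrow> a = a'"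
  by (auto simp: PT_def Tr_inj)

lemma Ob_FP: "A \<in> Ob (F_psi u b) \<longleftrightarrow> (\<exists>X x. A = PO X x \<and> pob b X x)"
proof
  assume "A \<in> Ob (F_psi u b)"
  then obtain X \<xi> where A: "A = (X, \<xi>)" and *: "ob b X" "\<xi> \<in> homs (cat_F u b) (psl X) X"
    "Cmp (cat_F u b) \<xi> (psi_arrow \<xi>) = Id (cat_F u b) X"
    by (auto simp: F_psi_def F_psi_objects_def Ob_F)
  then obtain x where x: "\<xi> = Tr (psl X) x X" "hom (psl X) X x" by (auto simp: homs_F)
  have "hom X (psl X) (psi x)" using hom_psi[OF x(2)] by simp
  then have "Tr X (x \<star> psi x) X = Tr X (one X) X" "hom X X (x \<star> psi x)"
    using *(3) x hom_cmp by (auto simp: Tr_psi Cmp_F Id_F)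
  then have "x \<star> psi x = one X" by (simp add: Tr_inj)
  then show "\<exists>X x. A = PO X x \<and> pob b X x" using A x * by (auto simp: PO_def pob_def)
next
  assume "\<exists>X x. A = PO X x \<and> pob b X x"
  then obtain X x where A: "A = PO X x" and p: "pob b X x" by blast
  note d = pobD[OF p]
  have "is_isomorphism (cat_F u b) (Tr (psl X) x X)"
    using d by (intro is_iso_Tr[of _ _ _ "psi x"]) auto
  then show "A \<in> Ob (F_psi u b)"
    using d by (simp add: A PO_def F_psi_def F_psi_objects_def Ob_F Tr_psi Cmp_F Id_F)
qed

lemma F_psi_objects_FP: "A \<in> F_psi_objects u b \<longleftrightarrow> (\<exists>X x. A = PO X x \<and> pob b X x)"
  using Ob_FP[of A b] by (simp add: F_psi_def)

lemma Arr_FP: "f \<in> Arr (F_psi u b) \<longleftrightarrow>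
    (\<exists>X x a Y y. f = PT X x a Y y \<and> pob b X x \<and> pob b Y y \<and> phom X x Y y a)"
proof
  assume "f \<in> Arr (F_psi u b)"
  then obtain X \<xi> m Y \<eta> where f: "f = ((X, \<xi>), m, (Y, \<eta>))" "(X, \<xi>) \<in> F_psi_objects u b"
    "(Y, \<eta>) \<in> F_psi_objects u b" "m \<in> homs (cat_F u b) X Y"
    "Cmp (cat_F u b) m \<xi> = Cmp (cat_F u b) \<eta> (psi_arrow m)"
    by (auto simp: F_psi_def)
  then obtain x y where x: "\<xi> = Tr (psl X) x X" "pob b X x" and y: "\<eta> = Tr (psl Y) y Y" "pob b Y y"
    by (auto simp: F_psi_objects_FP PO_def)
  obtain a where a: "m = Tr X a Y" "hom X Y a" using f by (auto simp: homs_F)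
  have "Tr (psl X) (a \<star> x) Y = Tr (psl X) (y \<star> psi a) Y"
    using f(5) pobD[OF x(2)] pobD[OF y(2)] a by (simp add: x(1) y(1) Tr_psi Cmp_F)
  then have "a \<star> x = y \<star> psi a"
    using hom_cmp[OF a(2) pobD(2)[OF x(2)]] hom_cmp[OF pobD(2)[OF y(2)] hom_psi[OF a(2)]]
    by (simp add: Tr_inj)
  then show "\<exists>X x a Y y. f = PT X x a Y y \<and> pob b X x \<and> pob b Y y \<and> phom X x Y y a"
    using f x y a unfolding PT_def PO_def phom_def by blast
next
  assume "\<exists>X x a Y y. f = PT X x a Y y \<and> pob b X x \<and> pob b Y y \<and> phom X x Y y a"
  then obtain X x a Y y where f: "f = PT X x a Y y" "pob b X x" "pob b Y y" "phom X x Y y a" by blast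
  have "PO X x \<in> F_psi_objects u b" "PO Y y \<in> F_psi_objects u b" using f by (auto simp: F_psi_objects_FP)
  then show "f \<in> Arr (F_psi u b)"
    using f pobD[OF f(2)] pobD[OF f(3)] by (simp add: PT_def PO_def F_psi_def phom_def Tr_psi Cmp_F)
qed

lemma PT_mem_Arr: "pob b X x \<Longrightarrow> pob b Y y \<Longrightarrow> phom X x Y y a \<Longrightarrow> PT X x a Y y \<in> Arr (F_psi u b)"
  unfolding Arr_FP by blast

lemma Dom_Cod_FP [simp]: "Dom (F_psi u b) (PT X x a Y y) = PO X x" "Cod (F_psi u b) (PT X x a Y y) = PO Y y"
  by (simp_all add: F_psi_def PT_def)

lemma PT_homs: "pob b X x \<Longrightarrow> pob b Y y \<Longrightarrow> phom X x Y y a \<Longrightarrow> PT X x a Y y \<in> homs (F_psi u b) (PO X x) (PO Y y)"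
  by (simp add: homs_def PT_mem_Arr)

lemma homs_FP:
  assumes "pob b X x" "pob b Y y"
  shows "f \<in> homs (F_psi u b) (PO X x) (PO Y y) \<longleftrightarrow> (\<exists>a. f = PT X x a Y y \<and> phom X x Y y a)"
proof
  assume "f \<in> homs (F_psi u b) (PO X x) (PO Y y)"
  then obtain X' x' a Y' y' where f: "f = PT X' x' a Y' y'" "pob b X' x'" "pob b Y' y'" "phom X' x' Y' y' a"
    "PO X' x' = PO X x" "PO Y' y' = PO Y y"
    unfolding homs_def Arr_FP by auto
  then have "X' = X" "x' = x" "Y' = Y" "y' = y" using PO_eq assms by blast+
  then show "\<exists>a. f = PT X x a Y y \<and> phom X x Y y a" using f by blast
qed (use assms PT_homs in blast)

lemma Cmp_FP: "hom Y Z g \<Longrightarrow> Cmp (F_psi u b) (PT Y y g Z z) (PT X x f Y y) = PT X x (g \<star> f) Z z"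
  by (simp add: F_psi_def PT_def PO_def Cmp_F)

lemma Id_FP: "Id (F_psi u b) (PO X x) = PT X x (one X) X x"
  by (simp add: F_psi_def PT_def PO_def Id_F)

lemma Zer_FP: "Zer (F_psi u b) (PO X x) (PO Y y) = PT X x 0 Y y"
  by (simp add: F_psi_def PT_def PO_def Zer_F)

lemma Add_FP: "Add (F_psi u b) (PT X x a Y y) (PT X x a' Y y) = PT X x (a + a') Y y"
  by (simp add: F_psi_def PT_def PO_def Add_F)

end

section \<open>Projective-injectives and null maps in the category with involution\<close>

context frob
begin

abbreviation FP :: "('r fpobj, 'r fparrow) precat" where "FP \<equiv> F_psi u b"
abbreviation EP :: "('r fparrow \<times> 'r fparrow) set" where "EP \<equiv> F_psi_exact u b E"

lemma EP_pairE:
  assumes "(i, p) \<in> EP"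
  obtains Y y j I t q W w where "i = PT Y y j I t" "p = PT I t q W w" "pob b Y y" "pob b I t" "pob b W w"
    "phom Y y I t j" "phom I t W w q" "(Tr Y j I, Tr I q W) \<in> E"
proof -
  have c: "i \<in> Arr FP" "p \<in> Arr FP" "Cod FP i = Dom FP p" and E: "(fst (snd i), fst (snd p)) \<in> E"
    using assms by (auto simp: F_psi_exact_def composable_def)
  obtain Y y j I t where i: "i = PT Y y j I t" "pob b Y y" "pob b I t" "phom Y y I t j"
    using c(1) unfolding Arr_FP by blast
  obtain I' t' q W w where p: "p = PT I' t' q W w" "pob b I' t'" "pob b W w" "phom I' t' W w q"
    using c(2) unfolding Arr_FP by blast
  have "I' = I \<and> t' = t" using c(3) i p PO_eq by auto
  moreover have "(Tr Y j I, Tr I' q W) \<in> E" using E i p by (simp add: PT_def)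
  ultimately show thesis using that i p by blast
qed

lemma EP_I:
  assumes "pob b Y y" "pob b I t" "pob b W w" "phom Y y I t j" "phom I t W w q" "(Tr Y j I, Tr I q W) \<in> E"
  shows "(PT Y y j I t, PT I t q W w) \<in> EP"
  unfolding F_psi_exact_def composable_def using assms PT_mem_Arr by (simp add: PT_def[of _ _ j] PT_def[of _ _ q])
    (simp add: PT_def[symmetric])

text \<open>A boundary embedding \<open>i\<close> of \<open>Y\<close> and its conjugate
  \<open>psi(i) psi(y)\<close> together form an equivariant map into \<open>I @ psl I\<close> with
  the swap. Its cokernel inherits a structure map \<open>w\<close> from the universal property, and
  cancelling the epimorphism \<open>q\<close> gives \<open>w psi(w) = 1\<close>.\<close>

lemma psi_embedding:
  assumes "pob b Y y"
  obtains I t j q W w where "bd b I" "pob b I t" "pob b W w" "phom Y y I t j" "phom I t W w q"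
    "(Tr Y j I, Tr I q W) \<in> E"
proof -
  note y = pobD[OF assms]
  obtain I i where I: "bd b I" "hom Y I i" "admissible_mono E (Tr Y i I)" using embedding y by blast
  let ?t = "psi i \<star> psi y" and ?I = "I @ psl I"
  have ht: "hom Y (psl I) ?t" using hom_cmp[OF hom_psi[OF I(2)] y(5)] .
  have obI: "ob b I" using I bd_ob by blast
  define j where "j = in1 I (psl I) \<star> i + in2 I (psl I) \<star> ?t"
  have ad: "admissible_mono E (Tr Y j ?I)" unfolding j_def
    using I y ht obI by (intro adm_mono_pair) auto
  have pI: "pob b ?I (sw I)" using obI by (rule pob_sw)
  have hj: "hom Y ?I j" unfolding j_def
    using I ht by (intro hom_add) (blast intro: hom_cmp hom_in1 hom_in2)+
  have ji: "psi i \<star> (psi y \<star> y) = psi i" using y hom_psi[OF I(2)] by (simp add: ones)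
  have pj: "phom Y y ?I (sw I) j"
    unfolding phom_def using hj I(2) hom_psi[OF I(2)] hom_cmp[OF I(2) y(2)]
    by (simp add: j_def cmps psi_fm_cmp sw_in ones ji) 
  obtain p where "(Tr Y j ?I, p) \<in> E" using ad by (auto simp: admissible_mono_def)
  moreover then obtain q W where p: "p = Tr ?I q W" "hom ?I W q" "ob b W"
    by (elim E_pairE) (auto dest!: Tr_eqD)
  ultimately have E: "(Tr Y j ?I, Tr ?I q W) \<in> E" by simp
  have bdI: "bd b ?I" using I by simp
  have lc: "lc b Y ?I W j q" using E_lc[OF E hj p(2) bdI] .
  note l = lc[unfolded lc_def] and l' = lc_psi[OF lc, unfolded lc_def]
  have hsw: "hom (psl ?I) ?I (sw I)" using pobD[OF pI] by simp
  have "hom (psl ?I) W (q \<star> sw I)" using hom_cmp[OF p(2) hsw] .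
  moreover have "(q \<star> sw I) \<star> psi j = 0"
  proof -
    have "(q \<star> sw I) \<star> psi j = (q \<star> j) \<star> y" using phom_eq(1)[OF pj] by (simp add: fm_cmp_assoc)
    then show ?thesis using l by (simp add: fm_cmp_zero)
  qed
  ultimately obtain w where w: "hom (psl W) W w" "q \<star> sw I = w \<star> psi q" using l' p(3) by blast
  have "w \<star> psi w = one W"
  proof -
    have "(w \<star> psi w) \<star> q = w \<star> psi (w \<star> psi q)" by (simp add: cmps psi_fm_cmp)
    also have "\<dots> = w \<star> psi (q \<star> sw I)" by (simp only: w(2))
    also have "\<dots> = (w \<star> psi q) \<star> psi (sw I)" by (simp add: cmps psi_fm_cmp)
    also have "\<dots> = (q \<star> sw I) \<star> psi (sw I)" by (simp only: w(2))
    also have "\<dots> = q \<star> (sw I \<star> psi (sw I))" by (simp only: fm_cmp_assoc)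
    also have "\<dots> = q" using pob_cancel(1)[OF pI p(2)] .
    finally have "(w \<star> psi w - one W) \<star> q = 0" using p(2) by (simp add: fm_cmp_diff ones)
    moreover have "hom W W (w \<star> psi w - one W)"
      using hom_cmp[OF w(1), of W "psi w"] hom_psi[OF w(1)] by (intro hom_diff) auto
    ultimately have "w \<star> psi w - one W = 0" using l p(3) by blast
    then show ?thesis by simp
  qed
  then have "pob b W w" using p w by (simp add: pob_def)
  moreover have "phom ?I (sw I) W w q" using p w by (simp add: phom_def)
  ultimately show thesis using that[OF bdI pI _ pj _ E] by blast
qed

text \<open>An injective object splits its equivariant boundary embedding, so its identity is null
  and \<open>NN_one_bd\<close> applies. Conversely, lifts and extensions exist after the involutions
  are forgotten, and their averages are equivariant solutions.\<close>

lemma proj_inj_FP: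
  assumes "pob b X x" shows "projective_injective FP EP (PO X x) \<longleftrightarrow> bd b X"
proof
  assume "projective_injective FP EP (PO X x)"
  then have inj: "is_injective FP EP (PO X x)" by (simp add: projective_injective_def)
  obtain I t j q W w where e: "bd b I" "pob b I t" "pob b W w" "phom X x I t j" "phom I t W w q"
    "(Tr X j I, Tr I q W) \<in> E" using assms by (rule psi_embedding)
  have "admissible_mono EP (PT X x j I t)" using EP_I[OF assms e(2-6)] by (rule admissible_monoI)
  moreover have "PT X x (one X) X x \<in> homs FP (Dom FP (PT X x j I t)) (PO X x)"
    using PT_homs[OF assms assms phom_one[OF assms]] by simp
  ultimately have "\<exists>g\<in>homs FP (Cod FP (PT X x j I t)) (PO X x). Cmp FP g (PT X x j I t) = PT X x (one X) X x"
    using inj unfolding is_injective_def by blast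
  then obtain g where "g \<in> homs FP (PO I t) (PO X x)" and g: "Cmp FP g (PT X x j I t) = PT X x (one X) X x"
    unfolding Dom_Cod_FP by blast
  then obtain r where r: "g = PT I t r X x" "phom I t X x r" using homs_FP[OF e(2) assms] by blast
  have "r \<star> j = one X"
    using g hom_cmp[OF phom_hom[OF r(2)] phom_hom[OF e(4)]] phom_hom[OF r(2)]
    by (simp add: r(1) Cmp_FP PT_eq)
  then have "NN b X X (one X)" using NNI[OF e(1) phom_hom[OF e(4)] phom_hom[OF r(2)]] by simp
  then show "bd b X" by (rule NN_one_bd)
next
  assume bd: "bd b X"
  have ob: "PO X x \<in> Ob FP" unfolding Ob_FP using assms by blast
  have "\<exists>g\<in>homs FP (PO X x) (Dom FP p). Cmp FP p g = f"
    if a: "admissible_epi EP p" "f \<in> homs FP (PO X x) (Cod FP p)" for p f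
  proof -
    obtain i where "(i, p) \<in> EP" using a(1) by (auto simp: admissible_epi_def)
    then obtain Y y j I t q W w where p: "p = PT I t q W w" "pob b I t" "pob b W w"
      "phom I t W w q" "(Tr Y j I, Tr I q W) \<in> E" by (rule EP_pairE) blast
    obtain f' where f: "f = PT X x f' W w" "phom X x W w f'"
      using a(2) homs_FP[OF assms p(3)] unfolding p(1) Dom_Cod_FP by blast
    have "admissible_epi E (Tr I q W)" using p(5) unfolding admissible_epi_def by (rule exI)
    then obtain g where g: "hom X I g" "q \<star> g = f'" using proj_lift[OF bd] p(4) f(2) phom_hom by blast
    have "q \<star> avg t x g = f'" using avg_left[OF p(4)] avg_id[OF assms f(2)] by (simp add: g)
    then show ?thesis
      using phom_avg[OF assms p(2) g(1)] PT_homs[OF assms p(2)] phom_hom[OF p(4)]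
      unfolding p(1) f(1) Dom_Cod_FP by (intro bexI[of _ "PT X x (avg t x g) I t"]) (simp_all add: Cmp_FP)
  qed
  moreover have "\<exists>g\<in>homs FP (Cod FP i) (PO X x). Cmp FP g i = f"
    if a: "admissible_mono EP i" "f \<in> homs FP (Dom FP i) (PO X x)" for i f
  proof -
    obtain p where "(i, p) \<in> EP" using a(1) by (auto simp: admissible_mono_def)
    then obtain Y y j I t q W w where p: "i = PT Y y j I t" "pob b Y y" "pob b I t"
      "phom Y y I t j" "(Tr Y j I, Tr I q W) \<in> E" by (rule EP_pairE) blast
    obtain f' where f: "f = PT Y y f' X x" "phom Y y X x f'"
      using a(2) homs_FP[OF p(2) assms] unfolding p(1) Dom_Cod_FP by blast
    have "admissible_mono E (Tr Y j I)" using p(5) by (rule admissible_monoI)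
    then obtain g where g: "hom I X g" "g \<star> j = f'" using inj_extend[OF bd] p(4) f(2) phom_hom by blast
    have "avg x t g \<star> j = f'" using avg_right[OF p(3,2,4)] avg_id[OF p(2) f(2)] by (simp add: g)
    then show ?thesis
      using phom_avg[OF p(3) assms g(1)] PT_homs[OF p(3) assms] phom_hom[OF phom_avg[OF p(3) assms g(1)]]
      unfolding p(1) f(1) Dom_Cod_FP by (intro bexI[of _ "PT I t (avg x t g) X x"]) (simp_all add: Cmp_FP)
  qed
  ultimately show "projective_injective FP EP (PO X x)"
    unfolding projective_injective_def is_projective_def is_injective_def using ob by blast
qed

text \<open>A factorization \<open>h g\<close> through \<open>P\<close> is replaced by one through
  \<open>SP\<close>: \<open>g\<close> is paired with its conjugate, and so is \<open>h\<close>, with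
  weight 1/2. The new composite is the average of \<open>a\<close>, which is \<open>a\<close>
  itself.\<close>

lemma factors_FP:
  assumes "pob b X x" "pob b Y y" "phom X x Y y a"
  shows "factors_through_proj_inj FP EP (PT X x a Y y) \<longleftrightarrow> NN b X Y a"
proof
  assume "factors_through_proj_inj FP EP (PT X x a Y y)"
  then obtain g h where gh: "g \<in> Arr FP" "h \<in> Arr FP" "Cod FP g = Dom FP h"
    "projective_injective FP EP (Cod FP g)" "PT X x a Y y = Cmp FP h g"
    by (auto simp: factors_through_proj_inj_def composable_def)
  obtain X' x' P t g' where g: "g = PT X' x' g' P t" "pob b X' x'" "pob b P t" "phom X' x' P t g'"
    using gh(1) unfolding Arr_FP by blast
  obtain P' t' Y' y' h' where h: "h = PT P' t' h' Y' y'" "pob b P' t'" "pob b Y' y'" "phom P' t' Y' y' h'"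
    using gh(2) unfolding Arr_FP by blast
  have P: "P' = P" "t' = t" using gh(3) g h PO_eq by auto
  have bd: "bd b P" using gh(4) g proj_inj_FP by auto
  have "PT X x a Y y = PT X' x' (h' \<star> g') Y' y'"
    using gh(5) phom_hom[OF h(4)] unfolding g(1) h(1) P by (simp add: Cmp_FP)
  then have "X' = X" "Y' = Y" "Tr X a Y = Tr X (h' \<star> g') Y" by (auto simp: PT_def PO_def)
  moreover from this have "hom X Y (h' \<star> g')" using phom_hom[OF h(4)] phom_hom[OF g(4)] P hom_cmp by blast
  ultimately have "a = h' \<star> g'" using phom_hom[OF assms(3)] Tr_inj by blast
  then show "NN b X Y a"
    using NNI[OF bd phom_hom[OF g(4)]] phom_hom[OF h(4)] P \<open>X' = X\<close> \<open>Y' = Y\<close> by blast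
next
  assume "NN b X Y a"
  then obtain P g h where P: "bd b P" "hom X P g" "hom P Y h" "a = h \<star> g" by (rule NNE)
  note x = pobD[OF assms(1)] and y = pobD[OF assms(2)]
  let ?P = "P @ psl P"
  have pP: "pob b ?P (sw P)" using P bd_ob pob_sw by blast
  define g' where "g' = in1 P (psl P) \<star> g + in2 P (psl P) \<star> (psi g \<star> psi x)"
  define h' where "h' = half *s (h \<star> pr1 P (psl P) + y \<star> (psi h \<star> pr2 P (psl P)))"
  have hg: "hom (psl X) (psl P) (psi g)" and hh: "hom (psl P) (psl Y) (psi h)" using P hom_psi by blast+
  have pg: "phom X x ?P (sw P) g'"
  proof -
    have "hom X ?P g'" unfolding g'_def
      using P(2) hom_cmp[OF hg x(5)] by (intro hom_add) (blast intro: hom_cmp hom_in1 hom_in2)+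
    moreover have "g' \<star> x = sw P \<star> psi g'"
      unfolding g'_def using pob_cancel(3)[OF assms(1) hg] hom_cmp[OF P(2) x(2)] hg
      by (simp add: cmps psi_fm_cmp sw_in ones)
    ultimately show ?thesis by (simp add: phom_def)
  qed
  have ph: "phom ?P (sw P) Y y h'"
  proof -
    have "hom ?P Y (h \<star> pr1 P (psl P) + y \<star> (psi h \<star> pr2 P (psl P)))"
      using hom_cmp[OF P(3) hom_pr1] hom_cmp[OF y(2) hom_cmp[OF hh hom_pr2]] by (rule hom_add)
    moreover have "y \<star> (psi y \<star> (h \<star> pr2 (psl P) P)) = h \<star> pr2 (psl P) P"
      using pob_cancel(2)[OF assms(2) hom_cmp[OF P(3) hom_pr2]] .
    ultimately have "phom ?P (sw P) Y y (h \<star> pr1 P (psl P) + y \<star> (psi h \<star> pr2 P (psl P)))"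
      by (simp add: phom_def cmps psi_fm_cmp pr_sw)
    then show ?thesis unfolding h'_def by (rule phom_smul)
  qed
  have "h' \<star> g' = avg y x a"
    using ones(1)[OF P(2)] ones(2)[OF hg]
    by (simp add: h'_def g'_def avg_def P(4) cmps psi_fm_cmp smul_simps)
  then have "PT X x a Y y = Cmp FP (PT ?P (sw P) h' Y y) (PT X x g' ?P (sw P))"
    using avg_id[OF assms(1,3)] phom_hom[OF ph] by (simp add: Cmp_FP)
  moreover have "projective_injective FP EP (PO ?P (sw P))" using proj_inj_FP[OF pP] P(1) by simp
  ultimately show "factors_through_proj_inj FP EP (PT X x a Y y)"
    unfolding factors_through_proj_inj_def composable_def
    using PT_mem_Arr[OF assms(1) pP pg] PT_mem_Arr[OF pP assms(2) ph] Dom_Cod_FP by metis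
qed

end


section \<open>The stable category\<close>

lemma Collect_eq_singleton_iff: "P z \<Longrightarrow> {g f | f. P f} = {g z} \<longleftrightarrow> (\<forall>f. P f \<longrightarrow> g f = g z)"
  by blast

lemma (in dvr) lcD:
  assumes "lc b Y I W j p"
  shows "bd b I" "ob b W" "hom Y I j" "hom I W p" "p \<star> j = 0"
  using assms unfolding lc_def by blast+

lemma (in dvr) lc_approx:
  assumes "lc b Y I W j p" "bd b P" "hom Y P f"
  obtains g where "hom I P g" "f = g \<star> j"
  using assms unfolding lc_def by blast

lemma (in dvr) lc_coker:
  assumes "lc b Y I W j p" "ob b T" "hom I T h" "h \<star> j = 0"
  obtains g where "hom W T g" "h = g \<star> p"
proof -
  have "\<forall>T h. ob b T \<and> hom I T h \<and> h \<star> j = 0 \<longrightarrow> (\<exists>g. hom W T g \<and> h = g \<star> p)"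
    using assms(1) unfolding lc_def by (elim conjE)
  from this[rule_format, of T h] assms(2-) that show thesis by blast
qed

lemma (in dvr) lc_epi: "lc b Y I W j p \<Longrightarrow> ob b T \<Longrightarrow> hom W T g \<Longrightarrow> g \<star> p = 0 \<Longrightarrow> g = 0"
  unfolding lc_def by blast

context frob
begin

abbreviation CP :: "('r fpobj, 'r fparrow set) precat" where "CP \<equiv> C_psi u b E"

definition SC :: "orbit list \<Rightarrow> 'r fm \<Rightarrow> 'r fm \<Rightarrow> orbit list \<Rightarrow> 'r fm \<Rightarrow> 'r fparrow set" where
  "SC X x a Y y = stable_class FP EP (PT X x a Y y)"

lemma SC_mem:
  assumes "pob b X x" "pob b Y y" "phom X x Y y a"
  shows "g \<in> SC X x a Y y \<longleftrightarrow> (\<exists>a'. g = PT X x a' Y y \<and> phom X x Y y a' \<and> NN b X Y (a' - a))"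
proof
  assume "g \<in> SC X x a Y y"
  then obtain h where "h \<in> homs FP (PO X x) (PO Y y)" "factors_through_proj_inj FP EP h"
    "g = Add FP (PT X x a Y y) h"
    by (auto simp: SC_def stable_class_def)
  moreover from this(1) obtain c where "h = PT X x c Y y" "phom X x Y y c"
    using homs_FP[OF assms(1,2)] by blast
  ultimately have "g = PT X x (a + c) Y y" "phom X x Y y (a + c)" "NN b X Y ((a + c) - a)"
    using factors_FP[OF assms(1,2)] phom_add[OF assms(3)] by (simp_all add: Add_FP)
  then show "\<exists>a'. g = PT X x a' Y y \<and> phom X x Y y a' \<and> NN b X Y (a' - a)" by blast
next
  assume "\<exists>a'. g = PT X x a' Y y \<and> phom X x Y y a' \<and> NN b X Y (a' - a)"
  then obtain a' where a': "g = PT X x a' Y y" "phom X x Y y a'" "NN b X Y (a' - a)" by blast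
  have c: "phom X x Y y (a' - a)" using phom_diff[OF a'(2) assms(3)] .
  have "g = Add FP (PT X x a Y y) (PT X x (a' - a) Y y)" by (simp add: Add_FP a'(1))
  moreover have "factors_through_proj_inj FP EP (PT X x (a' - a) Y y)"
    using factors_FP[OF assms(1,2) c] a'(3) by simp
  ultimately show "g \<in> SC X x a Y y"
    unfolding SC_def stable_class_def Dom_Cod_FP using PT_homs[OF assms(1,2) c] by blast
qed

lemma SC_eq:
  assumes "pob b X x" "pob b Y y" "phom X x Y y a" "phom X x Y y a'"
  shows "SC X x a Y y = SC X x a' Y y \<longleftrightarrow> NN b X Y (a - a')"
proof
  assume "SC X x a Y y = SC X x a' Y y"
  moreover have "PT X x a Y y \<in> SC X x a Y y"
    unfolding SC_mem[OF assms(1-3)] using assms(3) NN_zero[of b X Y] by (intro exI[of _ a]) simp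
  ultimately obtain a'' where "PT X x a Y y = PT X x a'' Y y" "phom X x Y y a''" "NN b X Y (a'' - a')"
    using SC_mem[OF assms(1,2,4)] by blast
  then show "NN b X Y (a - a')" using PT_eq phom_hom assms(3) by blast
next
  assume n: "NN b X Y (a - a')"
  have "NN b X Y (c - a) \<longleftrightarrow> NN b X Y (c - a')" for c
  proof
    show "NN b X Y (c - a')" if "NN b X Y (c - a)" using NN_add[OF that n] by simp
    show "NN b X Y (c - a)" if "NN b X Y (c - a')" using NN_diff[OF that n] by simp
  qed
  then show "SC X x a Y y = SC X x a' Y y"
    using SC_mem[OF assms(1-3)] SC_mem[OF assms(1,2,4)] by blast
qed

text \<open>Domains, composites and sums in the stable category are defined through
  \<open>SOME\<close> representatives. Any such representative has the expected ends and differs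
  from \<open>a\<close> by a null map.\<close>

lemma SC_some:
  assumes "pob b X x" "pob b Y y" "phom X x Y y a"
  obtains a' where "(SOME f. f \<in> SC X x a Y y) = PT X x a' Y y" "phom X x Y y a'" "NN b X Y (a' - a)"
proof -
  have "PT X x a Y y \<in> SC X x a Y y"
    unfolding SC_mem[OF assms] using assms(3) NN_zero[of b X Y] by (intro exI[of _ a]) simp
  then have "(SOME f. f \<in> SC X x a Y y) \<in> SC X x a Y y" by (rule someI)
  then show ?thesis using SC_mem[OF assms] that by blast
qed

lemma Ob_CP: "A \<in> Ob CP \<longleftrightarrow> (\<exists>X x. A = PO X x \<and> pob b X x)"
  by (simp add: C_psi_def stable_category_def Ob_FP)

lemma Arr_CP: "F \<in> Arr CP \<longleftrightarrow> (\<exists>X x a Y y. F = SC X x a Y y \<and> pob b X x \<and> pob b Y y \<and> phom X x Y y a)"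
proof -
  have A: "Arr CP = stable_class FP EP ` Arr FP" by (simp add: C_psi_def stable_category_def)
  show ?thesis
  proof
    assume "F \<in> Arr CP"
    then obtain f where f: "f \<in> Arr FP" "F = stable_class FP EP f" unfolding A by (rule imageE)
    from f(1) obtain X x a Y y where "f = PT X x a Y y" "pob b X x" "pob b Y y" "phom X x Y y a"
      unfolding Arr_FP by (elim exE conjE)
    then show "\<exists>X x a Y y. F = SC X x a Y y \<and> pob b X x \<and> pob b Y y \<and> phom X x Y y a"
      unfolding SC_def f(2) by (intro exI conjI) simp_all
  next
    assume "\<exists>X x a Y y. F = SC X x a Y y \<and> pob b X x \<and> pob b Y y \<and> phom X x Y y a"
    then show "F \<in> Arr CP" unfolding A SC_def by (elim exE conjE) (simp add: PT_mem_Arr)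
  qed
qed

lemma CP_raw:
  "Dom CP F = Dom FP (SOME f. f \<in> F)" "Cod CP F = Cod FP (SOME f. f \<in> F)"
  "Cmp CP G F = stable_class FP EP (Cmp FP (SOME g. g \<in> G) (SOME f. f \<in> F))"
  "Add CP G F = stable_class FP EP (Add FP (SOME g. g \<in> G) (SOME f. f \<in> F))"
  by (simp_all add: C_psi_def stable_category_def)

lemma Dom_Cod_CP:
  assumes "pob b X x" "pob b Y y" "phom X x Y y a"
  shows "Dom CP (SC X x a Y y) = PO X x" "Cod CP (SC X x a Y y) = PO Y y"
  by (rule SC_some[OF assms], simp add: CP_raw)+

lemma homs_CP:
  assumes "pob b X x" "pob b Y y"
  shows "F \<in> homs CP (PO X x) (PO Y y) \<longleftrightarrow> (\<exists>a. F = SC X x a Y y \<and> phom X x Y y a)"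
proof
  assume "F \<in> homs CP (PO X x) (PO Y y)"
  then obtain X' x' a Y' y' where f: "F = SC X' x' a Y' y'" "pob b X' x'" "pob b Y' y'" "phom X' x' Y' y' a"
    "PO X' x' = PO X x" "PO Y' y' = PO Y y"
    unfolding homs_def Arr_CP by (auto simp: Dom_Cod_CP)
  then have "X' = X" "x' = x" "Y' = Y" "y' = y" using PO_eq assms by blast+
  then show "\<exists>a. F = SC X x a Y y \<and> phom X x Y y a" using f by blast
next
  assume "\<exists>a. F = SC X x a Y y \<and> phom X x Y y a"
  then obtain a where a: "F = SC X x a Y y" "phom X x Y y a" by blast
  have "F \<in> Arr CP" unfolding Arr_CP using a assms by (intro exI conjI)
  then show "F \<in> homs CP (PO X x) (PO Y y)"
    unfolding homs_def using Dom_Cod_CP[OF assms a(2)] a(1) by simp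
qed

lemma Cmp_CP:
  assumes "pob b X x" "pob b Y y" "pob b Z z" "phom X x Y y f" "phom Y y Z z g"
  shows "Cmp CP (SC Y y g Z z) (SC X x f Y y) = SC X x (g \<star> f) Z z"
proof -
  obtain f' where f': "(SOME h. h \<in> SC X x f Y y) = PT X x f' Y y" "phom X x Y y f'" "NN b X Y (f' - f)"
    using SC_some[OF assms(1,2,4)] .
  obtain g' where g': "(SOME h. h \<in> SC Y y g Z z) = PT Y y g' Z z" "phom Y y Z z g'" "NN b Y Z (g' - g)"
    using SC_some[OF assms(2,3,5)] .
  have "Cmp CP (SC Y y g Z z) (SC X x f Y y) = SC X x (g' \<star> f') Z z"
    unfolding CP_raw f' g' Cmp_FP[OF phom_hom[OF g'(2)]] by (rule SC_def[symmetric])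
  also have "\<dots> = SC X x (g \<star> f) Z z"
  proof -
    have "NN b X Z ((g' - g) \<star> f' + g \<star> (f' - f))"
      using NN_right[OF g'(3) phom_hom[OF f'(2)]] NN_left[OF f'(3) phom_hom[OF assms(5)]] by (rule NN_add)
    moreover have "(g' - g) \<star> f' + g \<star> (f' - f) = g' \<star> f' - g \<star> f" by (simp add: cmps)
    ultimately show ?thesis
      using SC_eq[OF assms(1,3) phom_cmp[OF g'(2) f'(2)] phom_cmp[OF assms(5,4)]] by simp
  qed
  finally show ?thesis .
qed

lemma Id_CP: "Id CP (PO X x) = SC X x (one X) X x"
  by (simp add: C_psi_def stable_category_def Id_FP SC_def)

lemma Zer_CP: "Zer CP (PO X x) (PO Y y) = SC X x 0 Y y"
  by (simp add: C_psi_def stable_category_def Zer_FP SC_def)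

lemma Add_CP:
  assumes "pob b X x" "pob b Y y" "phom X x Y y f" "phom X x Y y g"
  shows "Add CP (SC X x f Y y) (SC X x g Y y) = SC X x (f + g) Y y"
proof -
  obtain f' where f': "(SOME h. h \<in> SC X x f Y y) = PT X x f' Y y" "phom X x Y y f'" "NN b X Y (f' - f)"
    using SC_some[OF assms(1,2,3)] .
  obtain g' where g': "(SOME h. h \<in> SC X x g Y y) = PT X x g' Y y" "phom X x Y y g'" "NN b X Y (g' - g)"
    using SC_some[OF assms(1,2,4)] .
  have "Add CP (SC X x f Y y) (SC X x g Y y) = SC X x (f' + g') Y y"
    unfolding CP_raw f' g' Add_FP by (rule SC_def[symmetric])
  moreover have "NN b X Y ((f' + g') - (f + g))"
    using NN_add[OF f'(3) g'(3)] by (simp add: algebra_simps)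
  ultimately show ?thesis
    using SC_eq[OF assms(1,2) phom_add[OF f'(2) g'(2)] phom_add[OF assms(3,4)]] by simp
qed

definition stiso :: "orbit list \<Rightarrow> 'r fm \<Rightarrow> orbit list \<Rightarrow> 'r fm \<Rightarrow> bool" where
  "stiso X x Y y \<longleftrightarrow> (\<exists>f g. phom X x Y y f \<and> phom Y y X x g \<and>
     NN b X X (g \<star> f - one X) \<and> NN b Y Y (f \<star> g - one Y))"

lemma stiso_sym: "stiso X x Y y \<Longrightarrow> stiso Y y X x"
  unfolding stiso_def by blast

lemma stiso_refl: "pob b X x \<Longrightarrow> stiso X x X x"
  unfolding stiso_def using phom_one[of b X x] NN_zero[of b X X] by (intro exI[of _ "one X"]) simp

lemma NN_cmp_one:
  assumes "hom X Y f" "hom Y X g" "hom Y Z f'" "hom Z Y g'"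
    "NN b X X (g \<star> f - one X)" "NN b Y Y (g' \<star> f' - one Y)"
  shows "NN b X X ((g \<star> g') \<star> (f' \<star> f) - one X)"
proof -
  have "(g \<star> g') \<star> (f' \<star> f) - one X = g \<star> ((g' \<star> f' - one Y) \<star> f) + (g \<star> f - one X)"
    using assms(1,2) by (simp add: cmps ones)
  then show ?thesis
    using NN_add[OF NN_left[OF NN_right[OF assms(6,1)] assms(2)] assms(5)] by (simp only:)
qed

lemma stiso_trans:
  assumes "stiso X x Y y" "stiso Y y Z z" shows "stiso X x Z z"
proof -
  obtain f g where 1: "phom X x Y y f" "phom Y y X x g" "NN b X X (g \<star> f - one X)" "NN b Y Y (f \<star> g - one Y)"
    using assms(1) by (auto simp: stiso_def)
  obtain f' g' where 2: "phom Y y Z z f'" "phom Z z Y y g'" "NN b Y Y (g' \<star> f' - one Y)" "NN b Z Z (f' \<star> g' - one Z)"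
    using assms(2) by (auto simp: stiso_def)
  note h = 1(1,2)[THEN phom_hom] 2(1,2)[THEN phom_hom]
  show ?thesis unfolding stiso_def
    using phom_cmp[OF 2(1) 1(1)] phom_cmp[OF 1(2) 2(2)]
      NN_cmp_one[OF h(1,2,3,4) 1(3) 2(3)] NN_cmp_one[OF h(4,3,2,1) 2(4) 1(4)] by blast
qed

lemma isomorphic_CP:
  assumes "pob b X x" "pob b Y y"
  shows "isomorphic CP (PO X x) (PO Y y) \<longleftrightarrow> stiso X x Y y"
proof -
  have eq: "(Cmp CP (SC Y y g X x) (SC X x f Y y) = Id CP (PO X x) \<longleftrightarrow> NN b X X (g \<star> f - one X))"
    if "phom X x Y y f" "phom Y y X x g" "pob b X x" "pob b Y y" for f g X x Y y
    using that by (simp add: Cmp_CP Id_CP SC_eq phom_cmp[of Y y X x g X x f] phom_one)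
  have "isomorphic CP (PO X x) (PO Y y) \<longleftrightarrow> (\<exists>F\<in>homs CP (PO X x) (PO Y y). \<exists>G\<in>homs CP (PO Y y) (PO X x).
     Cmp CP G F = Id CP (PO X x) \<and> Cmp CP F G = Id CP (PO Y y))"
    using assms unfolding isomorphic_def is_isomorphism_def Ob_CP homs_def[of CP "PO X x"] by auto
  also have "\<dots> \<longleftrightarrow> (\<exists>f g. phom X x Y y f \<and> phom Y y X x g \<and>
      Cmp CP (SC Y y g X x) (SC X x f Y y) = Id CP (PO X x) \<and>
      Cmp CP (SC X x f Y y) (SC Y y g X x) = Id CP (PO Y y))"
    unfolding Bex_def homs_CP[OF assms] homs_CP[OF assms(2,1)] by blast
  also have "\<dots> \<longleftrightarrow> stiso X x Y y"
    unfolding stiso_def using eq[OF _ _ assms] eq[OF _ _ assms(2,1)] by blast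
  finally show ?thesis .
qed

lemma zero_CP: assumes "pob b X x" shows "zero_object CP (PO X x) \<longleftrightarrow> bd b X"
proof -
  have "zero_object CP (PO X x) \<longleftrightarrow> SC X x (one X) X x = SC X x 0 X x"
    using assms Ob_CP by (auto simp: zero_object_def Id_CP Zer_CP)
  also have "\<dots> \<longleftrightarrow> NN b X X (one X)"
    using SC_eq[OF assms assms phom_one[OF assms] phom_zero] by simp
  finally show ?thesis using NN_one_bd bd_NN_one by blast
qed

lemma biproduct_CP_D:
  assumes "is_biproduct CP (PO X x) A' B'" "pob b X x"
  obtains A a B c i j p q where "A' = PO A a" "B' = PO B c" "pob b A a" "pob b B c"
    "phom A a X x i" "phom B c X x j" "phom X x A a p" "phom X x B c q"
    "NN b A A (p \<star> i - one A)" "NN b B B (q \<star> j - one B)" "NN b X X (i \<star> p + j \<star> q - one X)"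
proof -
  obtain iA iB pA pB where AB: "A' \<in> Ob CP" "B' \<in> Ob CP" and *:
    "iA \<in> homs CP A' (PO X x)" "iB \<in> homs CP B' (PO X x)" "pA \<in> homs CP (PO X x) A'" "pB \<in> homs CP (PO X x) B'"
    "Cmp CP pA iA = Id CP A'" "Cmp CP pB iB = Id CP B'"
    "Add CP (Cmp CP iA pA) (Cmp CP iB pB) = Id CP (PO X x)"
    using assms(1) unfolding is_biproduct_def by blast
  obtain A a B c where A: "A' = PO A a" "B' = PO B c" "pob b A a" "pob b B c" using AB Ob_CP by metis
  obtain i j p q where i: "iA = SC A a i X x" "phom A a X x i" "iB = SC B c j X x" "phom B c X x j"
     "pA = SC X x p A a" "phom X x A a p" "pB = SC X x q B c" "phom X x B c q"
    using *(1-4) unfolding A(1,2) homs_CP[OF A(3) assms(2)] homs_CP[OF A(4) assms(2)]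
      homs_CP[OF assms(2) A(3)] homs_CP[OF assms(2) A(4)] by blast
  note ph = phom_cmp[OF i(6,2)] phom_cmp[OF i(8,4)] phom_cmp[OF i(2,6)] phom_cmp[OF i(4,8)]
  have "NN b A A (p \<star> i - one A)" using *(5) A assms(2) i ph
    by (simp add: Cmp_CP Id_CP SC_eq phom_one)
  moreover have "NN b B B (q \<star> j - one B)" using *(6) A assms(2) i ph
    by (simp add: Cmp_CP Id_CP SC_eq phom_one)
  moreover have "NN b X X (i \<star> p + j \<star> q - one X)" using *(7) A assms(2) i ph
    by (simp add: Cmp_CP Id_CP Add_CP SC_eq phom_one phom_add)
  ultimately show thesis using that A i by blast
qed

text \<open>This is the Schanuel argument. The approximations give maps between \<open>I\<close> and
  \<open>I'\<close>, hence \<open>\<phi>\<close> from \<open>W'\<close> to \<open>W\<close> and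
  \<open>\<theta>\<close> back, and \<open>\<theta> \<phi> - 1\<close> factors through
  \<open>I'\<close>. So a map into \<open>W'\<close> is null as soon as its composite with
  \<open>\<phi>\<close> is.\<close>

lemma lc_compare:
  assumes X: "pob b X x" and lc: "lc b Y I W j p" "lc b Y I' W' j' p'"
    and pobs: "pob b Y y" "pob b I t" "pob b W w" "pob b I' t'" "pob b W' w'"
    and phoms: "phom Y y I t j" "phom I t W w p" "phom Y y I' t' j'" "phom I' t' W' w' p'"
    and van: "\<And>f. phom X x W w f \<Longrightarrow> NN b X W f" and f: "phom X x W' w' f"
  shows "NN b X W' f"
proof -
  note l = lcD[OF lc(1)] and l' = lcD[OF lc(2)]
  note h = phoms[THEN phom_hom]
  have obW: "ob b W" "ob b W'" "ob b I'" using pobs pobD(1) by blast+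
  obtain g0 where g0: "hom I' I g0" "j = g0 \<star> j'" using lc_approx[OF lc(2) l(1) h(1)] .
  \<comment> \<open>\<open>\<phi>\<close> must be equivariant because \<open>van\<close> speaks of
    equivariant maps; hence \<open>g0\<close> is averaged. \<open>k\<close> and
    \<open>\<theta>\<close> may stay arbitrary, because \<open>NN\<close> ignores
    involutions.\<close>
  define g where "g = avg t t' g0"
  have g: "phom I' t' I t g" unfolding g_def using phom_avg[OF pobs(4,2) g0(1)] .
  have gj: "g \<star> j' = j"
    using avg_right[OF pobs(4,1) phoms(3), of t g0] avg_id[OF pobs(1) phoms(1)] g0(2) by (simp add: g_def)
  obtain k where k: "hom I I' k" "j' = k \<star> j" using lc_approx[OF lc(1) l'(1) h(3)] .
  have "(p \<star> g) \<star> j' = 0" using l by (simp add: fm_cmp_assoc gj)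
  then obtain \<phi> where \<phi>: "hom W' W \<phi>" "p \<star> g = \<phi> \<star> p'"
    using lc_coker[OF lc(2) obW(1) hom_cmp[OF h(2) phom_hom[OF g]]] by blast
  have "(p' \<star> k) \<star> j = 0" using l' k(2) by (simp add: fm_cmp_assoc)
  then obtain \<theta> where \<theta>: "hom W W' \<theta>" "p' \<star> k = \<theta> \<star> p"
    using lc_coker[OF lc(1) obW(2) hom_cmp[OF h(4) k(1)]] by blast
  have "phom W' w' W w \<phi>"
  proof -
    have "hom (psl W') W (\<phi> \<star> w' - w \<star> psi \<phi>)"
      using hom_cmp[OF \<phi>(1) pobD(2)[OF pobs(5)]] hom_cmp[OF pobD(2)[OF pobs(3)] hom_psi[OF \<phi>(1)]] by (rule hom_diff)
    moreover have "(\<phi> \<star> w' - w \<star> psi \<phi>) \<star> psi p' = 0"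
    proof -
      have "\<phi> \<star> (w' \<star> psi p') = (\<phi> \<star> p') \<star> t'" using phom_eq(1)[OF phoms(4)] by (simp add: fm_cmp_assoc)
      also have "\<dots> = p \<star> (g \<star> t')" by (simp add: \<phi>(2)[symmetric] fm_cmp_assoc)
      also have "\<dots> = (p \<star> t) \<star> psi g" using phom_eq(1)[OF g] by (simp add: fm_cmp_assoc)
      also have "\<dots> = w \<star> psi (p \<star> g)" using phom_eq(1)[OF phoms(2)] by (simp add: fm_cmp_assoc psi_fm_cmp)
      also have "\<dots> = w \<star> (psi \<phi> \<star> psi p')" by (simp only: \<phi>(2) psi_fm_cmp)
      finally show ?thesis by (simp add: cmps)
    qed
    ultimately have "\<phi> \<star> w' - w \<star> psi \<phi> = 0" using lc_epi[OF lc_psi[OF lc(2)] obW(1)] by blast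
    then show ?thesis using \<phi>(1) by (simp add: phom_def)
  qed
  then have n: "NN b X W (\<phi> \<star> f)" using van phom_cmp f by blast
  \<comment> \<open>\<open>k g\<close> agrees with the identity after \<open>j'\<close>, so the
    difference factors through \<open>p'\<close>. The resulting \<open>m\<close> is the homotopy
    that compares \<open>\<theta> \<phi>\<close> with 1.\<close>
  have "(k \<star> g - one I') \<star> j' = 0" using gj k(2) h(3) by (simp add: cmps ones)
  moreover have "hom I' I' (k \<star> g - one I')" using hom_cmp[OF k(1) phom_hom[OF g]] by (intro hom_diff) auto
  ultimately obtain m where m: "hom W' I' m" "k \<star> g - one I' = m \<star> p'"
    using lc_coker[OF lc(2) obW(3)] by blast
  have "(\<theta> \<star> \<phi> - one W' - p' \<star> m) \<star> p' = 0"
  proof -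
    have "\<theta> \<star> (\<phi> \<star> p') = (\<theta> \<star> p) \<star> g" by (simp only: \<phi>(2)[symmetric] fm_cmp_assoc)
    also have "\<dots> = p' \<star> (k \<star> g)" by (simp only: \<theta>(2)[symmetric] fm_cmp_assoc)
    also have "k \<star> g = one I' + m \<star> p'" using m(2) by (simp add: algebra_simps)
    finally show ?thesis using h(4) by (simp add: cmps ones)
  qed
  moreover have "hom W' W' (\<theta> \<star> \<phi> - one W' - p' \<star> m)"
    using hom_cmp[OF \<theta>(1) \<phi>(1)] hom_cmp[OF h(4) m(1)] by (intro hom_diff) auto
  ultimately have "\<theta> \<star> \<phi> - one W' - p' \<star> m = 0" using lc_epi[OF lc(2) obW(2)] by blast
  then have e: "one W' = \<theta> \<star> \<phi> - p' \<star> m" by (simp add: algebra_simps)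
  have "f = one W' \<star> f" using phom_hom[OF f] by (simp add: ones)
  also have "\<dots> = \<theta> \<star> (\<phi> \<star> f) - p' \<star> (m \<star> f)" unfolding e by (simp add: cmps)
  finally show ?thesis
    using NN_diff[OF NN_left[OF n \<theta>(1)] NNI[of b I' X "m \<star> f" W' p']]
      l' hom_cmp[OF m(1) phom_hom[OF f]] h(4) by simp
qed

text \<open>\<open>shift\<close> is the end of some chosen sequence, of which only the defining
  property is known. Comparing it in both directions with an explicit equivariant approximation
  moves the question to the explicit \<open>W\<close>.\<close>

lemma Ext1_vanishes_iff:
  assumes X: "pob b X x" and Y: "pob b Y y" and lc: "lc b Y I W j p"
    and pobs: "pob b I t" "pob b W w" and phoms: "phom Y y I t j" "phom I t W w p"
  shows "Ext1_vanishes FP EP (PO X x) (PO Y y) \<longleftrightarrow> (\<forall>f. phom X x W w f \<longrightarrow> NN b X W f)"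
proof -
  let ?P = "\<lambda>V. \<exists>(i, p) \<in> EP. Dom FP i = PO Y y \<and> projective_injective FP EP (Cod FP i) \<and> Cod FP p = V"
  have "\<exists>V. ?P V"
  proof -
    obtain I t j q W w where e: "bd b I" "pob b I t" "pob b W w" "phom Y y I t j" "phom I t W w q"
      "(Tr Y j I, Tr I q W) \<in> E" using Y by (rule psi_embedding)
    then show ?thesis using EP_I[OF Y e(2-6)] proj_inj_FP[OF e(2)]
      by (intro exI[of _ "PO W w"] bexI[of _ "(PT Y y j I t, PT I t q W w)"]) simp_all
  qed
  then have "?P (shift FP EP (PO Y y))" unfolding shift_def by (rule someI_ex)
  then obtain i q where ip: "(i, q) \<in> EP" "Dom FP i = PO Y y" "projective_injective FP EP (Cod FP i)"
    "Cod FP q = shift FP EP (PO Y y)" by blast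
  from ip(1) obtain Y' y' j' I' t' p' W' w' where e: "i = PT Y' y' j' I' t'" "q = PT I' t' p' W' w'"
    "pob b Y' y'" "pob b I' t'" "pob b W' w'" "phom Y' y' I' t' j'" "phom I' t' W' w' p'" "(Tr Y' j' I', Tr I' p' W') \<in> E"
    by (rule EP_pairE)
  have Y': "Y' = Y" "y' = y" using ip(2) e(1) PO_eq[OF e(3) Y] by auto
  note e' = e(3-8)[unfolded Y']
  have sh: "shift FP EP (PO Y y) = PO W' w'" using ip(4) e(2) by simp
  have "bd b I'" using ip(3) proj_inj_FP[OF e(4)] unfolding e(1) by simp
  then have lc': "lc b Y I' W' j' p'" using E_lc e' phom_hom by blast
  have "Ext1_vanishes FP EP (PO X x) (PO Y y) \<longleftrightarrow>
      homs CP (PO X x) (PO W' w') = {SC X x 0 W' w'}"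
    by (simp add: Ext1_vanishes_def Ext1_def sh C_psi_def[symmetric] Zer_CP)
  also have "\<dots> \<longleftrightarrow> (\<forall>f. phom X x W' w' f \<longrightarrow> SC X x f W' w' = SC X x 0 W' w')"
  proof -
    have "homs CP (PO X x) (PO W' w') = {SC X x f W' w' | f. phom X x W' w' f}"
      by (intro Set.set_eqI) (simp only: homs_CP[OF X e'(3)] mem_Collect_eq)
    then show ?thesis
      by (simp only:) (rule Collect_eq_singleton_iff[where P = "phom X x W' w'" and g = "\<lambda>f. SC X x f W' w'"
          and z = 0, OF phom_zero])
  qed
  also have "\<dots> \<longleftrightarrow> (\<forall>f. phom X x W' w' f \<longrightarrow> NN b X W' f)"
    using SC_eq[OF X e'(3) _ phom_zero] by simp
  also have "\<dots> \<longleftrightarrow> (\<forall>f. phom X x W w f \<longrightarrow> NN b X W f)"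
    using lc_compare[OF X lc lc' Y pobs e'(2,3) phoms e'(4,5)]
      lc_compare[OF X lc' lc Y e'(2,3) pobs e'(4,5) phoms] by blast
  finally show ?thesis .
qed

end


section \<open>Crossing and boundary approximations\<close>

lemma le_at_0: "le_at 0 x y x' y' \<longleftrightarrow> x \<le> x' \<and> y \<le> y'"
  by (simp add: le_at_def)
lemma le_at_m1: "le_at (- 1) x y x' y' \<longleftrightarrow> x \<le> y' - pi \<and> y \<le> x' - pi"
  by (simp add: le_at_def)

lemma dM_eq_0: "\<bar>x' - y'\<bar> \<le> pi \<Longrightarrow> x \<le> x' \<Longrightarrow> y \<le> y' \<Longrightarrow> \<not> (x \<le> y' - pi \<and> y \<le> x' - pi) \<Longrightarrow> dM x y x' y' = 0"
  using dM_eq[of x' y' 0 x y] by (simp add: le_at_0 le_at_m1)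

lemma cc_zero_dM: "cc (obj_M x y) (obj_M x' y') (obj_M x'' y'') = 0 \<longleftrightarrow>
    dM x y x' y' + dM x' y' x'' y'' \<le> dM x y x'' y''"
  by (simp add: cc_def c_exp_obj_M)

context
  fixes b x y :: real
  assumes b: "\<bar>x - y\<bar> < b" "b < pi"
begin

text \<open>Each target dominates its source, while its translate by the inverse of
  \<open>sigma\<close> does not, as \<open>b < pi\<close>.\<close>

lemma square_dM:
  "dM x y (y + b) y = 0" "dM x y x (x + b) = 0" "dM (y + b) y (y + b) (x + b) = 0"
  "dM x (x + b) (y + b) (x + b) = 0" "dM x y (y + b) (x + b) = 0"
  using b by (auto intro!: dM_eq_0)

lemma square_cc:
  "cc (obj_M x y) (obj_M (y + b) y) (obj_M (y + b) (x + b)) = 0"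
  "cc (obj_M x y) (obj_M x (x + b)) (obj_M (y + b) (x + b)) = 0"
  unfolding cc_zero_dM square_dM by simp_all

text \<open>The corner is the join of the two middle points: an exponent that works for both works
  for it. Failure of \<open>k - 1\<close> at the corner therefore persists at one middle point,
  whose minimal exponent is then at least \<open>k\<close>.\<close>

lemma square_cc_target:
  assumes "width t \<le> b"
  shows "cc (obj_M (y + b) y) (obj_M (y + b) (x + b)) t = 0 \<or> cc (obj_M x (x + b)) (obj_M (y + b) (x + b)) t = 0"
proof -
  obtain t1 t2 where t: "t = obj_M t1 t2" using orbit_obj_M by blast
  define k where "k = dM (y + b) (x + b) t1 t2"
  have "\<not> le_at (k - 1) (y + b) (x + b) t1 t2"
    using dM_least[of "k - 1" "y + b" "x + b" t1 t2] by (auto simp: k_def)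
  then have n: "\<not> le_at (k - 1) (y + b) y t1 t2 \<or> \<not> le_at (k - 1) x (x + b) t1 t2"
    by (auto simp: le_at_def split: if_splits)
  have "\<bar>t1 - t2\<bar> \<le> pi" using assms b(2) by (simp add: t)
  then have "\<not> dM (y + b) y t1 t2 \<le> k - 1 \<or> \<not> dM x (x + b) t1 t2 \<le> k - 1"
    using n dM_le_iff by blast
  then show ?thesis unfolding t cc_zero_dM square_dM k_def by linarith
qed

text \<open>The coordinates of a boundary point differ by exactly \<open>b\<close>. A translate of
  it above \<open>(x, y)\<close> is therefore also above \<open>(y + b, y)\<close> or
  \<open>(x, x + b)\<close>, depending on which coordinate is larger.\<close>

lemma square_cc_boundary:
  assumes "width q = b"
  shows "cc (obj_M x y) (obj_M (y + b) y) q = 0 \<or> cc (obj_M x y) (obj_M x (x + b)) q = 0"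
proof -
  obtain q1 q2 where q: "q = obj_M q1 q2" using orbit_obj_M by blast
  then have w: "q1 = q2 + b \<or> q2 = q1 + b" using assms by (auto simp: abs_if split: if_splits)
  define k where "k = dM x y q1 q2"
  have "le_at k x y q1 q2" unfolding k_def by (rule le_at_dM)
  then have "le_at k (y + b) y q1 q2 \<or> le_at k x (x + b) q1 q2"
    using w by (cases "even k") (auto simp: le_at_def)
  then have "dM (y + b) y q1 q2 \<le> k \<or> dM x (x + b) q1 q2 \<le> k" using dM_least by blast
  then show ?thesis unfolding q cc_zero_dM square_dM k_def by simp
qed

end

text \<open>The rectangle from \<open>(a1, a2)\<close> to the translate by \<open>k\<pi>\<close> of the shift \<open>(y + b, x + b)\<close> of \<open>(x, y)\<close>
  is nonempty and contains no boundary point. Odd \<open>k\<close> exchange \<open>x\<close> and \<open>y\<close>.\<close>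

definition cross_at :: "real \<Rightarrow> real \<Rightarrow> real \<Rightarrow> real \<Rightarrow> real \<Rightarrow> int \<Rightarrow> bool" where
  "cross_at b a1 a2 x y k \<longleftrightarrow> x + of_int k * pi < a1 \<and> a1 \<le> y + b + of_int k * pi \<and>
     y + of_int k * pi < a2 \<and> a2 \<le> x + b + of_int k * pi"

text \<open>\<open>(a1, a1 + b)\<close> and \<open>(a2 + b, a2)\<close> are the minimal boundary
  points above \<open>(a1, a2)\<close>. The rectangle up to the corner at its minimal exponent
  \<open>k\<close> meets the boundary iff it contains one of them, and \<open>cross_at\<close> says
  that both fall outside.\<close>

lemma boundary_between_iff:
  assumes b: "b < pi" and xy: "\<bar>x - y\<bar> < b" and a: "\<bar>a1 - a2\<bar> \<le> b"
  shows "(\<exists>q. width q = b \<and> cc (obj_M a1 a2) q (obj_M (y + b) (x + b)) = 0) \<longleftrightarrow>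
    \<not> (\<exists>k. if even k then cross_at b a1 a2 x y k else cross_at b a1 a2 y x k)"
proof
  assume "\<exists>q. width q = b \<and> cc (obj_M a1 a2) q (obj_M (y + b) (x + b)) = 0"
  then obtain q1 q2 where q: "\<bar>q1 - q2\<bar> = b" and c: "cc (obj_M a1 a2) (obj_M q1 q2) (obj_M (y + b) (x + b)) = 0"
    by (metis orbit_obj_M width_obj_M)
  define i j where "i = dM a1 a2 q1 q2" and "j = dM q1 q2 (y + b) (x + b)"
  have ij: "le_at i a1 a2 q1 q2" "le_at j q1 q2 (y + b) (x + b)" by (simp_all add: i_def j_def le_at_dM)
  have q': "q1 = q2 + b \<or> q2 = q1 + b" using q by (auto simp: abs_if split: if_splits)
  have w: "\<bar>(y + b) - (x + b)\<bar> \<le> pi" using xy b by auto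
  show "\<not> (\<exists>k. if even k then cross_at b a1 a2 x y k else cross_at b a1 a2 y x k)"
  proof
    assume "\<exists>k. if even k then cross_at b a1 a2 x y k else cross_at b a1 a2 y x k"
    then obtain k where k: "if even k then cross_at b a1 a2 x y k else cross_at b a1 a2 y x k" ..
    \<comment> \<open>A crossing at \<open>k\<close> already forces \<open>k\<close> to be the
      minimal exponent: for even \<open>k\<close>, success at \<open>k - 1\<close> would give
      \<open>a1 <= x + b + (k - 1) pi < x + k pi < a1\<close>, and odd \<open>k\<close> exchanges
      \<open>x\<close> and \<open>y\<close>.\<close>
    have "le_at k a1 a2 (y + b) (x + b)" "\<not> le_at (k - 1) a1 a2 (y + b) (x + b)"
      using k b by (auto simp: cross_at_def le_at_def algebra_simps split: if_splits)
    then have "dM a1 a2 (y + b) (x + b) = k" using w by (intro dM_eq) auto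
    then have "i + j \<le> k" using c unfolding cc_zero_dM i_def j_def by simp
    then have "le_at (k - i) q1 q2 (y + b) (x + b)" using le_at_mono[OF ij(2) w] by simp
    define l where "l = k - i"
    have l: "le_at l q1 q2 (y + b) (x + b)" "k = i + l" using \<open>le_at (k - i) q1 q2 (y + b) (x + b)\<close> by (auto simp: l_def)
    define I L where "I = of_int i * pi" and "L = of_int l * pi"
    show False
      using k ij(1) l(1) q' unfolding l(2) cross_at_def le_at_def of_int_add distrib_right
        I_def[symmetric] L_def[symmetric]
      by (cases "even i"; cases "even l") (auto)
  qed
next
  assume n: "\<not> (\<exists>k. if even k then cross_at b a1 a2 x y k else cross_at b a1 a2 y x k)"
  define k where "k = dM a1 a2 (y + b) (x + b)"
  define K where "K = of_int k * pi"
  have le: "le_at k a1 a2 (y + b) (x + b)" unfolding k_def by (rule le_at_dM)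
  have "\<not> (if even k then cross_at b a1 a2 x y k else cross_at b a1 a2 y x k)" using n by blast
  then have "le_at k a1 (a1 + b) (y + b) (x + b) \<or> le_at k (a2 + b) a2 (y + b) (x + b)"
    using le unfolding cross_at_def le_at_def K_def[symmetric] by (auto split: if_splits)
  moreover have "dM a1 a2 a1 (a1 + b) \<le> 0" "dM a1 a2 (a2 + b) a2 \<le> 0"
    using a by (auto intro!: dM_least simp: le_at_0)
  ultimately have "cc (obj_M a1 a2) (obj_M a1 (a1 + b)) (obj_M (y + b) (x + b)) = 0 \<or>
      cc (obj_M a1 a2) (obj_M (a2 + b) a2) (obj_M (y + b) (x + b)) = 0"
    using dM_least[of k a1 "a1 + b" "y + b" "x + b"] dM_least[of k "a2 + b" a2 "y + b" "x + b"]
    unfolding cc_zero_dM k_def by linarith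
  moreover have "width (obj_M a1 (a1 + b)) = b" "width (obj_M (a2 + b) a2) = b" using xy by auto
  ultimately show "\<exists>q. width q = b \<and> cc (obj_M a1 a2) q (obj_M (y + b) (x + b)) = 0" by blast
qed

context dvr
begin

lemma hom_single_left:
  assumes "hom [m] [n] f" obtains r where "f = r *s bas m n"
  using assms hom_single_iff by blast

text \<open>Induction over the test list leaves a single orbit \<open>n\<close>, where maps are
  scalars. Assumption \<open>q\<close> gives the approximation property, \<open>t\<close> lets the
  relation between the two coefficients be solved, and cancelling powers of \<open>u\<close> gives
  uniqueness.\<close>

lemma lc_square:
  assumes m: "cc m q1 w = 0" "cc m q2 w = 0" and t: "\<And>t. width t \<le> b \<Longrightarrow> cc q1 w t = 0 \<or> cc q2 w t = 0"
    and q: "\<And>q. width q = b \<Longrightarrow> cc m q1 q = 0 \<or> cc m q2 q = 0"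
    and wd: "width q1 = b" "width q2 = b" "width w \<le> b"
  defines "j \<equiv> in1 [q1] [q2] \<star> bas m q1 + in2 [q1] [q2] \<star> bas m q2"
    and "p \<equiv> bas q1 w \<star> pr1 [q1] [q2] - bas q2 w \<star> pr2 [q1] [q2]"
  shows "lc b [m] ([q1] @ [q2]) [w] j p"
proof -
  let ?I = "[q1] @ [q2]"
  have one1: "one [n] \<star> (bas k n \<star> a) = bas k n \<star> a" "one [n] \<star> bas k n = bas k n" for k n a
    using ones[OF hom_bas] by auto
  have prj: "pr1 [q1] [q2] \<star> j = bas m q1" "pr2 [q1] [q2] \<star> j = bas m q2"
    by (simp_all add: j_def cmps one1)
  have pin: "p \<star> in1 [q1] [q2] = bas q1 w" "p \<star> in2 [q1] [q2] = - bas q2 w"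
    using ones(3)[OF hom_bas] by (simp_all add: p_def cmps)
  have hj: "hom [m] ?I j" unfolding j_def
    by (intro hom_add; rule hom_cmp[OF hom_in1 hom_bas] hom_cmp[OF hom_in2 hom_bas])
  have hp: "hom ?I [w] p" unfolding p_def
    by (intro hom_diff; rule hom_cmp[OF hom_bas hom_pr1] hom_cmp[OF hom_bas hom_pr2])
  have pj: "p \<star> j = 0" by (simp add: p_def cmps prj bas_cmp m)
  have app: "\<exists>g. hom ?I P g \<and> f = g \<star> j" if "bd b P" "hom [m] P f" for P f
    using that
  proof (induction P arbitrary: f)
    case Nil
    then show ?case by (intro exI[of _ 0]) (simp add: hom_Nil fm_cmp_zero)
  next
    case (Cons n P)
    have f: "hom [m] ([n] @ P) f" using Cons.prems by simp
    obtain g where g: "hom ?I P g" "pr2 [n] P \<star> f = g \<star> j"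
      using Cons.IH[of "pr2 [n] P \<star> f"] Cons.prems hom_cmp[OF hom_pr2 f] by (auto simp: bd_def)
    obtain r where r: "pr1 [n] P \<star> f = r *s bas m n" using hom_cmp[OF hom_pr1 f] by (rule hom_single_left)
    have "\<exists>h. hom ?I [n] h \<and> h \<star> j = bas m n"
    proof -
      have "cc m q1 n = 0 \<or> cc m q2 n = 0" using q[of n] Cons.prems by (simp add: bd_def)
      then show ?thesis
      proof
        assume "cc m q1 n = 0"
        then show ?thesis
          by (intro exI[of _ "bas q1 n \<star> pr1 [q1] [q2]"] conjI hom_cmp[OF hom_bas hom_pr1])
            (simp add: fm_cmp_assoc prj bas_cmp smul_simps)
      next
        assume "cc m q2 n = 0"
        then show ?thesis
          by (intro exI[of _ "bas q2 n \<star> pr2 [q1] [q2]"] conjI hom_cmp[OF hom_bas hom_pr2])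
            (simp add: fm_cmp_assoc prj bas_cmp smul_simps)
      qed
    qed
    then obtain h where h: "hom ?I [n] h" "h \<star> j = bas m n" by blast
    have "hom ?I ([n] @ P) (in1 [n] P \<star> (r *s h) + in2 [n] P \<star> g)"
      using hom_cmp[OF hom_in1 hom_smul[OF h(1)]] hom_cmp[OF hom_in2 g(1)] by (rule hom_add)
    moreover have "f = (in1 [n] P \<star> (r *s h) + in2 [n] P \<star> g) \<star> j"
      using split_left[OF f] by (simp add: cmps r g(2)[symmetric] h(2))
    ultimately show ?case by auto
  qed
  have cok: "\<exists>g. hom [w] T g \<and> h = g \<star> p" if "ob b T" "hom ?I T h" "h \<star> j = 0" for T h
    using that
  proof (induction T arbitrary: h)
    case Nil
    then show ?case by (intro exI[of _ 0]) (simp add: hom_Nil fm_cmp_zero)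
  next
    case (Cons n T)
    have f: "hom ?I ([n] @ T) h" using Cons.prems by simp
    have "(pr2 [n] T \<star> h) \<star> j = 0" using Cons.prems by (simp add: cmps)
    then obtain g where g: "hom [w] T g" "pr2 [n] T \<star> h = g \<star> p"
      using Cons.IH[OF _ hom_cmp[OF hom_pr2 f]] Cons.prems(1) by (auto simp: ob_def)
    let ?h = "pr1 [n] T \<star> h"
    have hh: "hom ?I [n] ?h" using hom_cmp[OF hom_pr1 f] .
    obtain r where r: "?h \<star> in1 [q1] [q2] = r *s bas q1 n" using hom_cmp[OF hh hom_in1] by (rule hom_single_left)
    obtain s where s: "?h \<star> in2 [q1] [q2] = s *s bas q2 n" using hom_cmp[OF hh hom_in2] by (rule hom_single_left)
    have hs: "?h = r *s (bas q1 n \<star> pr1 [q1] [q2]) + s *s (bas q2 n \<star> pr2 [q1] [q2])"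
      using split_right[OF hh] r s by (simp add: fm_cmp_assoc[symmetric] fm_cmp_smul)
    have "?h \<star> j = 0" using Cons.prems by (simp add: cmps)
    then have "(r * u ^ cc m q1 n + s * u ^ cc m q2 n) *s bas m n = 0"
      unfolding hs by (simp add: cmps prj bas_cmp smul_simps)
    then have rs: "r * u ^ cc m q1 n + s * u ^ cc m q2 n = 0" by (simp only: bas_eq_0_iff)
    \<comment> \<open>The cocycle identity ties the exponents of the two legs together. One of
      \<open>cc q1 w n\<close> and \<open>cc q2 w n\<close> is 0 by \<open>t\<close>; after a power
      of \<open>u\<close> is cancelled in \<open>rs\<close>, the coefficient of that leg is
      \<open>d\<close> up to sign.\<close>
    have co: "cc q1 w n + cc m q1 n = cc q2 w n + cc m q2 n"
      using cc_cocycle[of m q1 w n] cc_cocycle[of m q2 w n] m by simp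
    have n: "width n \<le> b" using Cons.prems(1) by (simp add: ob_def)
    have "\<exists>d. r = d * u ^ cc q1 w n \<and> s = - (d * u ^ cc q2 w n)"
      using t[OF n]
    proof
      assume 0: "cc q1 w n = 0"
      then have e: "cc m q1 n = cc m q2 n + cc q2 w n" using co by simp
      have "u ^ cc m q2 n * (r * u ^ cc q2 w n + s) = 0"
        using rs unfolding e power_add by (simp add: algebra_simps)
      then have "r * u ^ cc q2 w n + s = 0" using u_nonzero by simp
      then show ?thesis using 0 by (intro exI[of _ r]) (simp add: eq_neg_iff_add_eq_0 add.commute)
    next
      assume 0: "cc q2 w n = 0"
      then have e: "cc m q2 n = cc m q1 n + cc q1 w n" using co by simp
      have "u ^ cc m q1 n * (r + s * u ^ cc q1 w n) = 0"
        using rs unfolding e power_add by (simp add: algebra_simps)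
      then have "r + s * u ^ cc q1 w n = 0" using u_nonzero by simp
      then show ?thesis using 0 by (intro exI[of _ "- s"]) (simp add: eq_neg_iff_add_eq_0)
    qed
    then obtain d where d: "r = d * u ^ cc q1 w n" "s = - (d * u ^ cc q2 w n)" by blast
    have hd: "?h = (d *s bas w n) \<star> p"
      unfolding hs d by (simp add: p_def cmps bas_cmp_assoc smul_simps)
    have "hom [w] ([n] @ T) (in1 [n] T \<star> (d *s bas w n) + in2 [n] T \<star> g)"
      using hom_cmp[OF hom_in1 hom_smul[OF hom_bas]] hom_cmp[OF hom_in2 g(1)] by (rule hom_add)
    moreover have "h = (in1 [n] T \<star> (d *s bas w n) + in2 [n] T \<star> g) \<star> p"
      using split_left[OF f] unfolding hd g(2) by (simp add: cmps)
    ultimately show ?case by auto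
  qed
  have epi: "g = 0" if "hom [w] T g" "g \<star> p = 0" for T g
  proof -
    have "g \<star> bas q1 w = 0" using arg_cong[OF that(2), of "\<lambda>a. a \<star> in1 [q1] [q2]"]
      by (simp add: fm_cmp_assoc pin fm_cmp_zero)
    with that(1) show ?thesis
    proof (induction T arbitrary: g)
      case Nil then show ?case by (simp add: hom_Nil)
    next
      case (Cons n T)
      have f: "hom [w] ([n] @ T) g" using Cons.prems by simp
      have "pr2 [n] T \<star> g = 0"
        using Cons.IH[OF hom_cmp[OF hom_pr2 f]] Cons.prems(2) by (simp add: cmps)
      moreover obtain r where r: "pr1 [n] T \<star> g = r *s bas w n" using hom_cmp[OF hom_pr1 f] by (rule hom_single_left)
      moreover have "(r *s bas w n) \<star> bas q1 w = 0" using Cons.prems(2) unfolding r[symmetric] by (simp add: cmps)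
      then have "r = 0" using u_nonzero by (simp add: cmps bas_cmp smul_simps bas_eq_0_iff)
      ultimately show ?case using split_left[OF f] by (simp add: fm_cmp_zero smul_simps)
    qed
  qed
  show ?thesis unfolding lc_def
    using wd hj hp pj app cok epi by (auto simp: bd_def ob_def)
qed

section \<open>Direct sums of squares and the adjunctions of \<open>S\<close>\<close>

definition ds :: "orbit list \<Rightarrow> orbit list \<Rightarrow> orbit list \<Rightarrow> orbit list \<Rightarrow> 'r fm \<Rightarrow> 'r fm \<Rightarrow> 'r fm" where
  "ds X Y X' Y' f f' = in1 Y Y' \<star> (f \<star> pr1 X X') + in2 Y Y' \<star> (f' \<star> pr2 X X')"

lemma hom_ds: "hom X Y f \<Longrightarrow> hom X' Y' f' \<Longrightarrow> hom (X @ X') (Y @ Y') (ds X Y X' Y' f f')"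
  unfolding ds_def
  by (intro hom_add) (blast intro: hom_cmp[OF hom_in1] hom_cmp[OF hom_in2] hom_cmp[OF _ hom_pr1] hom_cmp[OF _ hom_pr2])+

lemma ds_in:
  assumes "hom X Y f" "hom X' Y' f'"
  shows "ds X Y X' Y' f f' \<star> in1 X X' = in1 Y Y' \<star> f" "ds X Y X' Y' f f' \<star> in2 X X' = in2 Y Y' \<star> f'"
    "pr1 Y Y' \<star> ds X Y X' Y' f f' = f \<star> pr1 X X'" "pr2 Y Y' \<star> ds X Y X' Y' f f' = f' \<star> pr2 X X'"
  using assms by (simp_all add: ds_def cmps ones)

lemma lc_ds:
  assumes "lc b Y I W j p" "lc b Y' I' W' j' p'"
  shows "lc b (Y @ Y') (I @ I') (W @ W') (ds Y I Y' I' j j') (ds I W I' W' p p')" (is "lc b _ _ _ ?j ?p")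
proof -
  note l = lcD[OF assms(1)] and l' = lcD[OF assms(2)]
  have hj: "hom (Y @ Y') (I @ I') ?j" and hp: "hom (I @ I') (W @ W') ?p" using l l' hom_ds by blast+
  have "?p \<star> ?j = (?p \<star> in1 I I') \<star> (j \<star> pr1 Y Y') + (?p \<star> in2 I I') \<star> (j' \<star> pr2 Y Y')"
    unfolding ds_def[of Y I] by (simp only: fm_cmp_add_right fm_cmp_assoc)
  also have "\<dots> = in1 W W' \<star> ((p \<star> j) \<star> pr1 Y Y') + in2 W W' \<star> ((p' \<star> j') \<star> pr2 Y Y')"
    by (simp only: ds_in(1,2)[OF l(4) l'(4)] fm_cmp_assoc)
  finally have pj: "?p \<star> ?j = 0" using l(5) l'(5) by (simp add: fm_cmp_zero)
  have app: "\<exists>g. hom (I @ I') P g \<and> f = g \<star> ?j" if P: "bd b P" "hom (Y @ Y') P f" for P f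
  proof -
    obtain g where g: "hom I P g" "f \<star> in1 Y Y' = g \<star> j"
      using lc_approx[OF assms(1) P(1) hom_cmp[OF P(2) hom_in1]] by blast
    obtain g' where g': "hom I' P g'" "f \<star> in2 Y Y' = g' \<star> j'"
      using lc_approx[OF assms(2) P(1) hom_cmp[OF P(2) hom_in2]] by blast
    have "hom (I @ I') P (g \<star> pr1 I I' + g' \<star> pr2 I I')"
      using hom_cmp[OF g(1) hom_pr1] hom_cmp[OF g'(1) hom_pr2] by (rule hom_add)
    moreover have "(g \<star> pr1 I I' + g' \<star> pr2 I I') \<star> ?j = (f \<star> in1 Y Y') \<star> pr1 Y Y' + (f \<star> in2 Y Y') \<star> pr2 Y Y'"
      using l l' by (simp add: fm_cmp_add_left fm_cmp_assoc ds_in g(2) g'(2))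
    ultimately show ?thesis using split_right[OF P(2)] by (auto simp: fm_cmp_assoc)
  qed
  have cok: "\<exists>g. hom (W @ W') T g \<and> h = g \<star> ?p" if T: "ob b T" "hom (I @ I') T h" "h \<star> ?j = 0" for T h
  proof -
    have "(h \<star> ?j) \<star> in1 Y Y' = 0" "(h \<star> ?j) \<star> in2 Y Y' = 0" using T(3) by (simp_all add: fm_cmp_zero)
    then have "(h \<star> in1 I I') \<star> j = 0" "(h \<star> in2 I I') \<star> j' = 0"
      using l(3) l'(3) by (simp_all add: fm_cmp_assoc ds_in)
    then obtain g g' where g: "hom W T g" "h \<star> in1 I I' = g \<star> p" and g': "hom W' T g'" "h \<star> in2 I I' = g' \<star> p'"
      using lc_coker[OF assms(1) T(1) hom_cmp[OF T(2) hom_in1]] lc_coker[OF assms(2) T(1) hom_cmp[OF T(2) hom_in2]]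
      by metis
    have "hom (W @ W') T (g \<star> pr1 W W' + g' \<star> pr2 W W')"
      using hom_cmp[OF g(1) hom_pr1] hom_cmp[OF g'(1) hom_pr2] by (rule hom_add)
    moreover have "(g \<star> pr1 W W' + g' \<star> pr2 W W') \<star> ?p = (h \<star> in1 I I') \<star> pr1 I I' + (h \<star> in2 I I') \<star> pr2 I I'"
      unfolding g(2) g'(2) using l l' by (simp add: fm_cmp_add_left fm_cmp_assoc ds_in)
    ultimately show ?thesis using split_right[OF T(2)] by (auto simp: fm_cmp_assoc)
  qed
  have epi: "g = 0" if T: "ob b T" "hom (W @ W') T g" "g \<star> ?p = 0" for T g
  proof -
    have "(g \<star> ?p) \<star> in1 I I' = 0" "(g \<star> ?p) \<star> in2 I I' = 0" using T(3) by (simp_all add: fm_cmp_zero)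
    then have "(g \<star> in1 W W') \<star> p = 0" "(g \<star> in2 W W') \<star> p' = 0"
      using l(4) l'(4) by (simp_all add: fm_cmp_assoc ds_in)
    then have "g \<star> in1 W W' = 0" "g \<star> in2 W W' = 0"
      using lc_epi[OF assms(1) T(1) hom_cmp[OF T(2) hom_in1]] lc_epi[OF assms(2) T(1) hom_cmp[OF T(2) hom_in2]] by blast+
    then show ?thesis using split_right[OF T(2)] by (simp add: fm_cmp_assoc[symmetric] fm_cmp_zero)
  qed
  have "bd b (I @ I')" "ob b (W @ W')" using l l' by simp_all
  then show ?thesis unfolding lc_def using hj hp pj app cok epi by blast
qed

abbreviation Sm :: "orbit list \<Rightarrow> orbit list \<Rightarrow> 'r fm \<Rightarrow> 'r fm" where
  "Sm X Y f \<equiv> ds X Y (psl X) (psl Y) f (psi f)"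

lemma phom_Sm:
  assumes "hom X Y f" shows "phom (X @ psl X) (sw X) (Y @ psl Y) (sw Y) (Sm X Y f)"
  unfolding phom_def
proof
  have h: "hom (psl X) (psl Y) (psi f)" using assms hom_psi by blast
  show "hom (X @ psl X) (Y @ psl Y) (Sm X Y f)" using assms h hom_ds by blast
  show "Sm X Y f \<star> sw X = sw Y \<star> psi (Sm X Y f)"
    using assms h by (simp add: ds_def cmps psi_fm_cmp pr_sw sw_in ones)
qed

text \<open>\<open>S\<close> is left adjoint to forgetting the involution: the equivariant map that
  belongs to \<open>f\<close> has components \<open>f\<close> and \<open>w psi(f)\<close>. The
  correspondence respects null maps in both directions.\<close>

lemma all_NN_left_S:
  assumes "pob b W w"
  shows "(\<forall>f. phom (X @ psl X) (sw X) W w f \<longrightarrow> NN b (X @ psl X) W f) \<longleftrightarrow> (\<forall>f. hom X W f \<longrightarrow> NN b X W f)"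
proof (intro iffI allI impI)
  fix f :: "'r fm" assume a: "\<forall>f. phom (X @ psl X) (sw X) W w f \<longrightarrow> NN b (X @ psl X) W f" and f: "hom X W f"
  define g where "g = f \<star> pr1 X (psl X) + w \<star> (psi f \<star> pr2 X (psl X))"
  have h: "hom (psl X) (psl W) (psi f)" using f hom_psi by blast
  have "hom (X @ psl X) W g" unfolding g_def
    using hom_cmp[OF f hom_pr1] hom_cmp[OF pobD(2)[OF assms] hom_cmp[OF h hom_pr2]] by (rule hom_add)
  moreover have "g \<star> sw X = w \<star> psi g"
    using pob_cancel(2)[OF assms hom_cmp[OF f hom_pr2]] by (simp add: g_def cmps psi_fm_cmp pr_sw add.commute)
  ultimately have "NN b (X @ psl X) W g" using a by (simp add: phom_def)
  then have "NN b X W (g \<star> in1 X (psl X))" using hom_in1 by (rule NN_right)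
  then show "NN b X W f" using f by (simp add: g_def cmps ones)
next
  fix f :: "'r fm" assume a: "\<forall>f. hom X W f \<longrightarrow> NN b X W f" and f: "phom (X @ psl X) (sw X) W w f"
  have hf: "hom (X @ psl X) W f" using f phom_hom by blast
  have 1: "NN b X W (f \<star> in1 X (psl X))" using a hom_cmp[OF hf hom_in1] by blast
  have "sw X \<star> in1 (psl X) X = in2 X (psl X)" by (simp add: sw_def cmps)
  then have "f \<star> in2 X (psl X) = w \<star> (psi (f \<star> in1 X (psl X)))"
    using phom_eq(2)[OF f, of "in1 (psl X) X"] by (simp add: psi_fm_cmp)
  then have 2: "NN b (psl X) W (f \<star> in2 X (psl X))"
    using NN_left[OF NN_psi[OF 1] pobD(2)[OF assms]] by simp
  show "NN b (X @ psl X) W f"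
    using NN_add[OF NN_right[OF 1 hom_pr1] NN_right[OF 2 hom_pr2]] split_right[OF hf] by (simp add: fm_cmp_assoc)
qed

text \<open>\<open>S\<close> is right adjoint as well: the second component of an equivariant map
  into \<open>SW\<close> is the conjugate of the first.\<close>

lemma all_NN_right_S:
  assumes "pob b X x"
  shows "(\<forall>f. phom X x (W @ psl W) (sw W) f \<longrightarrow> NN b X (W @ psl W) f) \<longleftrightarrow> (\<forall>f. hom X W f \<longrightarrow> NN b X W f)"
proof (intro iffI allI impI)
  fix f :: "'r fm" assume a: "\<forall>f. phom X x (W @ psl W) (sw W) f \<longrightarrow> NN b X (W @ psl W) f" and f: "hom X W f"
  define g where "g = in1 W (psl W) \<star> f + in2 W (psl W) \<star> (psi f \<star> psi x)"
  have h: "hom (psl X) (psl W) (psi f)" using f hom_psi by blast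
  have h': "hom X (psl W) (psi f \<star> psi x)" using hom_cmp[OF h pobD(5)[OF assms]] .
  have "hom X (W @ psl W) g" unfolding g_def
    using hom_cmp[OF hom_in1 f] hom_cmp[OF hom_in2 h'] by (rule hom_add)
  moreover have "g \<star> x = sw W \<star> psi g"
    using pob_cancel(3)[OF assms h] hom_cmp[OF f pobD(2)[OF assms]] h
    by (simp add: g_def cmps psi_fm_cmp sw_in ones)
  ultimately have "NN b X (W @ psl W) g" using a by (simp add: phom_def)
  then have "NN b X W (pr1 W (psl W) \<star> g)" using hom_pr1 by (rule NN_left)
  then show "NN b X W f" using f by (simp add: g_def cmps ones)
next
  fix f :: "'r fm" assume a: "\<forall>f. hom X W f \<longrightarrow> NN b X W f" and f: "phom X x (W @ psl W) (sw W) f"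
  have hf: "hom X (W @ psl W) f" using f phom_hom by blast
  have 1: "NN b X W (pr1 W (psl W) \<star> f)" using a hom_cmp[OF hom_pr1 hf] by blast
  have "pr2 W (psl W) \<star> f = (pr2 W (psl W) \<star> (f \<star> x)) \<star> psi x"
    using pob_cancel(1)[OF assms hf] by (simp add: fm_cmp_assoc)
  also have "\<dots> = psi (pr1 W (psl W) \<star> f) \<star> psi x"
    unfolding phom_eq(1)[OF f] fm_cmp_assoc[symmetric] pr_sw by (simp add: psi_fm_cmp)
  finally have 2: "NN b X (psl W) (pr2 W (psl W) \<star> f)"
    using NN_right[OF NN_psi[OF 1] pobD(5)[OF assms]] by simp
  show "NN b X (W @ psl W) f"
    using NN_add[OF NN_left[OF 1 hom_in1] NN_left[OF 2 hom_in2]] split_left[OF hf] by simp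
qed

lemma all_NN_single: "(\<forall>f. hom [a] [w] f \<longrightarrow> NN b [a] [w] f) \<longleftrightarrow> NN b [a] [w] (bas a w)"
  using NN_smul by (auto simp: hom_single_iff) (metis hom_bas hom_single_iff)

lemma all_NN_append: "(\<forall>f. hom (X @ Y) W f \<longrightarrow> NN b (X @ Y) W f) \<longleftrightarrow>
    (\<forall>f. hom X W f \<longrightarrow> NN b X W f) \<and> (\<forall>f. hom Y W f \<longrightarrow> NN b Y W f)"
proof (intro iffI conjI allI impI)
  fix f :: "'r fm" assume a: "\<forall>f. hom (X @ Y) W f \<longrightarrow> NN b (X @ Y) W f"
  show "NN b X W f" if f: "hom X W f"
  proof -
    have "NN b X W ((f \<star> pr1 X Y) \<star> in1 X Y)" using a hom_cmp[OF f hom_pr1] NN_right[OF _ hom_in1] by blast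
    then show ?thesis using f by (simp add: fm_cmp_assoc ones)
  qed
  show "NN b Y W f" if f: "hom Y W f"
  proof -
    have "NN b Y W ((f \<star> pr2 X Y) \<star> in2 X Y)" using a hom_cmp[OF f hom_pr2] NN_right[OF _ hom_in2] by blast
    then show ?thesis using f by (simp add: fm_cmp_assoc ones)
  qed
next
  fix f :: "'r fm" assume a: "(\<forall>f. hom X W f \<longrightarrow> NN b X W f) \<and> (\<forall>f. hom Y W f \<longrightarrow> NN b Y W f)" and f: "hom (X @ Y) W f"
  have "NN b (X @ Y) W ((f \<star> in1 X Y) \<star> pr1 X Y + (f \<star> in2 X Y) \<star> pr2 X Y)"
    using a hom_cmp[OF f hom_in1] hom_cmp[OF f hom_in2] by (blast intro: NN_add NN_right[OF _ hom_pr1] NN_right[OF _ hom_pr2])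
  then show "NN b (X @ Y) W f" using split_right[OF f] by (simp add: fm_cmp_assoc)
qed

lemma NN_bas_eq: "NN b [a] [w] (bas a w) \<longleftrightarrow> (\<exists>q. width q = b \<and> cc a q w = 0)"
  using NN_bas_iff[of b a w 1] NN_bas by (auto simp: smul_simps)

end


section \<open>Extensions between named objects\<close>

lemma sign_val_sq [simp]: "sign_val e * sign_val e = (1 :: 'r::comm_ring_1)"
  by (cases e) auto

fun name_coord :: "name \<Rightarrow> real \<times> real" where
  "name_coord (Regular x y) = (x, y)"
| "name_coord (Singular e x) = (x, x)"

fun same_sign :: "name \<Rightarrow> name \<Rightarrow> bool" where
  "same_sign (Singular e x) (Singular e' x') = (e = e')"
| "same_sign _ _ = False"

fun crossing :: "real \<Rightarrow> real \<times> real \<Rightarrow> real \<times> real \<Rightarrow> bool" where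
  "crossing b (a1, a2) (x, y) \<longleftrightarrow> (\<exists>k. cross_at b a1 a2 x y k \<or> cross_at b a1 a2 y x k)"

lemma cross_at_shift: "cross_at b (a1 + pi) (a2 + pi) x y k \<longleftrightarrow> cross_at b a1 a2 x y (k - 1)"
  by (auto simp: cross_at_def algebra_simps)

lemma cross_at_diag: "cross_at b a a x y k \<longleftrightarrow> cross_at b a a y x k"
  by (auto simp: cross_at_def)

text \<open>A regular object contains \<open>M(a1, a2)\<close> and its image under
  \<open>psi\<close>. Translation by \<open>pi\<close> shifts \<open>k\<close> by 1, so the two
  together cover both orders of \<open>x\<close> and \<open>y\<close> at every
  \<open>k\<close>.\<close>

lemma crossing_parity:
  "(\<exists>k. if even k then cross_at b a1 a2 x y k else cross_at b a1 a2 y x k) \<or>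
   (\<exists>k. if even k then cross_at b (a1 + pi) (a2 + pi) x y k else cross_at b (a1 + pi) (a2 + pi) y x k)
   \<longleftrightarrow> crossing b (a1, a2) (x, y)"
proof
  assume "crossing b (a1, a2) (x, y)"
  then obtain k where k: "cross_at b a1 a2 x y k \<or> cross_at b a1 a2 y x k" by auto
  show "(\<exists>k. if even k then cross_at b a1 a2 x y k else cross_at b a1 a2 y x k) \<or>
   (\<exists>k. if even k then cross_at b (a1 + pi) (a2 + pi) x y k else cross_at b (a1 + pi) (a2 + pi) y x k)"
  proof (cases "if even k then cross_at b a1 a2 x y k else cross_at b a1 a2 y x k")
    case False
    then have "if even (k + 1) then cross_at b (a1 + pi) (a2 + pi) x y (k + 1) else cross_at b (a1 + pi) (a2 + pi) y x (k + 1)"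
      using k by (auto simp: cross_at_shift split: if_splits)
    then show ?thesis by blast
  qed blast
next
  assume "(\<exists>k. if even k then cross_at b a1 a2 x y k else cross_at b a1 a2 y x k) \<or>
   (\<exists>k. if even k then cross_at b (a1 + pi) (a2 + pi) x y k else cross_at b (a1 + pi) (a2 + pi) y x k)"
  then show "crossing b (a1, a2) (x, y)" by (auto simp: cross_at_shift split: if_splits)
qed

context dvr
begin

lemma in_pr_single:
  "in1 [m] [n] = (single ((0, m), (0, m)) 1 :: 'r fm)" "in2 [m] [n] = (single ((1, n), (0, n)) 1 :: 'r fm)"
  "pr1 [m] [n] = (single ((0, m), (0, m)) 1 :: 'r fm)" "pr2 [m] [n] = (single ((0, n), (1, n)) 1 :: 'r fm)"
proof -
  have i: "[0..<length [m]] = [0]" "[length [m]..<length [m] + length [n]] = [1]" by simp_all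
  have r: "inc_rel ([m] @ [n]) [0] = {((0, m), (0, m))}" "inc_rel ([m] @ [n]) [1] = {((1, n), (0, n))}"
    by (auto simp: inc_rel_def)
  have c: "converse {(p, q)} = {(q, p)}" for p q :: idx by auto
  show "in1 [m] [n] = (single ((0, m), (0, m)) 1 :: 'r fm)" "in2 [m] [n] = (single ((1, n), (0, n)) 1 :: 'r fm)"
  "pr1 [m] [n] = (single ((0, m), (0, m)) 1 :: 'r fm)" "pr2 [m] [n] = (single ((0, n), (1, n)) 1 :: 'r fm)"
    unfolding in1_def in2_def pr1_def pr2_def i inc_def prj_def r c by (simp_all add: pm_def)
qed

lemma sw_single: "sw [m] = single ((0, m), (1, m)) 1 + single ((1, psi_orbit m), (0, psi_orbit m)) 1"
  by (simp add: sw_def in_pr_single fm_cmp_single cmp_single_def)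

fun nX :: "name \<Rightarrow> orbit list" where
  "nX (Regular x y) = [obj_M x y] @ psl [obj_M x y]"
| "nX (Singular e x) = [obj_M x x]"

fun nx :: "name \<Rightarrow> 'r fm" where
  "nx (Regular x y) = sw [obj_M x y]"
| "nx (Singular e x) = sign_val e *s bas (psi_orbit (obj_M x x)) (obj_M x x)"

lemma obj_S_PO: "obj_S [m] = PO ([m] @ psl [m]) (sw [m])"
proof -
  let ?A = "four_block_mat (0\<^sub>m 1 1) (1\<^sub>m 1) (1\<^sub>m 1) (0\<^sub>m 1 1) :: 'r mat"
  let ?B = "mat 2 2 (\<lambda>(j, i). ent [psi_orbit m, m] [m, psi_orbit m] (sw [m]) j i) :: 'r mat"
  have "?A = ?B"
  proof (rule eq_matI)
    fix i j assume "i < dim_row ?B" "j < dim_col ?B"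
    then have "i = 0 \<or> i = 1" "j = 0 \<or> j = 1" by auto
    then show "?A $$ (i, j) = ?B $$ (i, j)"
      by (elim disjE) (simp_all add: ent_def sw_single lookup_add lookup_single)
  qed simp_all
  then show ?thesis by (simp add: obj_S_def Let_def PO_def Tr_def numeral_2_eq_2)
qed

lemma obj_Z_PO: "obj_Z e x = PO (nX (Singular e x)) (nx (Singular e x))"
proof -
  let ?m = "obj_M x x"
  have "mat 1 1 (\<lambda>_. sign_val e) = (mat 1 1 (\<lambda>(j, i). ent [psi_orbit ?m] [?m] (sign_val e *s bas (psi_orbit ?m) ?m) j i) :: 'r mat)"
    by (rule eq_matI) (simp_all add: ent_def bas_def)
  then show ?thesis by (simp add: obj_Z_def PO_def Tr_def)
qed

lemma named_PO: "named n = PO (nX n) (nx n)"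
  by (cases n) (simp_all only: named.simps obj_S_PO obj_Z_PO nX.simps nx.simps)

lemma cc_diag: "cc (obj_M x x) (psi_orbit (obj_M x x)) (obj_M x x) = 0"
  "cc (psi_orbit (obj_M x x)) (obj_M x x) (psi_orbit (obj_M x x)) = 0"
  using cc_obj_M_psi[of x x] cc_sym by auto

lemma pob_named: assumes "valid_name b n" "0 < b" shows "pob b (nX n) (nx n)"
proof (cases n)
  case (Regular x y)
  then show ?thesis using assms pob_sw[of b "[obj_M x y]"] by (simp add: ob_def)
next
  case (Singular e x)
  then show ?thesis using assms
    by (simp add: pob_def ob_def hom_smul fm_cmp_smul bas_cmp smul_simps cc_diag one_single)
qed

lemma lc_named:
  assumes "\<bar>x - y\<bar> < b" "b < pi"
  shows "lc b [obj_M x y] ([obj_M (y + b) y] @ [obj_M x (x + b)]) [obj_M (y + b) (x + b)]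
    (in1 [obj_M (y + b) y] [obj_M x (x + b)] \<star> bas (obj_M x y) (obj_M (y + b) y) +
     in2 [obj_M (y + b) y] [obj_M x (x + b)] \<star> bas (obj_M x y) (obj_M x (x + b)))
    (bas (obj_M (y + b) y) (obj_M (y + b) (x + b)) \<star> pr1 [obj_M (y + b) y] [obj_M x (x + b)] -
     bas (obj_M x (x + b)) (obj_M (y + b) (x + b)) \<star> pr2 [obj_M (y + b) y] [obj_M x (x + b)])"
  using square_cc[OF assms] square_cc_target[OF assms] square_cc_boundary[OF assms] assms
  by (intro lc_square) auto

lemma all_NN_nX:
  assumes b: "b < pi" and xy: "\<bar>x - y\<bar> < b" and n: "valid_name b n"
  shows "(\<forall>f. hom (nX n) [obj_M (y + b) (x + b)] f \<longrightarrow> NN b (nX n) [obj_M (y + b) (x + b)] f) \<longleftrightarrow>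
    \<not> crossing b (name_coord n) (x, y)"
proof (cases n)
  case (Regular a1 a2)
  then have a: "\<bar>a1 - a2\<bar> \<le> b" "\<bar>(a1 + pi) - (a2 + pi)\<bar> \<le> b" using n by auto
  show ?thesis
    unfolding Regular nX.simps all_NN_append list.map psi_orbit_M all_NN_single NN_bas_eq
      boundary_between_iff[OF b xy a(1)] boundary_between_iff[OF b xy a(2)] name_coord.simps
    using crossing_parity by blast
next
  case (Singular e a)
  have "(\<exists>k. if even k then cross_at b a a x y k else cross_at b a a y x k) \<longleftrightarrow> crossing b (a, a) (x, y)"
    using cross_at_diag by (auto split: if_splits)
  moreover have "\<bar>a - a\<bar> \<le> b" using xy by simp
  ultimately show ?thesis
    unfolding Singular nX.simps all_NN_single NN_bas_eq name_coord.simps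
    using boundary_between_iff[OF b xy] by blast
qed

lemma bas_ones: "one [n] \<star> bas k n = bas k n" "one [n] \<star> (bas k n \<star> a) = bas k n \<star> a"
  "bas k n \<star> one [k] = bas k n" "bas k n \<star> (one [k] \<star> a) = bas k n \<star> a"
  using ones[OF hom_bas] by auto

end

context frob
begin

text \<open>\<open>S\<close> applied to the square of \<open>M(x, y)\<close> is an equivariant
  approximation of \<open>SM(x, y)\<close>, and the right adjunction removes the involution from
  maps into \<open>S\<close> of the corner.\<close>

lemma Ext1_Regular:
  assumes b: "b < pi" and m: "valid_name b (Regular x y)" and n: "valid_name b n"
  shows "Ext1_vanishes FP EP (named n) (named (Regular x y)) \<longleftrightarrow> \<not> crossing b (name_coord n) (x, y)"
proof -
  have xy: "\<bar>x - y\<bar> < b" using m by simp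
  define q1 q2 w where "q1 = obj_M (y + b) y" and "q2 = obj_M x (x + b)" and "w = obj_M (y + b) (x + b)"
  let ?m = "obj_M x y"
  obtain j p where lc: "lc b [?m] ([q1] @ [q2]) [w] j p"
    using lc_named[OF xy b] unfolding q1_def q2_def w_def by blast
  note l = lcD[OF lc]
  have lc2: "lc b ([?m] @ psl [?m]) (([q1] @ [q2]) @ psl ([q1] @ [q2])) ([w] @ psl [w])
      (Sm [?m] ([q1] @ [q2]) j) (Sm ([q1] @ [q2]) [w] p)"
    using lc_ds[OF lc lc_psi[OF lc]] by simp
  have "Ext1_vanishes FP EP (PO (nX n) (nx n)) (PO ([?m] @ psl [?m]) (sw [?m])) \<longleftrightarrow>
      (\<forall>f. phom (nX n) (nx n) ([w] @ psl [w]) (sw [w]) f \<longrightarrow> NN b (nX n) ([w] @ psl [w]) f)"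
  proof (rule Ext1_vanishes_iff[OF pob_named[OF n b_pos] _ lc2 _ _ phom_Sm[OF l(3)] phom_Sm[OF l(4)]])
    show "pob b ([?m] @ psl [?m]) (sw [?m])" using xy by (intro pob_sw) (simp add: ob_def)
    show "pob b (([q1] @ [q2]) @ psl ([q1] @ [q2])) (sw ([q1] @ [q2]))" using l(1) bd_ob pob_sw by blast
    show "pob b ([w] @ psl [w]) (sw [w])" using l(2) pob_sw by blast
  qed
  also have "\<dots> \<longleftrightarrow> (\<forall>f. hom (nX n) [w] f \<longrightarrow> NN b (nX n) [w] f)"
    using pob_named[OF n b_pos] by (rule all_NN_right_S)
  finally show ?thesis
    unfolding named_PO[of n] named_PO[of "Regular x y"] nX.simps(1) nx.simps(1) w_def all_NN_nX[OF b xy n] .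
qed

text \<open>On the diagonal, \<open>psi\<close> exchanges the two middle orbits of the square up to
  isomorphism, so the square of \<open>M(x, x)\<close> itself carries an involution and
  \<open>S\<close> need not be applied.\<close>

lemma Ext1_Singular:
  assumes b: "b < pi" and n: "valid_name b n"
  shows "Ext1_vanishes FP EP (named n) (named (Singular e x)) \<longleftrightarrow>
    \<not> crossing b (name_coord n) (x, x) \<or> same_sign n (Singular e x)"
proof -
  have xy: "\<bar>x - x\<bar> < b" using b_pos by simp
  define q1 q2 w where "q1 = obj_M (x + b) x" and "q2 = obj_M x (x + b)" and "w = obj_M (x + b) (x + b)"
  let ?m = "obj_M x x" and ?z = "sign_val e :: 'r"
  let ?I = "[q1] @ [q2]"
  define j :: "'r fm" where "j = in1 [q1] [q2] \<star> bas ?m q1 + in2 [q1] [q2] \<star> bas ?m q2"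
  define p :: "'r fm" where "p = bas q1 w \<star> pr1 [q1] [q2] - bas q2 w \<star> pr2 [q1] [q2]"
  have lc: "lc b [?m] ?I [w] j p"
    using lc_named[OF xy b] unfolding q1_def q2_def w_def j_def p_def by simp
  have q12: "cc (psi_orbit q1) q2 (psi_orbit q1) = 0" "cc (psi_orbit q2) q1 (psi_orbit q2) = 0"
    unfolding q1_def q2_def psi_orbit_M cc_obj_M_zero by (rule exI[of _ 1], simp)+
  have q12': "cc q1 (psi_orbit q2) q1 = 0" "cc q2 (psi_orbit q1) q2 = 0" using q12 cc_sym by metis+
  have w: "cc w (psi_orbit w) w = 0" "cc (psi_orbit w) w (psi_orbit w) = 0"
    unfolding w_def by (rule cc_diag)+
  note m = cc_diag[of x]
  \<comment> \<open>\<open>t\<close> exchanges the middle orbits through basic isomorphisms; the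
    factor \<open>?z\<close> makes \<open>j\<close> equivariant.\<close>
  define t :: "'r fm" where "t = ?z *s (in1 [q1] [q2] \<star> (bas (psi_orbit q2) q1 \<star> pr2 [psi_orbit q1] [psi_orbit q2]) +
     in2 [q1] [q2] \<star> (bas (psi_orbit q1) q2 \<star> pr1 [psi_orbit q1] [psi_orbit q2]))"
  \<comment> \<open>The sign is forced by \<open>p t = \<omega> psi(p)\<close>: the exchange of the
    summands turns the difference \<open>p\<close> of the two legs into its negative.\<close>
  define \<omega> :: "'r fm" where "\<omega> = (- ?z) *s bas (psi_orbit w) w"
  have psi_t: "psi t = ?z *s (in1 [psi_orbit q1] [psi_orbit q2] \<star> (bas q2 (psi_orbit q1) \<star> pr2 [q1] [q2]) +
     in2 [psi_orbit q1] [psi_orbit q2] \<star> (bas q1 (psi_orbit q2) \<star> pr1 [q1] [q2]))"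
    by (simp add: t_def psi_fm_cmp)
  have psi_z: "psi (?z *s bas (psi_orbit ?m) ?m) = ?z *s bas ?m (psi_orbit ?m)" by simp
  have ht: "hom (psl ?I) ?I t" unfolding t_def
    by (simp del: append.simps append_Cons, intro hom_smul hom_add hom_cmp[OF hom_in1 hom_cmp[OF hom_bas]] hom_cmp[OF hom_in2 hom_cmp[OF hom_bas]])
      (rule hom_pr1 hom_pr2)+
  have o: "bas q1 q1 \<star> pr1 [q1] [q2] = pr1 [q1] [q2]" "bas q2 q2 \<star> pr2 [q1] [q2] = pr2 [q1] [q2]"
    using ones(1)[OF hom_pr1[of "[q1]" "[q2]"]] ones(1)[OF hom_pr2[of "[q1]" "[q2]"]] by (simp_all add: one_single)
  have tt: "t \<star> psi t = one ?I"
    unfolding psi_t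
    by (simp add: t_def cmps smul_simps bas_ones bas_cmp_assoc q12' o)
      (use in_pr[of u "[q1]" "[q2]"] in \<open>simp add: add.commute\<close>)
  have obI: "ob b ?I" and obw: "ob b [w]" using b_pos by (auto simp: ob_def q1_def q2_def w_def)
  have pt: "pob b ?I t" using ht tt obI by (simp add: pob_def)
  have pw: "pob b [w] \<omega>" using obw w
    by (simp add: pob_def \<omega>_def hom_smul hom_uminus cmps bas_cmp smul_simps one_single)
  have hj: "hom [?m] ?I j" "hom ?I [w] p" using lcD[OF lc] by auto
  have pj: "phom [?m] (?z *s bas (psi_orbit ?m) ?m) ?I t j"
  proof -
    have "j \<star> (?z *s bas (psi_orbit ?m) ?m) = t \<star> psi j"
      by (simp add: j_def t_def cmps psi_fm_cmp bas_ones bas_cmp bas_cmp_assoc smul_simps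
          cc_iso_left[OF m(2)] cc_iso_right[OF q12(1)] cc_iso_right[OF q12(2)])
    then show ?thesis using hj by (simp add: phom_def)
  qed
  have pp: "phom ?I t [w] \<omega> p"
  proof -
    have "p \<star> t = \<omega> \<star> psi p"
      by (simp add: p_def t_def \<omega>_def cmps psi_fm_cmp bas_ones bas_cmp bas_cmp_assoc smul_simps
          cc_iso_left[OF q12(1)] cc_iso_left[OF q12(2)] cc_iso_right[OF w(2)])
    then show ?thesis using hj by (simp add: phom_def)
  qed
  have pz: "pob b [?m] (?z *s bas (psi_orbit ?m) ?m)" using pob_named[of b "Singular e x"] b_pos by simp
  have Ext: "Ext1_vanishes FP EP (named n) (named (Singular e x)) \<longleftrightarrow>
      (\<forall>f. phom (nX n) (nx n) [w] \<omega> f \<longrightarrow> NN b (nX n) [w] f)"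
    unfolding named_PO nX.simps(2) nx.simps(2)
    using Ext1_vanishes_iff[OF pob_named[OF n b_pos] pz lc pt pw pj pp] .
  show ?thesis
  proof (cases n)
    case (Regular a1 a2)
    have "(\<forall>f. phom (nX n) (nx n) [w] \<omega> f \<longrightarrow> NN b (nX n) [w] f) \<longleftrightarrow>
        (\<forall>f. hom [obj_M a1 a2] [w] f \<longrightarrow> NN b [obj_M a1 a2] [w] f)"
      unfolding Regular nX.simps nx.simps by (rule all_NN_left_S[OF pw])
    also have "\<dots> \<longleftrightarrow> \<not> crossing b (a1, a2) (x, x)"
    proof -
      have a: "\<bar>a1 - a2\<bar> \<le> b" using n Regular by simp
      have "(\<exists>k. if even k then cross_at b a1 a2 x x k else cross_at b a1 a2 x x k) \<longleftrightarrow> crossing b (a1, a2) (x, x)"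
        by auto
      then show ?thesis
        unfolding all_NN_single NN_bas_eq w_def using boundary_between_iff[OF b xy a] by blast
    qed
    finally show ?thesis using Ext Regular by simp
  next
    case (Singular e' a)
    let ?a = "obj_M a a"
    \<comment> \<open>Equivariance of \<open>r\<close> times the basic morphism reads
      \<open>(sign_val e' + sign_val e) r = 0\<close>. For equal signs only \<open>r = 0\<close>
      remains, so there is no extension even when the coordinates cross.\<close>
    have ph: "phom [?a] (nx n) [w] \<omega> f \<longleftrightarrow> (\<exists>r. f = r *s bas ?a w \<and> (r = 0 \<or> e' \<noteq> e))" for f
    proof -
      have "phom [?a] (nx n) [w] \<omega> (r *s bas ?a w) \<longleftrightarrow> r = 0 \<or> e' \<noteq> e" for r
      proof -
        have "phom [?a] (nx n) [w] \<omega> (r *s bas ?a w) \<longleftrightarrow>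
            (sign_val e' * r) *s bas (psi_orbit ?a) w = (- ?z * r) *s bas (psi_orbit ?a) w"
          by (simp add: Singular phom_def hom_smul \<omega>_def cmps bas_cmp smul_simps cc_iso_left[OF cc_diag(2)]
              cc_iso_right[OF w(2)] mult.commute)
        also have "\<dots> \<longleftrightarrow> (sign_val e' + ?z) * r = 0"
          unfolding smul_bas_eq_iff by (simp add: distrib_right eq_neg_iff_add_eq_0)
        also have "\<dots> \<longleftrightarrow> r = 0 \<or> e' \<noteq> e"
        proof -
          have "(2::'r) \<noteq> 0" using half by (metis mult_zero_left zero_neq_one)
          then show ?thesis by (cases e; cases e') auto
        qed
        finally show ?thesis .
      qed
      then show ?thesis by (metis hom_single_iff phom_hom)
    qed
    have "(\<forall>f. phom [?a] (nx n) [w] \<omega> f \<longrightarrow> NN b [?a] [w] f) \<longleftrightarrow> NN b [?a] [w] (bas ?a w) \<or> e' = e"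
    proof (cases "e' = e")
      case True
      then show ?thesis using ph NN_zero by (auto simp: smul_simps)
    next
      case False
      then show ?thesis using ph NN_smul[of b "[?a]" "[w]" "bas ?a w"] by (metis smul_simps(4))
    qed
    moreover have "NN b [?a] [w] (bas ?a w) \<longleftrightarrow> \<not> crossing b (a, a) (x, x)"
      using all_NN_nX[OF b xy n] unfolding Singular nX.simps all_NN_single w_def by simp
    ultimately show ?thesis using Ext Singular by simp
  qed
qed

lemma Ext1_named:
  assumes "b < pi" "valid_name b n" "valid_name b m"
  shows "Ext1_vanishes FP EP (named n) (named m) \<longleftrightarrow>
    \<not> crossing b (name_coord n) (name_coord m) \<or> same_sign n m"
  using Ext1_Regular[OF assms(1) _ assms(2)] Ext1_Singular[OF assms(1,2)] assms(3)
  by (cases m) auto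

end


section \<open>Splitting off regular and singular summands\<close>

context dvr
begin

text \<open>If the restriction of an equivariant map \<open>p\<close> to some summands of \<open>X\<close> is invertible, then the
  remaining summands of \<open>X\<close> carry a complement of the split equivariant image.\<close>

lemma equivariant_complement:
  assumes X: "pob b X x" and B: "pob b B c" and \<alpha>: "phom B c X x \<alpha>" and p: "phom X x B c p"
    and p\<alpha>: "p \<star> \<alpha> = one B"
    and ks: "distinct ks" "set ks \<subseteq> {..<length X}"
    and v: "hom B (sub X ks) v" "(p \<star> inc X ks) \<star> v = one B" "v \<star> (p \<star> inc X ks) = one (sub X ks)"
  shows "\<exists>X' x' k l. length X' = length X - length ks \<and> pob b X' x' \<and> phom X' x' X x k \<and> phom X x X' x' l \<and>
    l \<star> k = one X' \<and> p \<star> k = 0 \<and> l \<star> \<alpha> = 0 \<and> \<alpha> \<star> p + k \<star> l = one X"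
proof -
  define ks' where "ks' = filter (\<lambda>i. i \<notin> set ks) [0..<length X]"
  define X' where "X' = sub X ks'"
  have d: "distinct ks'" "set ks' \<subseteq> {..<length X}" "set ks \<inter> set ks' = {}" "set ks' \<inter> set ks = {}"
    "set ks \<union> set ks' = {..<length X}"
    using ks(2) by (auto simp: ks'_def)
  have "length ks' = card (set ks')" using d(1) by (simp add: distinct_card)
  also have "set ks' = {..<length X} - set ks" by (auto simp: ks'_def)
  also have "card \<dots> = length X - length ks" using ks by (simp add: card_Diff_subset distinct_card)
  finally have len: "length X' = length X - length ks" by (simp add: X'_def sub_def)
  let ?i = "inc X ks" and ?i' = "inc X ks'" and ?p = "prj X ks" and ?p' = "prj X ks'"
  note hi = hom_inc[OF ks(2), where 'a = 'r] hom_prj[OF ks(2), where 'a = 'r]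
    hom_inc[OF d(2), where 'a = 'r] hom_prj[OF d(2), where 'a = 'r]
  note hp = phom_hom[OF p] and ha = phom_hom[OF \<alpha>]
  have sum: "?i \<star> ?p + ?i' \<star> ?p' = one X" using inc_prj_sum[OF ks(1) d(1,3,5)] .
  have p'i: "?p' \<star> ?i = 0" using prj_inc_disjoint d(3) by blast
  have p'i': "?p' \<star> ?i' = one X'" using prj_inc[OF d(1)] by (simp add: X'_def)
  \<comment> \<open>\<open>e\<close> projects onto the kernel of \<open>p\<close> along the chosen
    summands, \<open>e'\<close> along the image of \<open>\<alpha>\<close>. \<open>e'\<close> is
    equivariant; \<open>e\<close> allows the kernel to be indexed by the remaining positions. As the
    two have the same image, each acts as the identity on the other.\<close>
  define e where "e = one X - ?i \<star> (v \<star> p)"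
  define e' where "e' = one X - \<alpha> \<star> p"
  have he: "hom X X e" unfolding e_def by (intro hom_diff hom_one hom_cmp[OF hi(1) hom_cmp[OF v(1) hp]])
  have he': "hom X X e'" unfolding e'_def by (intro hom_diff hom_one hom_cmp[OF ha hp])
  have pe': "p \<star> e' = 0"
    using hp by (simp add: e'_def cmps ones fm_cmp_assoc[symmetric] p\<alpha>)
  have pe: "p \<star> e = 0"
  proof -
    have "p \<star> (?i \<star> (v \<star> p)) = ((p \<star> ?i) \<star> v) \<star> p" by (simp only: fm_cmp_assoc)
    then show ?thesis using hp by (simp add: e_def fm_cmp_diff v(2) ones)
  qed
  have ei: "e \<star> ?i = 0"
  proof -
    have "(?i \<star> (v \<star> p)) \<star> ?i = ?i \<star> (v \<star> (p \<star> ?i))" by (simp only: fm_cmp_assoc)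
    then show ?thesis using hi(1) by (simp add: e_def fm_cmp_diff v(3) ones)
  qed
  have e'_app: "e' \<star> a = a - \<alpha> \<star> (p \<star> a)" if "hom Z X a" for Z a
    using that by (simp add: e'_def fm_cmp_diff fm_cmp_assoc ones)
  have e_app: "e \<star> a = a - ?i \<star> (v \<star> (p \<star> a))" if "hom Z X a" for Z a
    using that by (simp add: e_def fm_cmp_diff fm_cmp_assoc ones)
  have e'e: "e' \<star> e = e" and e'e': "e' \<star> e' = e'" and ee': "e \<star> e' = e'"
    by (simp_all only: e'_app[OF he] e'_app[OF he'] e_app[OF he'] pe pe' fm_cmp_zero diff_zero)
  have e'\<alpha>: "e' \<star> \<alpha> = 0" using ha by (simp add: e'_def cmps ones p\<alpha>)
  define k where "k = e \<star> ?i'"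
  define l where "l = ?p' \<star> e'"
  have hk: "hom X' X k" and hl: "hom X X' l"
    unfolding k_def l_def X'_def using hom_cmp[OF he hi(3)] hom_cmp[OF hi(4) he'] .
  have pe'': "phom X x X x e'" unfolding e'_def using phom_diff[OF phom_one[OF X] phom_cmp[OF \<alpha> p]] .
  have lk: "l \<star> k = one X'"
  proof -
    have "l \<star> k = ?p' \<star> (e' \<star> e) \<star> ?i'" by (simp add: l_def k_def fm_cmp_assoc)
    also have "\<dots> = ?p' \<star> (?i' - ?i \<star> (v \<star> (p \<star> ?i')))"
      unfolding e'e using hi(3) by (simp add: e_def cmps ones)
    also have "\<dots> = one X'" by (simp add: fm_cmp_diff fm_cmp_assoc[symmetric] p'i p'i' fm_cmp_zero)
    finally show ?thesis .
  qed
  have kl: "k \<star> l = e'"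
  proof -
    have "k \<star> l = e \<star> (?i' \<star> ?p') \<star> e'" by (simp add: l_def k_def fm_cmp_assoc)
    also have "?i' \<star> ?p' = one X - ?i \<star> ?p" using sum by (simp add: algebra_simps)
    also have "e \<star> (one X - ?i \<star> ?p) = e"
      using he by (simp add: fm_cmp_diff ones fm_cmp_assoc[symmetric] ei fm_cmp_zero)
    finally show ?thesis by (simp add: ee')
  qed
  have e'k: "e' \<star> k = k" by (simp add: k_def fm_cmp_assoc[symmetric] e'e)
  have le': "l \<star> e' = l" by (simp add: l_def fm_cmp_assoc e'e')
  define x' where "x' = l \<star> (x \<star> psi k)"
  have hx': "hom (psl X') X' x'"
    unfolding x'_def by (intro hom_cmp[OF hl hom_cmp[OF pobD(2)[OF X] hom_psi[OF hk]]])
  have phk: "phom X' x' X x k"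
  proof -
    have "k \<star> x' = (k \<star> l) \<star> (x \<star> psi k)" by (simp add: x'_def fm_cmp_assoc)
    also have "\<dots> = x \<star> (psi (e' \<star> k))" unfolding kl by (simp add: phom_eq(2)[OF pe''] psi_fm_cmp)
    finally show ?thesis using hk by (simp add: phom_def e'k)
  qed
  have phl: "phom X x X' x' l"
  proof -
    have "x' \<star> psi l = l \<star> (x \<star> psi (k \<star> l))" by (simp add: x'_def fm_cmp_assoc psi_fm_cmp)
    also have "\<dots> = (l \<star> e') \<star> x" unfolding kl by (simp add: phom_eq(1)[OF pe''] fm_cmp_assoc)
    finally show ?thesis using hl by (simp add: phom_def le')
  qed
  have "x' \<star> psi x' = (x' \<star> psi l) \<star> (psi x \<star> k)" by (simp add: x'_def[THEN arg_cong, of psi] psi_fm_cmp fm_cmp_assoc)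
  also have "\<dots> = l \<star> ((x \<star> psi x) \<star> k)" using phom_eq(1)[OF phl, symmetric] by (simp add: fm_cmp_assoc)
  also have "\<dots> = one X'" using hk pobD(3)[OF X] by (simp add: ones lk)
  finally have "x' \<star> psi x' = one X'" .
  moreover have "ob b X'" using pobD(1)[OF X] d(2) by (auto simp: ob_def X'_def sub_def subset_iff)
  ultimately have "pob b X' x'" using hx' by (simp add: pob_def)
  moreover have "p \<star> k = 0" by (simp add: k_def fm_cmp_assoc[symmetric] pe fm_cmp_zero)
  moreover have "l \<star> \<alpha> = 0" by (simp add: l_def fm_cmp_assoc e'\<alpha> fm_cmp_zero)
  moreover have "\<alpha> \<star> p + k \<star> l = one X" unfolding kl e'_def by simp
  ultimately show ?thesis using len phk phl lk by blast
qed

text \<open>With the identity it spans the equivariant endomorphisms of \<open>SM\<close> (see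
  \<open>named_local\<close>). Its square is a power of \<open>u\<close>, a nonunit unless
  \<open>m\<close> is isomorphic to \<open>psi m\<close>.\<close>

definition flp :: "orbit \<Rightarrow> 'r fm" where
  "flp m = in1 [m] [psi_orbit m] \<star> (bas (psi_orbit m) m \<star> pr2 [m] [psi_orbit m]) +
     in2 [m] [psi_orbit m] \<star> (bas m (psi_orbit m) \<star> pr1 [m] [psi_orbit m])"

lemma cc_psi_sym: "cc (psi_orbit m) m (psi_orbit m) = cc m (psi_orbit m) m"
  using cc_sym by metis

lemma flp_sq: "flp m \<star> flp m = u ^ cc m (psi_orbit m) m *s one ([m] @ [psi_orbit m])"
proof -
  have "flp m \<star> flp m = u ^ cc m (psi_orbit m) m *s (in1 [m] [psi_orbit m] \<star> pr1 [m] [psi_orbit m] +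
     in2 [m] [psi_orbit m] \<star> pr2 [m] [psi_orbit m])"
    by (simp add: flp_def cmps bas_ones bas_cmp_assoc cc_psi_sym smul_simps one_single[symmetric])
  then show ?thesis by (simp add: in_pr)
qed

lemma hom_flp: "hom ([m] @ [psi_orbit m]) ([m] @ [psi_orbit m]) (flp m)"
  unfolding flp_def
  by (intro hom_add hom_cmp[OF hom_in1 hom_cmp[OF hom_bas hom_pr2]] hom_cmp[OF hom_in2 hom_cmp[OF hom_bas hom_pr1]])

lemma phom_flp: "phom ([m] @ psl [m]) (sw [m]) ([m] @ psl [m]) (sw [m]) (flp m)"
proof -
  have "flp m \<star> sw [m] = sw [m] \<star> psi (flp m)"
    by (simp add: flp_def sw_def cmps psi_fm_cmp bas_ones)
  then show ?thesis using hom_flp by (simp add: phom_def)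
qed

text \<open>With \<open>F = flp m\<close> and \<open>c\<close> the exponent in
  \<open>flp_sq\<close>, \<open>(r + s F)(r - s F) = r^2 - s^2 u^c\<close>. For a unit
  \<open>r\<close> and \<open>c > 0\<close> this is \<open>r^2\<close> times 1 minus a multiple of
  \<open>u\<close>, hence a unit.\<close>

lemma flp_unit:
  assumes "r dvd 1" "cc m (psi_orbit m) m \<noteq> 0"
  obtains M' where "hom ([m] @ [psi_orbit m]) ([m] @ [psi_orbit m]) M'"
    "(r *s one ([m] @ [psi_orbit m]) + s *s flp m) \<star> M' = one ([m] @ [psi_orbit m])"
    "M' \<star> (r *s one ([m] @ [psi_orbit m]) + s *s flp m) = one ([m] @ [psi_orbit m])"
    "phom ([m] @ psl [m]) (sw [m]) ([m] @ psl [m]) (sw [m]) M'"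
proof -
  let ?B = "[m] @ [psi_orbit m]"
  obtain r' where r': "r * r' = 1" using assms(1) by (metis dvd_def)
  let ?t = "r' * r' * s * s * u ^ cc m (psi_orbit m) m"
  have "u dvd u ^ cc m (psi_orbit m) m" using assms(2) by simp
  then have "u dvd ?t" by simp
  then have "(1 - ?t) dvd 1" by (rule unit_sub)
  then obtain d where d: "(1 - ?t) * d = 1" by (metis dvd_def)
  have o: "one ?B \<star> flp m = flp m" "flp m \<star> one ?B = flp m" using ones[OF hom_flp] by auto
  \<comment> \<open>\<open>q\<close> inverts \<open>r^2 - s^2 u^c\<close>, because
    \<open>r' r'\<close> inverts \<open>r^2\<close> and \<open>d\<close> inverts
    \<open>1 - ?t\<close>.\<close>
  define q where "q = r' * r' * d"
  define M' where "M' = q *s (r *s one ?B - s *s flp m)"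
  have q: "q * (r * r - s * s * u ^ cc m (psi_orbit m) m) = 1"
  proof -
    have "q * (r * r - s * s * u ^ cc m (psi_orbit m) m) = ((r * r') * (r * r') - ?t) * d"
      by (simp add: q_def algebra_simps)
    then show ?thesis using d by (simp add: r')
  qed
  have e: "(q * (r * r) - q * (s * s * u ^ cc m (psi_orbit m) m)) = 1"
    using q by (simp add: right_diff_distrib)
  show thesis
  proof (rule that)
    show "hom ?B ?B M'" unfolding M'_def by (intro hom_smul hom_diff hom_one hom_flp)
    show "(r *s one ?B + s *s flp m) \<star> M' = one ?B"
    proof -
      have "(r *s one ?B + s *s flp m) \<star> M' = (q * (r * r) - q * (s * s * u ^ cc m (psi_orbit m) m)) *s one ?B"
        unfolding M'_def fm_cmp_smul fm_cmp_diff fm_cmp_add_left o one_one flp_sq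
        by (rule poly_mapping_eqI) (simp add: lookup_add lookup_minus algebra_simps)
      then show ?thesis unfolding e by (simp add: smul_simps)
    qed
    show "M' \<star> (r *s one ?B + s *s flp m) = one ?B"
    proof -
      have "M' \<star> (r *s one ?B + s *s flp m) = (q * (r * r) - q * (s * s * u ^ cc m (psi_orbit m) m)) *s one ?B"
        unfolding M'_def fm_cmp_smul fm_cmp_diff fm_cmp_add_right o one_one flp_sq
        by (rule poly_mapping_eqI) (simp add: lookup_add lookup_minus algebra_simps)
      then show ?thesis unfolding e by (simp add: smul_simps)
    qed
    have "pob (max b (width m)) ([m] @ psl [m]) (sw [m])" for b
      by (rule pob_sw) (simp add: ob_def)
    then show "phom ([m] @ psl [m]) (sw [m]) ([m] @ psl [m]) (sw [m]) M'"
      unfolding M'_def using phom_one[of _ "[m] @ psl [m]" "sw [m]"] phom_flp[of m]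
      by (intro phom_smul phom_diff) auto
  qed
qed

lemma prj_x_inc:
  assumes "pob b X x" "i < length X" "j < length X"
  shows "prj X [i] \<star> (x \<star> psi (inc X [j])) = ent (psl X) X x i j *s bas (psi_orbit (X ! j)) (X ! i)"
  using ent_prj_inc[of "psl X" X x j i u] pobD(2)[OF assms(1)] assms(2,3) psi_inc[of "[j]" X, where 'a = 'r] by simp

text \<open>The sum of \<open>1 + s\<close> and \<open>1 - s\<close> is the unit 2, so one of them
  is a unit; this selects the sign \<open>e\<close>. Inclusion and projection at position
  \<open>i\<close> are then symmetrized for that sign, and their composite is the unit
  \<open>2 (1 + z s)\<close>, where \<open>z\<close> is the value of \<open>e\<close>.\<close>

lemma singular_summand:
  assumes X: "pob b X x" and i: "i < length X" "X ! i = obj_M y y"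
  shows "\<exists>e \<alpha> p X' x' k l. phom (nX (Singular e y)) (nx (Singular e y)) X x \<alpha> \<and>
    phom X x (nX (Singular e y)) (nx (Singular e y)) p \<and> p \<star> \<alpha> = one (nX (Singular e y)) \<and>
    length X' < length X \<and> pob b X' x' \<and> phom X' x' X x k \<and> phom X x X' x' l \<and>
    l \<star> k = one X' \<and> p \<star> k = 0 \<and> l \<star> \<alpha> = 0 \<and> \<alpha> \<star> p + k \<star> l = one X"
proof -
  let ?m = "obj_M y y"
  let ?n = "psi_orbit ?m"
  define s where "s = ent (psl X) X x i i"
  have "(1 + s) + (1 - s) dvd 1" using two_unit by simp
  then have "1 + s dvd 1 \<or> 1 - s dvd 1" using u_dvd_iff dvd_add by blast
  then obtain e where e: "1 + sign_val e * s dvd 1"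
  proof
    assume "1 + s dvd 1" then show thesis using that[of Plus] by simp
  next
    assume "1 - s dvd 1" then show thesis using that[of Minus] by simp
  qed
  define z where "z = (sign_val e :: 'r)"
  have zz: "z * z = 1" by (simp add: z_def)
  let ?a = "inc X [i] :: 'r fm" and ?q = "prj X [i] :: 'r fm"
  have sub: "sub X [i] = [?m]" using i by (simp add: sub_def)
  have ha: "hom [?m] X ?a" and hq: "hom X [?m] ?q"
    using hom_inc[of "[i]" X] hom_prj[of "[i]" X] i sub by auto
  have qa: "?q \<star> ?a = bas ?m ?m" using prj_inc[of "[i]" u X] sub by (simp add: one_single)
  have sa: "?q \<star> (x \<star> psi ?a) = s *s bas ?n ?m" using prj_x_inc[OF X i(1) i(1)] i by (simp add: s_def)
  have qxa: "psi ?q \<star> (psi x \<star> ?a) = s *s bas ?m ?n"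
    using arg_cong[OF sa, of psi] by (simp add: psi_fm_cmp)
  note cc0 = cc_diag[of y]
  have xx: "hom [?n] X (x \<star> psi ?a)" using hom_cmp[OF pobD(2)[OF X] hom_psi[OF ha]] by simp
  have hpa: "hom [?n] (psl X) (psi ?a)" using hom_psi[OF ha] by simp
  have hpq: "hom (psl X) [?n] (psi ?q)" using hom_psi[OF hq] by simp
  have "width (X ! i) \<le> b" using pobD(1)[OF X] nth_mem[OF i(1)] unfolding ob_def by blast
  then have "0 \<le> b" unfolding i(2) by simp
  then have B: "pob b [?m] (z *s bas ?n ?m)"
    by (simp add: pob_def ob_def hom_smul fm_cmp_smul bas_cmp smul_simps cc0 one_single zz)
  define \<alpha> where "\<alpha> = ?a + z *s (x \<star> (psi ?a \<star> bas ?m ?n))"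
  define p where "p = ?q + z *s (bas ?n ?m \<star> (psi ?q \<star> psi x))"
  have h\<alpha>: "hom [?m] X \<alpha>" unfolding \<alpha>_def
    by (intro hom_add hom_smul ha hom_cmp[OF pobD(2)[OF X] hom_cmp[OF hpa hom_bas]])
  have hp: "hom X [?m] p" unfolding p_def
    by (intro hom_add hom_smul hq hom_cmp[OF hom_bas hom_cmp[OF hpq pobD(5)[OF X]]])
  have ph\<alpha>: "phom [?m] (z *s bas ?n ?m) X x \<alpha>"
  proof -
    have "psi ?a \<star> bas ?n ?n = psi ?a" using ones(3)[OF hpa] by (simp add: one_single)
    then have "\<alpha> \<star> (z *s bas ?n ?m) = x \<star> psi \<alpha>"
      using pob_cancel(2)[OF X hom_cmp[OF ha hom_bas[of ?n]]]
      by (simp add: \<alpha>_def cmps psi_fm_cmp bas_cmp cc0 smul_simps zz add.commute)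
    then show ?thesis using h\<alpha> by (simp add: phom_def)
  qed
  have php: "phom X x [?m] (z *s bas ?n ?m) p"
  proof -
    have "bas ?m ?m \<star> (?q \<star> x) = ?q \<star> x" using ones(2)[OF hq] by (simp add: one_single)
    moreover have "psi ?q \<star> (psi x \<star> x) = psi ?q" using pob_cancel(3)[OF X hpq] .
    ultimately have "p \<star> x = (z *s bas ?n ?m) \<star> psi p"
      by (simp add: p_def cmps psi_fm_cmp bas_cmp_assoc cc0 smul_simps zz add.commute)
    then show ?thesis using hp by (simp add: phom_def)
  qed
  have pa: "p \<star> ?a = (1 + z * s) *s bas ?m ?m"
    by (simp add: p_def cmps qa qxa bas_cmp cc0 smul_simps)
  have p\<alpha>: "p \<star> \<alpha> = (2 * (1 + z * s)) *s bas ?m ?m"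
  proof -
    have "?q \<star> (x \<star> (psi ?a \<star> bas ?m ?n)) = (?q \<star> (x \<star> psi ?a)) \<star> bas ?m ?n" by (simp only: fm_cmp_assoc)
    also have "\<dots> = s *s bas ?m ?m" by (simp add: sa cmps bas_cmp cc0 smul_simps)
    finally have 1: "?q \<star> (x \<star> (psi ?a \<star> bas ?m ?n)) = s *s bas ?m ?m" .
    have "psi x \<star> (x \<star> (psi ?a \<star> bas ?m ?n)) = psi ?a \<star> bas ?m ?n"
      using pob_cancel(4)[OF X hom_cmp[OF hpa hom_bas]] .
    moreover have "psi ?q \<star> (psi ?a \<star> bas ?m ?n) = bas ?m ?n"
      using arg_cong[OF qa, of psi] by (simp add: psi_fm_cmp fm_cmp_assoc[symmetric] bas_cmp smul_simps)
    ultimately have 2: "psi ?q \<star> (psi x \<star> (x \<star> (psi ?a \<star> bas ?m ?n))) = bas ?m ?n" by simp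
    show ?thesis
      by (simp add: p_def \<alpha>_def cmps 1 2 qa qxa bas_cmp cc0 smul_simps zz)
        (rule poly_mapping_eqI, simp add: lookup_add algebra_simps)
  qed
  have "2 * (1 + z * s) dvd 1" unfolding unit_mult z_def using two_unit e by blast
  then obtain r where r: "2 * (1 + z * s) * r = 1" by (metis dvd_def)
  define \<alpha>' where "\<alpha>' = r *s \<alpha>"
  have ph\<alpha>': "phom [?m] (z *s bas ?n ?m) X x \<alpha>'" unfolding \<alpha>'_def using ph\<alpha> by (rule phom_smul)
  have rr: "r * (2 * (1 + z * s)) = 1" "(1 + z * s) * (2 * r) = 1" "2 * r * (1 + z * s) = 1"
    using r by (simp_all add: ac_simps)
  have p\<alpha>': "p \<star> \<alpha>' = one [?m]"
    by (simp only: \<alpha>'_def fm_cmp_smul p\<alpha> smul_simps(3,4) one_single rr)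
  \<comment> \<open>\<open>2 r\<close> inverts \<open>1 + z s\<close>, the coefficient of
    \<open>p\<close> on the chosen summand.\<close>
  define v where "v = (2 * r) *s (bas ?m ?m :: 'r fm)"
  have v: "hom [?m] (sub X [i]) v" "(p \<star> ?a) \<star> v = one [?m]" "v \<star> (p \<star> ?a) = one (sub X [i])"
    by (simp_all only: v_def sub hom_smul hom_bas pa fm_cmp_smul bas_cmp cc_left power_0 smul_simps(3,4)
        mult.right_neutral rr one_single)
  have "\<exists>X' x' k l. length X' = length X - length [i] \<and> pob b X' x' \<and> phom X' x' X x k \<and> phom X x X' x' l \<and>
    l \<star> k = one X' \<and> p \<star> k = 0 \<and> l \<star> \<alpha>' = 0 \<and> \<alpha>' \<star> p + k \<star> l = one X"
    using i by (intro equivariant_complement[OF X B ph\<alpha>' php p\<alpha>' _ _ v]) auto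
  then obtain X' x' k l where *: "length X' = length X - length [i]" "pob b X' x'" "phom X' x' X x k" "phom X x X' x' l"
    "l \<star> k = one X'" "p \<star> k = 0" "l \<star> \<alpha>' = 0" "\<alpha>' \<star> p + k \<star> l = one X" by blast
  have "length X' < length X" using *(1) i by simp
  then show ?thesis using * ph\<alpha>' php p\<alpha>' unfolding z_def
    by (intro exI[of _ e] exI[of _ \<alpha>'] exI[of _ p] exI[of _ X'] exI[of _ x'] exI[of _ k] exI[of _ l]) simp
qed

lemma inc_pair: "inc X [i, j] \<star> in1 [X ! i] [X ! j] = inc X [i]" "inc X [i, j] \<star> in2 [X ! i] [X ! j] = inc X [j]"
proof -
  have r: "inc_rel X [k] = {((k, X ! k), (0, X ! k))}" for k by (auto simp: inc_rel_def)
  have "inc_rel X [i, j] = {((i, X ! i), (0, X ! i)), ((j, X ! j), (1, X ! j))}"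
    by (auto simp: inc_rel_def lessThan_Suc image_iff)
  then have r2: "inc X [i, j] = single ((i, X ! i), (0, X ! i)) 1 + (single ((j, X ! j), (1, X ! j)) 1 :: 'r fm)"
    by (simp add: inc_def pm_def)
  show "inc X [i, j] \<star> in1 [X ! i] [X ! j] = inc X [i]" "inc X [i, j] \<star> in2 [X ! i] [X ! j] = inc X [j]"
    unfolding r2 in_pr_single by (simp_all add: fm_cmp_add_left fm_cmp_single cmp_single_def inc_def r pm_def)
qed

text \<open>The coefficient at \<open>(i, i)\<close> of \<open>x psi(x) = 1\<close> has a unit term,
  at some \<open>j\<close> whose orbit is isomorphic to \<open>psi m\<close>. Positions
  \<open>i\<close> and \<open>j\<close> together split off as \<open>SM\<close>: the conjugate of
  the inclusion at \<open>i\<close> serves as second component, and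
  \<open>p \<alpha> = 1 + s flp\<close> is invertible.\<close>

lemma regular_summand:
  assumes X: "pob b X x" and i: "i < length X" "X ! i = m" and m: "cc m (psi_orbit m) m \<noteq> 0"
  shows "\<exists>\<alpha> p X' x' k l. phom ([m] @ psl [m]) (sw [m]) X x \<alpha> \<and>
    phom X x ([m] @ psl [m]) (sw [m]) p \<and> p \<star> \<alpha> = one ([m] @ psl [m]) \<and>
    length X' < length X \<and> pob b X' x' \<and> phom X' x' X x k \<and> phom X x X' x' l \<and>
    l \<star> k = one X' \<and> p \<star> k = 0 \<and> l \<star> \<alpha> = 0 \<and> \<alpha> \<star> p + k \<star> l = one X"
proof -
  let ?m' = "psi_orbit m"
  let ?B = "[m] @ [?m']"
  note x = pobD[OF X]
  define s where "s = ent (psl X) X x i i"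
  have "(\<Sum>j<length (psl X). ent (psl X) X x i j * ent X (psl X) (psi x) j i * u ^ cc (X ! i) (psl X ! j) (X ! i)) = 1"
    using ent_cmp[of "psl X" X x X "psi x" u i i] x(2) ent_one[OF i(1), where 'a = 'r] unfolding x(3) by simp
  then obtain j where j: "j < length X" and
    "ent (psl X) X x i j * ent X (psl X) (psi x) j i * u ^ cc (X ! i) (psl X ! j) (X ! i) dvd 1"
    using nonunit_sum[of "{..<length (psl X)}" "\<lambda>j. ent (psl X) X x i j * ent X (psl X) (psi x) j i * u ^ cc (X ! i) (psl X ! j) (X ! i)"]
    by auto
  then have du: "ent (psl X) X x i j dvd 1" and c0: "cc m (psi_orbit (X ! j)) m = 0"
    using i unit_mult unit_u_power by auto
  define d where "d = ent (psl X) X x i j"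
  obtain d' where d': "d * d' = 1" using du by (metis dvd_def d_def)
  have d'': "d' * d = 1" using d' by (simp add: mult.commute)
  have d3: "d' * (c * d) = c" for c by (simp add: mult.left_commute d'')
  define n where "n = X ! j"
  have c1: "cc ?m' n ?m' = 0" using c0 cc_psi[of m "psi_orbit n" m] by (simp add: n_def)
  have c2: "cc n ?m' n = 0" using c1 cc_sym by metis
  \<comment> \<open>Otherwise \<open>m\<close> would be isomorphic to \<open>psi m\<close>, against
    the assumption.\<close>
  have ij: "i \<noteq> j" using c0 m i by auto
  let ?a = "inc X [i] :: 'r fm" and ?q = "prj X [i] :: 'r fm" and ?a' = "inc X [j] :: 'r fm"
  have ha: "hom [m] X ?a" and hq: "hom X [m] ?q" and ha': "hom [n] X ?a'"
    using hom_inc[of "[i]" X] hom_prj[of "[i]" X] hom_inc[of "[j]" X] i j by (auto simp: sub_def n_def)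
  have hpa: "hom [?m'] (psl X) (psi ?a)" and hpq: "hom (psl X) [?m'] (psi ?q)"
    using hom_psi[OF ha] hom_psi[OF hq] by simp_all
  have qa: "?q \<star> ?a = bas m m" using prj_inc[of "[i]" u X] i by (simp add: one_single sub_def)
  have qa': "?q \<star> ?a' = 0" using prj_inc_disjoint[of "[j]" "[i]" u X] ij by simp
  have pqa: "psi ?q \<star> psi ?a = bas ?m' ?m'" using arg_cong[OF qa, of psi] by (simp add: psi_fm_cmp)
  have sa: "?q \<star> (x \<star> psi ?a) = s *s bas ?m' m" using prj_x_inc[OF X i(1) i(1)] i by (simp add: s_def)
  have sa': "?q \<star> (x \<star> psi ?a') = d *s bas (psi_orbit n) m" using prj_x_inc[OF X i(1) j] i by (simp add: d_def n_def)
  have qxa: "psi ?q \<star> (psi x \<star> ?a) = s *s bas m ?m'"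
    using arg_cong[OF sa, of psi] by (simp add: psi_fm_cmp)
  have qxa': "psi ?q \<star> (psi x \<star> ?a') = d *s bas n ?m'"
    using arg_cong[OF sa', of psi] by (simp add: psi_fm_cmp)
  have B: "pob b ([m] @ psl [m]) (sw [m])"
    using x(1) i by (intro pob_sw) (auto simp: ob_def)
  define \<alpha> where "\<alpha> = ?a \<star> pr1 [m] [?m'] + x \<star> (psi ?a \<star> pr2 [m] [?m'])"
  define p where "p = in1 [m] [?m'] \<star> ?q + in2 [m] [?m'] \<star> (psi ?q \<star> psi x)"
  have ph\<alpha>: "phom ([m] @ psl [m]) (sw [m]) X x \<alpha>"
  proof -
    have "hom ?B X \<alpha>" unfolding \<alpha>_def
      by (intro hom_add hom_cmp[OF ha hom_pr1] hom_cmp[OF x(2) hom_cmp[OF hpa hom_pr2]])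
    moreover have "\<alpha> \<star> sw [m] = x \<star> psi \<alpha>"
      using pob_cancel(2)[OF X hom_cmp[OF ha hom_pr2[of "[?m']"]]] pr_sw[of "[m]"]
      by (simp add: \<alpha>_def cmps psi_fm_cmp add.commute)
    ultimately show ?thesis by (simp add: phom_def)
  qed
  have php: "phom X x ([m] @ psl [m]) (sw [m]) p"
  proof -
    have "hom X ?B p" unfolding p_def
      by (intro hom_add hom_cmp[OF hom_in1 hq] hom_cmp[OF hom_in2 hom_cmp[OF hpq x(5)]])
    moreover have "p \<star> x = sw [m] \<star> psi p"
      using pob_cancel(3)[OF X hpq] sw_in[of "[m]"] ones(1)[OF hpq] ones(2)[OF hq]
      by (simp add: p_def cmps psi_fm_cmp)
    ultimately show ?thesis by (simp add: phom_def)
  qed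
  have pa: "p \<star> ?a = in1 [m] [?m'] + s *s (in2 [m] [?m'] \<star> bas m ?m')"
  proof -
    have "in1 [m] [?m'] \<star> bas m m = in1 [m] [?m']" using ones(3)[OF hom_in1[of "[m]"]] by (simp add: one_single)
    then show ?thesis by (simp add: p_def cmps qa qxa)
  qed
  have pa': "p \<star> ?a' = d *s (in2 [m] [?m'] \<star> bas n ?m')"
    by (simp add: p_def cmps qa' qxa')
  have p\<alpha>: "p \<star> \<alpha> = 1 *s one ?B + s *s flp m"
  proof -
    have "p \<star> (x \<star> psi ?a) = s *s (in1 [m] [?m'] \<star> bas ?m' m) + in2 [m] [?m']"
    proof -
      have "psi x \<star> (x \<star> psi ?a) = psi ?a" using pob_cancel(4)[OF X hpa] .
      moreover have "in2 [m] [?m'] \<star> bas ?m' ?m' = in2 [m] [?m']"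
        using ones(3)[OF hom_in2[of "[?m']" "[m]"]] by (simp add: one_single)
      ultimately show ?thesis by (simp add: p_def cmps sa pqa)
    qed
    then have "p \<star> \<alpha> = in1 [m] [?m'] \<star> pr1 [m] [?m'] + s *s (in2 [m] [?m'] \<star> (bas m ?m' \<star> pr1 [m] [?m'])) +
       (s *s (in1 [m] [?m'] \<star> (bas ?m' m \<star> pr2 [m] [?m'])) + in2 [m] [?m'] \<star> pr2 [m] [?m'])"
      unfolding \<alpha>_def fm_cmp_add_right
      by (simp only: fm_cmp_assoc[symmetric] pa) (simp add: cmps)
    also have "\<dots> = 1 *s one ?B + s *s flp m"
      unfolding in_pr[of u "[m]" "[?m']", symmetric] flp_def by (simp add: smul_simps)
    finally show ?thesis .
  qed
  obtain M' where M': "hom ?B ?B M'" "(1 *s one ?B + s *s flp m) \<star> M' = one ?B"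
    "M' \<star> (1 *s one ?B + s *s flp m) = one ?B" "phom ([m] @ psl [m]) (sw [m]) ([m] @ psl [m]) (sw [m]) M'"
    using flp_unit[OF _ m, of 1 s] by auto
  define \<alpha>' where "\<alpha>' = \<alpha> \<star> M'"
  have ph\<alpha>': "phom ([m] @ psl [m]) (sw [m]) X x \<alpha>'" unfolding \<alpha>'_def using phom_cmp[OF ph\<alpha> M'(4)] .
  have p\<alpha>': "p \<star> \<alpha>' = one ([m] @ psl [m])"
    using M'(2) by (simp add: \<alpha>'_def fm_cmp_assoc[symmetric] p\<alpha>)
  have sub: "sub X [i, j] = [m] @ [n]" using i by (simp add: sub_def n_def)
  let ?w = "bas ?m' n :: 'r fm"
  \<comment> \<open>On positions \<open>i\<close> and \<open>j\<close>, \<open>p\<close> is lower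
    triangular with diagonal 1, \<open>d\<close> and with \<open>s\<close> below it.
    \<open>v\<close> is the inverse matrix; \<open>?w\<close> occurs in it because the orbit at
    \<open>j\<close> is only isomorphic to \<open>psi m\<close>.\<close>
  define v where "v = in1 [m] [n] \<star> pr1 [m] [?m'] +
    d' *s (in2 [m] [n] \<star> (?w \<star> (pr2 [m] [?m'] - s *s (bas m ?m' \<star> pr1 [m] [?m']))))"
  have hv: "hom ?B (sub X [i, j]) v" unfolding v_def sub
    by (intro hom_add hom_smul hom_diff hom_cmp[OF hom_in1 hom_pr1] hom_cmp[OF hom_in2]
        hom_cmp[OF hom_bas[of ?m' n]] hom_pr2 hom_cmp[OF hom_bas hom_pr1])
  have inc2: "inc X [i, j] \<star> in1 [m] [n] = ?a" "inc X [i, j] \<star> in2 [m] [n] = ?a'"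
    using inc_pair[of X i j] i by (simp_all add: n_def)
  have pv: "(p \<star> inc X [i, j]) \<star> v = one ?B"
  proof -
    have "(p \<star> inc X [i, j]) \<star> v = (p \<star> ?a) \<star> pr1 [m] [?m'] +
        d' *s ((p \<star> ?a') \<star> (?w \<star> (pr2 [m] [?m'] - s *s (bas m ?m' \<star> pr1 [m] [?m']))))"
      unfolding v_def inc2[symmetric] by (simp add: fm_cmp_add_right fm_cmp_smul fm_cmp_assoc)
    also have "\<dots> = in1 [m] [?m'] \<star> pr1 [m] [?m'] + in2 [m] [?m'] \<star> pr2 [m] [?m']"
    proof -
      have o: "bas ?m' ?m' \<star> pr2 [m] [?m'] = pr2 [m] [?m']" using ones(1)[OF hom_pr2[of "[m]" "[?m']"]] by (simp add: one_single)
      show ?thesis unfolding pa pa'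
        by (simp add: cmps bas_cmp_assoc bas_cmp c1 cc_iso_right[OF c1] cc_iso_right[OF c2] smul_simps o d' d'' d3 mult.assoc)
    qed
    finally show ?thesis by (simp add: in_pr)
  qed
  have vp: "v \<star> (p \<star> inc X [i, j]) = one (sub X [i, j])"
  proof -
    have hpi: "hom ([m] @ [n]) ?B (p \<star> inc X [i, j])"
      using hom_cmp[OF phom_hom[OF php] hom_inc[of "[i, j]" X]] i j sub by simp
    have "v \<star> (p \<star> inc X [i, j]) = (v \<star> (p \<star> ?a)) \<star> pr1 [m] [n] + (v \<star> (p \<star> ?a')) \<star> pr2 [m] [n]"
      by (subst split_right[OF hpi]) (simp add: fm_cmp_add_right fm_cmp_assoc inc2[symmetric])
    also have "v \<star> (p \<star> ?a) = in1 [m] [n]"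
    proof -
      have o: "pr1 [m] [?m'] \<star> (p \<star> ?a) = bas m m"
        unfolding pa by (simp add: cmps smul_simps) (simp add: one_single)
      have o': "pr2 [m] [?m'] \<star> (p \<star> ?a) = s *s bas m ?m'"
        unfolding pa by (simp add: cmps bas_ones smul_simps)
      have "bas m ?m' \<star> (pr1 [m] [?m'] \<star> (p \<star> ?a)) = bas m ?m'"
        unfolding o by (simp add: bas_cmp smul_simps)
      moreover have "in1 [m] [n] \<star> bas m m = in1 [m] [n]" using ones(3)[OF hom_in1[of "[m]" "[n]"]] by (simp add: one_single)
      ultimately show ?thesis unfolding v_def by (simp add: cmps o o' fm_cmp_zero smul_simps)
    qed
    also have "v \<star> (p \<star> ?a') = in2 [m] [n]"
    proof -
      have o: "pr1 [m] [?m'] \<star> (p \<star> ?a') = 0" "pr2 [m] [?m'] \<star> (p \<star> ?a') = d *s bas n ?m'"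
        unfolding pa' by (simp_all add: cmps bas_ones smul_simps)
      have "in2 [m] [n] \<star> bas n n = in2 [m] [n]" using ones(3)[OF hom_in2[of "[n]" "[m]"]] by (simp add: one_single)
      then show ?thesis unfolding v_def
        by (simp add: cmps o fm_cmp_zero smul_simps bas_cmp c2 d' d'' mult.assoc)
    qed
    finally show ?thesis unfolding sub by (simp add: in_pr)
  qed
  have "\<exists>X' x' k l. length X' = length X - length [i, j] \<and> pob b X' x' \<and> phom X' x' X x k \<and> phom X x X' x' l \<and>
    l \<star> k = one X' \<and> p \<star> k = 0 \<and> l \<star> \<alpha>' = 0 \<and> \<alpha>' \<star> p + k \<star> l = one X"
    using i j ij hv pv vp by (intro equivariant_complement[OF X B ph\<alpha>' php p\<alpha>']) auto
  then obtain X' x' k l where *: "length X' = length X - length [i, j]" "pob b X' x'" "phom X' x' X x k" "phom X x X' x' l"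
    "l \<star> k = one X'" "p \<star> k = 0" "l \<star> \<alpha>' = 0" "\<alpha>' \<star> p + k \<star> l = one X" by blast
  have "length X' < length X" using *(1) i by simp
  then show ?thesis using * ph\<alpha>' php p\<alpha>'
    by (intro exI[of _ \<alpha>'] exI[of _ p] exI[of _ X'] exI[of _ x'] exI[of _ k] exI[of _ l]) simp
qed

end


section \<open>Indecomposable objects of the stable category\<close>

text \<open>A representative of the value of \<open>h\<close>: \<open>SM(x, y)\<close> is
  \<open>SE(x, y + pi)\<close>, and for \<open>x < y\<close> the prescribed point
  \<open>[y + pi, x + 2 pi]\<close> is translated back by \<open>pi\<close>.\<close>

fun name_point :: "name \<Rightarrow> point" where
  "name_point (Regular x y) = (if y < x then (x, y + pi, Plus) else (y, x + pi, Plus))"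
| "name_point (Singular e x) = (x, x + pi, e)"

lemma name_point_H_tilde: "valid_name pi n \<Longrightarrow> name_point n \<in> H_tilde"
  by (cases n) (auto simp: H_tilde_def)

lemma H_class_eq_iff: "H_class p = H_class q \<longleftrightarrow> equivclp H_gen p q"
proof
  assume "H_class p = H_class q"
  then have "q \<in> H_class p" by (simp add: H_class_def)
  then show "equivclp H_gen p q" by (simp add: H_class_def)
next
  assume "equivclp H_gen p q"
  then show "H_class p = H_class q"
    unfolding H_class_def by (auto intro: equivclp_trans equivclp_sym)
qed

lemma H_class_translate:
  assumes "(x, y, e) \<in> H_tilde"
  shows "H_class (x + of_int k * pi, y + of_int k * pi, e) = H_class (x, y, e)"
proof -
  have step: "H_class (x + pi, y + pi, e) = H_class (x, y, e)" if "(x, y, e) \<in> H_tilde" for x y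
    using H_gen.intros(2)[OF that] H_class_eq_iff by (metis r_into_equivclp)
  have mem: "(x + of_int k * pi, y + of_int k * pi, e) \<in> H_tilde" for k :: int
    using assms by (auto simp: H_tilde_def)
  show ?thesis
  proof (induction k rule: int_induct[where k = 0])
    case (step1 i)
    then show ?case using step[OF mem[of i]] by (simp add: algebra_simps)
  next
    case (step2 i)
    have e: "(x + of_int (i - 1) * pi) + pi = x + of_int i * pi" "(y + of_int (i - 1) * pi) + pi = y + of_int i * pi"
      by (simp_all add: algebra_simps)
    show ?case using step[OF mem[of "i - 1"]] step2(2) unfolding e by (rule trans[OF sym])
  qed simp
qed

lemma cc_zero_translate:
  assumes "cc (obj_M x y) (obj_M x' y') (obj_M x y) = 0"
  shows "\<exists>k::int. (x = x' + of_int k * pi \<and> y = y' + of_int k * pi) \<or> (x = y' + of_int k * pi \<and> y = x' + of_int k * pi)"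
proof -
  obtain k :: int where k: "if even k then x = x' + of_int k * pi \<and> y = y' + of_int k * pi
       else x = y' + of_int k * pi \<and> y = x' + of_int k * pi"
    using assms unfolding cc_obj_M_zero by (rule exE)
  show ?thesis using k by (intro exI[of _ k]) (simp split: if_split_asm)
qed

context dvr
begin

text \<open>An orbit of another width is isomorphic to no boundary orbit, so the passage to any
  middle orbit and back contributes a positive power of \<open>u\<close> to the diagonal
  coefficient.\<close>

lemma NN_ent_dvd:
  assumes "NN b X X a" "i < length X" "width (X ! i) \<noteq> b"
  shows "u dvd ent X X a i i"
proof -
  obtain P g h where P: "bd b P" "hom X P g" "hom P X h" "a = h \<star> g" using assms(1) by (rule NNE)
  have "u dvd ent P X h i j * ent X P g j i * u ^ cc (X ! i) (P ! j) (X ! i)" if "j < length P" for j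
  proof -
    have "cc (X ! i) (P ! j) (X ! i) \<noteq> 0"
      using that P(1) assms(3) cc_zero_width nth_mem unfolding bd_def by metis
    then show ?thesis by simp
  qed
  then show ?thesis
    using ent_cmp[of P X h X g u i i] P
      dvd_sum[of "{..<length P}" u "\<lambda>j. ent P X h i j * ent X P g j i * u ^ cc (X ! i) (P ! j) (X ! i)"]
    by simp
qed

end

context frob
begin

lemma biproduct_CP:
  assumes "pob b X x" "pob b A a" "pob b B c"
    "phom A a X x i" "phom B c X x j" "phom X x A a p" "phom X x B c q"
    "NN b A A (p \<star> i - one A)" "NN b B B (q \<star> j - one B)" "NN b B A (p \<star> j)" "NN b A B (q \<star> i)"
    "NN b X X (i \<star> p + j \<star> q - one X)"
  shows "is_biproduct CP (PO X x) (PO A a) (PO B c)"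
  unfolding is_biproduct_def
proof (intro conjI bexI)
  note ph = phom_cmp[OF assms(6,4)] phom_cmp[OF assms(7,5)] phom_cmp[OF assms(6,5)] phom_cmp[OF assms(7,4)]
    phom_cmp[OF assms(4,6)] phom_cmp[OF assms(5,7)]
  note one = phom_one[OF assms(1)] phom_one[OF assms(2)] phom_one[OF assms(3)]
  show "PO X x \<in> Ob CP" "PO A a \<in> Ob CP" "PO B c \<in> Ob CP" using assms Ob_CP by blast+
  show "SC A a i X x \<in> homs CP (PO A a) (PO X x)" "SC B c j X x \<in> homs CP (PO B c) (PO X x)"
    "SC X x p A a \<in> homs CP (PO X x) (PO A a)" "SC X x q B c \<in> homs CP (PO X x) (PO B c)"
    using assms homs_CP by blast+
  show "Cmp CP (SC X x p A a) (SC A a i X x) = Id CP (PO A a)"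
    using assms by (simp add: Cmp_CP Id_CP SC_eq[OF _ _ ph(1) one(2)])
  show "Cmp CP (SC X x q B c) (SC B c j X x) = Id CP (PO B c)"
    using assms by (simp add: Cmp_CP Id_CP SC_eq[OF _ _ ph(2) one(3)])
  show "Cmp CP (SC X x p A a) (SC B c j X x) = Zer CP (PO B c) (PO A a)"
    using assms by (simp add: Cmp_CP Zer_CP SC_eq[OF _ _ ph(3) phom_zero])
  show "Cmp CP (SC X x q B c) (SC A a i X x) = Zer CP (PO A a) (PO B c)"
    using assms by (simp add: Cmp_CP Zer_CP SC_eq[OF _ _ ph(4) phom_zero])
  show "Add CP (Cmp CP (SC A a i X x) (SC X x p A a)) (Cmp CP (SC B c j X x) (SC X x q B c)) = Id CP (PO X x)"
    using assms by (simp add: Cmp_CP Id_CP Add_CP[OF _ _ ph(5,6)] SC_eq[OF _ _ phom_add[OF ph(5,6)] one(1)])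
qed

definition stbip :: "orbit list \<Rightarrow> 'r fm \<Rightarrow> orbit list \<Rightarrow> 'r fm \<Rightarrow> orbit list \<Rightarrow> 'r fm \<Rightarrow> bool" where
  "stbip X x A a B c \<longleftrightarrow> (\<exists>i j p q. phom A a X x i \<and> phom B c X x j \<and> phom X x A a p \<and> phom X x B c q \<and>
    NN b A A (p \<star> i - one A) \<and> NN b B B (q \<star> j - one B) \<and> NN b B A (p \<star> j) \<and> NN b A B (q \<star> i) \<and>
    NN b X X (i \<star> p + j \<star> q - one X))"

lemma stbip_exact:
  assumes "phom A a X x i" "phom B c X x j" "phom X x A a p" "phom X x B c q"
    "p \<star> i = one A" "q \<star> j = one B" "p \<star> j = 0" "q \<star> i = 0" "i \<star> p + j \<star> q = one X"
  shows "stbip X x A a B c"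
  unfolding stbip_def using assms NN_zero
  by (intro exI[of _ i] exI[of _ j] exI[of _ p] exI[of _ q]) simp

text \<open>The idempotent of \<open>X\<close> that belongs to the boundary list \<open>B\<close> is
  null, so a stable decomposition of the complement \<open>X'\<close> is one of
  \<open>X\<close>.\<close>

lemma stbip_drop:
  assumes 1: "phom B c X x \<alpha>" "phom X' x' X x k" "phom X x B c p" "phom X x X' x' l"
    "l \<star> k = one X'" "\<alpha> \<star> p + k \<star> l = one X" and bd: "bd b B" and 2: "stbip X' x' A a D d"
  shows "stbip X x A a D d"
proof -
  obtain i j q r where *: "phom A a X' x' i" "phom D d X' x' j" "phom X' x' A a q" "phom X' x' D d r"
    "NN b A A (q \<star> i - one A)" "NN b D D (r \<star> j - one D)" "NN b D A (q \<star> j)" "NN b A D (r \<star> i)"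
    "NN b X' X' (i \<star> q + j \<star> r - one X')" using 2 unfolding stbip_def by blast
  have kk: "l \<star> (k \<star> i) = i" "l \<star> (k \<star> j) = j"
    using phom_hom[OF *(1)] phom_hom[OF *(2)] by (simp_all add: fm_cmp_assoc[symmetric] 1(5) ones)
  note hk = phom_hom[OF 1(2)] phom_hom[OF 1(4)]
  have n: "NN b X X (k \<star> ((i \<star> q + j \<star> r - one X') \<star> l))"
    using NN_left[OF NN_right[OF *(9) hk(2)] hk(1)] .
  have "NN b X X (\<alpha> \<star> p)" using NNI[OF bd phom_hom[OF 1(3)] phom_hom[OF 1(1)]] .
  then have "NN b X X (k \<star> ((i \<star> q + j \<star> r - one X') \<star> l) - \<alpha> \<star> p)" using NN_diff[OF n] by blast
  moreover have "k \<star> ((i \<star> q + j \<star> r - one X') \<star> l) - \<alpha> \<star> p = (k \<star> i) \<star> (q \<star> l) + (k \<star> j) \<star> (r \<star> l) - one X"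
    unfolding 1(6)[symmetric] using hk by (simp add: cmps ones)
  ultimately have "NN b X X ((k \<star> i) \<star> (q \<star> l) + (k \<star> j) \<star> (r \<star> l) - one X)" by simp
  then show ?thesis unfolding stbip_def
    using phom_cmp[OF 1(2) *(1)] phom_cmp[OF 1(2) *(2)] phom_cmp[OF *(3) 1(4)] phom_cmp[OF *(4) 1(4)] *(5-8)
    by (intro exI[of _ "k \<star> i"] exI[of _ "k \<star> j"] exI[of _ "q \<star> l"] exI[of _ "r \<star> l"]) (simp add: fm_cmp_assoc kk)
qed

lemma bd_extension:
  assumes "hom B X \<alpha>" "hom X' X k" "hom X B p" "hom X X' l" "\<alpha> \<star> p + k \<star> l = one X" "bd b B" "bd b X'"
  shows "bd b X"
  using NN_add[OF NNI[OF assms(6,3,1)] NNI[OF assms(7,4,2)]] NN_one_bd by (simp add: assms(5))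

text \<open>The leading orbit decides: on the diagonal a singular summand splits off, elsewhere one
  of the form \<open>SM\<close>. If the latter has width \<open>b\<close>, it is stably zero and is
  dropped, and induction treats the shorter complement.\<close>

lemma stable_split:
  "pob b X x \<Longrightarrow> bd b X \<or> (\<exists>n X' x'. valid_name b n \<and> pob b X' x' \<and> stbip X x (nX n) (nx n) X' x')"
proof (induction "length X" arbitrary: X x rule: less_induct)
  case less
  show ?case
  proof (cases "X = []")
    case False
    then have i: "0 < length X" by simp
    obtain y y' where m: "X ! 0 = obj_M y y'" using orbit_obj_M by blast
    show ?thesis
    proof (cases "y = y'")
      case True
      then obtain e \<alpha> p X' x' k l where s: "phom (nX (Singular e y)) (nx (Singular e y)) X x \<alpha>"
        "phom X x (nX (Singular e y)) (nx (Singular e y)) p" "p \<star> \<alpha> = one (nX (Singular e y))"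
        "pob b X' x'" "phom X' x' X x k" "phom X x X' x' l"
        "l \<star> k = one X'" "p \<star> k = 0" "l \<star> \<alpha> = 0" "\<alpha> \<star> p + k \<star> l = one X"
        using singular_summand[OF less.prems i, of y] m by blast
      have "stbip X x (nX (Singular e y)) (nx (Singular e y)) X' x'"
        using stbip_exact[OF s(1,5,2,6,3,7,8,9,10)] .
      then show ?thesis using s(4) by (intro disjI2 exI[of _ "Singular e y"] exI[of _ X'] exI[of _ x']) simp
    next
      case False
      then have c: "cc (obj_M y y') (psi_orbit (obj_M y y')) (obj_M y y') \<noteq> 0" by (simp add: cc_obj_M_psi)
      obtain \<alpha> p X' x' k l where s: "phom ([obj_M y y'] @ psl [obj_M y y']) (sw [obj_M y y']) X x \<alpha>"
        "phom X x ([obj_M y y'] @ psl [obj_M y y']) (sw [obj_M y y']) p" "p \<star> \<alpha> = one ([obj_M y y'] @ psl [obj_M y y'])"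
        "length X' < length X" "pob b X' x'" "phom X' x' X x k" "phom X x X' x' l"
        "l \<star> k = one X'" "p \<star> k = 0" "l \<star> \<alpha> = 0" "\<alpha> \<star> p + k \<star> l = one X"
        using regular_summand[OF less.prems i m c] by blast
      have "width (X ! 0) \<le> b" using pobD(1)[OF less.prems] nth_mem[OF i] unfolding ob_def by blast
      then consider "\<bar>y - y'\<bar> < b" | "\<bar>y - y'\<bar> = b" unfolding m by fastforce
      then show ?thesis
      proof cases
        case 1
        then have "valid_name b (Regular y y')" using False by simp
        moreover have "stbip X x (nX (Regular y y')) (nx (Regular y y')) X' x'"
          using stbip_exact[OF s(1,6,2,7,3,8,9,10,11)] by simp
        ultimately show ?thesis using s(5) by blast
      next
        case 2
        then have B: "bd b ([obj_M y y'] @ psl [obj_M y y'])" by (simp add: bd_def)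
        from less.hyps[OF s(4,5)] show ?thesis
        proof
          assume "bd b X'"
          then have "bd b X"
            using bd_extension[OF phom_hom[OF s(1)] phom_hom[OF s(6)] phom_hom[OF s(2)] phom_hom[OF s(7)] s(11) B] by blast
          then show ?thesis ..
        next
          assume "\<exists>n X'' x''. valid_name b n \<and> pob b X'' x'' \<and> stbip X' x' (nX n) (nx n) X'' x''"
          then obtain n X'' x'' where n: "valid_name b n" "pob b X'' x''" "stbip X' x' (nX n) (nx n) X'' x''" by blast
          have "stbip X x (nX n) (nx n) X'' x''" using stbip_drop[OF s(1,6,2,7,8,11) B n(3)] .
          then show ?thesis using n by blast
        qed
      qed
    qed
  qed simp
qed

lemma named_not_bd: "valid_name b n \<Longrightarrow> \<not> bd b (nX n)"
  using b_pos by (cases n) (auto simp: bd_def)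

text \<open>A named object is not stably zero, so indecomposability makes the complement of a named
  summand zero. The idempotent of the complement is then null, and the other one is 1 modulo null
  maps.\<close>

lemma stable_classification:
  assumes X: "pob b X x" and ind: "indecomposable CP (PO X x)"
  shows "\<exists>n. valid_name b n \<and> stiso X x (nX n) (nx n)"
proof -
  have "\<not> bd b X" using ind zero_CP[OF X] unfolding indecomposable_def by blast
  then obtain n X' x' where n: "valid_name b n" "pob b X' x'" "stbip X x (nX n) (nx n) X' x'"
    using stable_split[OF X] by blast
  then obtain i j p q where s: "phom (nX n) (nx n) X x i" "phom X' x' X x j" "phom X x (nX n) (nx n) p"
    "phom X x X' x' q" "NN b (nX n) (nX n) (p \<star> i - one (nX n))" "NN b X' X' (q \<star> j - one X')"
    "NN b X' (nX n) (p \<star> j)" "NN b (nX n) X' (q \<star> i)" "NN b X X (i \<star> p + j \<star> q - one X)"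
    unfolding stbip_def by blast
  have pn: "pob b (nX n) (nx n)" using pob_named[OF n(1) b_pos] .
  have "is_biproduct CP (PO X x) (PO (nX n) (nx n)) (PO X' x')" using biproduct_CP[OF X pn n(2) s] .
  then have "zero_object CP (PO (nX n) (nx n)) \<or> zero_object CP (PO X' x')"
    using ind unfolding indecomposable_def by blast
  then have "bd b X'" using zero_CP[OF pn] zero_CP[OF n(2)] named_not_bd[OF n(1)] by blast
  then have "NN b X X (j \<star> q)" using NNI phom_hom[OF s(4)] phom_hom[OF s(2)] by blast
  then have "NN b X X ((i \<star> p + j \<star> q - one X) - j \<star> q)" using NN_diff[OF s(9)] by blast
  then have "NN b X X (i \<star> p - one X)" by simp
  then have "stiso X x (nX n) (nx n)" unfolding stiso_def using s by blast
  then show ?thesis using n(1) by blast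
qed

text \<open>Endomorphisms are scalars \<open>r\<close> in the singular case. In the regular case an
  equivariant map on \<open>SM\<close> is determined by its restriction to \<open>M\<close>, hence
  of the form \<open>r + s flp\<close>. A unit \<open>r\<close> makes either invertible, and
  \<open>r\<close> or \<open>1 - r\<close> is a unit.\<close>

lemma named_local:
  assumes n: "valid_name b n" and a: "phom (nX n) (nx n) (nX n) (nx n) a"
  shows "\<exists>a'. hom (nX n) (nX n) a' \<and> (a' \<star> a = one (nX n) \<or> a' \<star> (one (nX n) - a) = one (nX n))"
proof (cases n)
  case (Singular e y)
  let ?m = "obj_M y y"
  obtain r where r: "a = r *s bas ?m ?m" using phom_hom[OF a] unfolding Singular by (auto simp: hom_single_iff)
  have "r + (1 - r) dvd 1" by simp
  then have "r dvd 1 \<or> 1 - r dvd 1" using u_dvd_iff dvd_add by blast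
  then show ?thesis
  proof
    assume "r dvd 1"
    then obtain r' where "r * r' = 1" by (metis dvd_def)
    then show ?thesis unfolding Singular r
      by (intro exI[of _ "r' *s bas ?m ?m"]) (simp add: hom_smul fm_cmp_smul bas_cmp smul_simps(3,4) one_single)
  next
    assume "1 - r dvd 1"
    then obtain r' where "(1 - r) * r' = 1" by (metis dvd_def)
    moreover have "one [?m] - r *s bas ?m ?m = (1 - r) *s bas ?m ?m"
      by (simp add: one_single smul_simps)
    ultimately show ?thesis unfolding Singular r
      by (intro exI[of _ "r' *s bas ?m ?m"]) (simp add: hom_smul fm_cmp_smul bas_cmp smul_simps(3,4) one_single)
  qed
next
  case (Regular y y')
  define m where "m = obj_M y y'"
  let ?m' = "psi_orbit m"
  let ?B = "[m] @ [?m']"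
  have nX: "nX n = ?B" "nx n = sw [m]" by (simp_all add: Regular m_def)
  have c: "cc m ?m' m \<noteq> 0" using n unfolding Regular m_def by (simp add: cc_obj_M_psi)
  have ph: "phom ?B (sw [m]) ?B (sw [m]) a" and ha: "hom ?B ?B a" using a phom_hom[OF a] unfolding nX by auto
  obtain r where r: "pr1 [m] [?m'] \<star> (a \<star> in1 [m] [?m']) = r *s bas m m"
    using hom_cmp[OF hom_pr1 hom_cmp[OF ha hom_in1]] by (rule hom_single_left)
  obtain s where s: "pr2 [m] [?m'] \<star> (a \<star> in1 [m] [?m']) = s *s bas m ?m'"
    using hom_cmp[OF hom_pr2 hom_cmp[OF ha hom_in1]] by (rule hom_single_left)
  have a1: "a \<star> in1 [m] [?m'] = in1 [m] [?m'] \<star> (r *s bas m m) + in2 [m] [?m'] \<star> (s *s bas m ?m')"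
    using split_left[OF hom_cmp[where u = u, OF ha hom_in1]] unfolding r s .
  have "sw [m] \<star> in1 [?m'] [m] = in2 [m] [?m']" by (simp add: sw_def cmps)
  then have "a \<star> in2 [m] [?m'] = sw [m] \<star> psi (a \<star> in1 [m] [?m'])"
    using phom_eq(2)[OF ph, of "in1 [?m'] [m]"] by (simp add: psi_fm_cmp)
  also have "\<dots> = in2 [m] [?m'] \<star> (r *s bas ?m' ?m') + in1 [m] [?m'] \<star> (s *s bas ?m' m)"
    unfolding a1 using sw_in[of "[m]"] by (simp add: psi_fm_cmp cmps bas_ones)
  finally have a2: "a \<star> in2 [m] [?m'] = in2 [m] [?m'] \<star> (r *s bas ?m' ?m') + in1 [m] [?m'] \<star> (s *s bas ?m' m)" .
  have o: "in1 [m] [?m'] \<star> (bas m m \<star> pr1 [m] [?m']) = in1 [m] [?m'] \<star> pr1 [m] [?m']"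
     "in2 [m] [?m'] \<star> (bas ?m' ?m' \<star> pr2 [m] [?m']) = in2 [m] [?m'] \<star> pr2 [m] [?m']"
    by (simp_all add: one_single[symmetric])
  have "a = (a \<star> in1 [m] [?m']) \<star> pr1 [m] [?m'] + (a \<star> in2 [m] [?m']) \<star> pr2 [m] [?m']"
    using split_right[OF ha] by (simp add: fm_cmp_assoc)
  also have "\<dots> = r *s one ?B + s *s flp m"
    unfolding a1 a2 flp_def in_pr[of u "[m]" "[?m']", symmetric] by (simp add: cmps o smul_simps)
  finally have ars: "a = r *s one ?B + s *s flp m" .
  have "r + (1 - r) dvd 1" by simp
  then have "r dvd 1 \<or> 1 - r dvd 1" using u_dvd_iff dvd_add by blast
  then show ?thesis
  proof
    assume "r dvd 1"
    then obtain M' where "hom ?B ?B M'" "M' \<star> (r *s one ?B + s *s flp m) = one ?B"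
      using flp_unit[OF _ c, of r s] by blast
    then show ?thesis unfolding nX ars by blast
  next
    assume "1 - r dvd 1"
    then obtain M' where M': "hom ?B ?B M'" "M' \<star> ((1 - r) *s one ?B + (- s) *s flp m) = one ?B"
      using flp_unit[OF _ c, of "1 - r" "- s"] by blast
    have "(1 - r) *s one ?B + (- s) *s flp m = one ?B - (r *s one ?B + s *s flp m)"
      by (simp add: smul_simps)
    then show ?thesis unfolding nX ars using M' by auto
  qed
qed

text \<open>The map \<open>i p\<close> is idempotent modulo null maps. By \<open>named_local\<close>
  it or its complement has a left inverse; cancelling that one makes the other null and kills the
  corresponding summand.\<close>

lemma named_indecomposable:
  assumes n: "valid_name b n" shows "indecomposable CP (named n)"
  unfolding indecomposable_def named_PO
proof (intro conjI allI impI)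
  let ?X = "nX n" and ?x = "nx n"
  have X: "pob b ?X ?x" using pob_named[OF n b_pos] .
  show "PO ?X ?x \<in> Ob CP" using X Ob_CP by blast
  show "\<not> zero_object CP (PO ?X ?x)" using zero_CP[OF X] named_not_bd[OF n] by blast
  fix A' B' assume "is_biproduct CP (PO ?X ?x) A' B'"
  then obtain A a B c i j p q where AB: "A' = PO A a" "B' = PO B c" "pob b A a" "pob b B c"
    "phom A a ?X ?x i" "phom B c ?X ?x j" "phom ?X ?x A a p" "phom ?X ?x B c q"
    and N: "NN b A A (p \<star> i - one A)" "NN b B B (q \<star> j - one B)" "NN b ?X ?X (i \<star> p + j \<star> q - one ?X)"
    using X by (rule biproduct_CP_D)
  note h = AB(5-8)[THEN phom_hom]
  \<comment> \<open>If \<open>f g\<close> is null, so is \<open>g (f g) f\<close>. This is the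
    square of \<open>g f\<close>, hence 1 modulo null maps.\<close>
  have zero: "NN b Z Z (one Z)"
    if "hom Z ?X f" "hom ?X Z g" "NN b Z Z (g \<star> f - one Z)" "NN b ?X ?X (f \<star> g)" for Z f g
  proof -
    have hgf: "hom Z Z (g \<star> f - one Z)" "hom Z Z (g \<star> f)" using that by (auto intro: hom_diff hom_cmp)
    have "NN b Z Z (g \<star> ((f \<star> g) \<star> f))" using NN_left[OF NN_right[OF that(4,1)] that(2)] .
    moreover have "NN b Z Z ((g \<star> f - one Z) \<star> (g \<star> f) + (g \<star> f - one Z))"
      using NN_add[OF NN_right[OF that(3) hgf(2)] that(3)] .
    ultimately have "NN b Z Z (g \<star> ((f \<star> g) \<star> f) - ((g \<star> f - one Z) \<star> (g \<star> f) + (g \<star> f - one Z)))" by (rule NN_diff)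
    moreover have "g \<star> ((f \<star> g) \<star> f) - ((g \<star> f - one Z) \<star> (g \<star> f) + (g \<star> f - one Z)) = one Z"
      using ones(2)[OF that(2)] by (simp add: cmps)
    ultimately show ?thesis by simp
  qed
  let ?e = "i \<star> p"
  have he: "hom ?X ?X ?e" using hom_cmp[OF h(1,3)] .
  have "NN b ?X ?X (i \<star> ((p \<star> i - one A) \<star> p))" using NN_left[OF NN_right[OF N(1) h(3)] h(1)] .
  then have ee: "NN b ?X ?X (?e \<star> ?e - ?e)" using h by (simp add: cmps ones)
  obtain a' where a': "hom ?X ?X a'" "a' \<star> ?e = one ?X \<or> a' \<star> (one ?X - ?e) = one ?X"
    using named_local[OF n phom_cmp[OF AB(5,7)]] by blast
  from a'(2) show "zero_object CP A' \<or> zero_object CP B'"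
  proof
    assume 1: "a' \<star> ?e = one ?X"
    have "a' \<star> (?e \<star> ?e - ?e) = (a' \<star> ?e) \<star> ?e - a' \<star> ?e" by (simp add: cmps)
    also have "\<dots> = ?e - one ?X" unfolding 1 using he by (simp add: ones)
    finally have "NN b ?X ?X (?e - one ?X)" using NN_left[OF ee a'(1)] by simp
    then have "NN b ?X ?X ((?e + j \<star> q - one ?X) - (?e - one ?X))" using N(3) NN_diff by blast
    then have "NN b ?X ?X (j \<star> q)" by simp
    then have "NN b B B (one B)" using zero h(2,4) N(2) by blast
    then show ?thesis using zero_CP[OF AB(4)] NN_one_bd AB(2) by blast
  next
    assume 1: "a' \<star> (one ?X - ?e) = one ?X"
    have "a' \<star> (?e \<star> ?e - ?e) = - ((a' \<star> (one ?X - ?e)) \<star> ?e)" using he by (simp add: cmps ones ones[OF h(1)])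
    also have "\<dots> = - ?e" unfolding 1 using he by (simp add: ones)
    finally have "NN b ?X ?X (- ?e)" using NN_left[OF ee a'(1)] by simp
    then have "NN b ?X ?X ?e" using NN_uminus by fastforce
    then have "NN b A A (one A)" using zero h(1,3) N(1) by blast
    then show ?thesis using zero_CP[OF AB(3)] NN_one_bd AB(1) by blast
  qed
qed

text \<open>Modulo null maps \<open>g f\<close> is 1, so its diagonal coefficient at a nonboundary
  position is a unit. A unit term in the sum over \<open>Y\<close> then exhibits an isomorphic
  orbit.\<close>

lemma stiso_summand:
  assumes "stiso X x Y y" "i < length X" "width (X ! i) \<noteq> b"
  shows "\<exists>j<length Y. cc (X ! i) (Y ! j) (X ! i) = 0"
proof -
  obtain f g where fg: "phom X x Y y f" "phom Y y X x g" "NN b X X (g \<star> f - one X)"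
    using assms(1) unfolding stiso_def by blast
  have "u dvd ent X X (g \<star> f - one X) i i" using NN_ent_dvd[OF fg(3) assms(2,3)] .
  then have "u dvd ent X X (g \<star> f) i i - 1"
    using ent_one[OF assms(2), where 'a = 'r] by (simp add: ent_def lookup_minus)
  then have "u dvd - (ent X X (g \<star> f) i i - 1)" by (simp only: dvd_minus_iff)
  then have "1 - (1 - ent X X (g \<star> f) i i) dvd 1" by (intro unit_sub) simp
  then have "(\<Sum>j<length Y. ent Y X g i j * ent X Y f j i * u ^ cc (X ! i) (Y ! j) (X ! i)) dvd 1"
    using ent_cmp[of Y X g X f u i i] phom_hom[OF fg(1)] by simp
  then obtain j where "j < length Y" "ent Y X g i j * ent X Y f j i * u ^ cc (X ! i) (Y ! j) (X ! i) dvd 1"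
    using nonunit_sum[of "{..<length Y}" "\<lambda>j. ent Y X g i j * ent X Y f j i * u ^ cc (X ! i) (Y ! j) (X ! i)"] by auto
  then show ?thesis using unit_mult unit_u_power by blast
qed

lemma stiso_named_coord:
  assumes "valid_name b n" "valid_name b n'" "stiso (nX n) (nx n) (nX n') (nx n')"
    "name_coord n = (x, y)" "name_coord n' = (x', y')"
  shows "\<exists>k::int. (x = x' + of_int k * pi \<and> y = y' + of_int k * pi) \<or> (x = y' + of_int k * pi \<and> y = x' + of_int k * pi)"
proof -
  have 0: "nX n ! 0 = obj_M x y" "0 < length (nX n)" using assms(4) by (cases n; auto)+
  have "width (nX n ! 0) \<noteq> b" using assms(1,4) b_pos unfolding 0 by (cases n) auto
  then obtain j where j: "j < length (nX n')" "cc (obj_M x y) (nX n' ! j) (obj_M x y) = 0"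
    using stiso_summand[OF assms(3) 0(2)] unfolding 0 by blast
  have "nX n' ! j = obj_M x' y' \<or> nX n' ! j = obj_M (x' + pi) (y' + pi)"
    using j(1) assms(5) by (cases n') (auto simp: less_Suc_eq psi_orbit_M)
  then show ?thesis
  proof
    assume "nX n' ! j = obj_M x' y'"
    then show ?thesis using j(2) cc_zero_translate by simp
  next
    assume "nX n' ! j = obj_M (x' + pi) (y' + pi)"
    then obtain k :: int where "(x = x' + pi + of_int k * pi \<and> y = y' + pi + of_int k * pi) \<or>
        (x = y' + pi + of_int k * pi \<and> y = x' + pi + of_int k * pi)"
      using j(2) cc_zero_translate[of x y "x' + pi" "y' + pi"] by auto
    then show ?thesis by (intro exI[of _ "k + 1"]) (simp add: algebra_simps)
  qed
qed

text \<open>For different signs, equivariance of \<open>f\<close> reads \<open>2 r = 0\<close>. Then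
  \<open>f = 0\<close> and the identity would be null, although \<open>[obj_M x x]\<close> is not a
  boundary list.\<close>

lemma stiso_Singular_sign:
  assumes "stiso (nX (Singular e x)) (nx (Singular e x)) (nX (Singular e' x')) (nx (Singular e' x'))"
    "x = x' + of_int k * pi"
  shows "e = e'"
proof (rule ccontr)
  assume e: "e \<noteq> e'"
  let ?m = "obj_M x x" and ?n = "obj_M x' x'"
  obtain f g where fg: "phom [?m] (sign_val e *s bas (psi_orbit ?m) ?m) [?n] (sign_val e' *s bas (psi_orbit ?n) ?n) f"
    "NN b [?m] [?m] (g \<star> f - one [?m])"
    using assms(1) unfolding stiso_def by auto
  obtain r where r: "f = r *s bas ?m ?n" using phom_hom[OF fg(1)] by (auto simp: hom_single_iff)
  have "(r * sign_val e) *s bas (psi_orbit ?m) ?n = (r * sign_val e') *s bas (psi_orbit ?m) ?n"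
    using phom_eq(1)[OF fg(1)]
    by (simp add: r cmps bas_cmp smul_simps cc_iso_left[OF cc_diag(2)] cc_iso_right[OF cc_diag(2)] mult.commute)
  then have "r * sign_val e = r * sign_val e'" by (simp only: smul_bas_eq_iff)
  then have "r * 2 = 0" using e by (cases e; cases e') (auto simp: algebra_simps)
  moreover have "(2::'r) \<noteq> 0" using half by (metis mult_zero_left zero_neq_one)
  ultimately have "f = 0" by (simp add: r smul_simps)
  then have "NN b [?m] [?m] (one [?m])" using NN_uminus[OF fg(2)] by (simp add: fm_cmp_zero)
  then have "bd b [?m]" by (rule NN_one_bd)
  then show False using b_pos by (simp add: bd_def)
qed

text \<open>This provides the uniqueness behind \<open>THE\<close> in \<open>h_map\<close>.
  Coordinates of isomorphic names differ by a translation, possibly with an exchange, which the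
  ordering chosen in \<open>name_point\<close> absorbs.\<close>

lemma stiso_named_H_class:
  assumes "b \<le> pi" "valid_name b n" "valid_name b n'" "stiso (nX n) (nx n) (nX n') (nx n')"
  shows "H_class (name_point n) = H_class (name_point n')"
proof -
  obtain x y where c: "name_coord n = (x, y)" by fastforce
  obtain x' y' where c': "name_coord n' = (x', y')" by fastforce
  obtain k :: int where k: "(x = x' + of_int k * pi \<and> y = y' + of_int k * pi) \<or> (x = y' + of_int k * pi \<and> y = x' + of_int k * pi)"
    using stiso_named_coord[OF assms(2-4) c c'] by blast
  have "valid_name pi n'" using assms(1,3) by (cases n') auto
  then have H: "name_point n' \<in> H_tilde" by (rule name_point_H_tilde)
  define K where "K = of_int k * pi"
  have tr: "H_class (X + K, Y + K, e) = H_class (X, Y, e)" if "(X, Y, e) \<in> H_tilde" for X Y e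
    using H_class_translate[OF that] by (simp add: K_def)
  show ?thesis
  proof (cases n)
    case (Regular a1 a2)
    then have a: "a1 = x" "a2 = y" "x \<noteq> y" using c assms(2) by auto
    show ?thesis
    proof (cases n')
      case R': (Regular b1 b2)
      then have b': "b1 = x'" "b2 = y'" "x' \<noteq> y'" using c' assms(3) by auto
      have "name_point n = (fst (name_point n') + K, fst (snd (name_point n')) + K, snd (snd (name_point n')))"
        using k a(3) b'(3) unfolding Regular R' a(1,2) b'(1,2) K_def[symmetric] by auto
      then show ?thesis using tr H by (metis prod.collapse)
    next
      case (Singular e s)
      then have "x' = y'" using c' by simp
      then show ?thesis using k a(3) by auto
    qed
  next
    case (Singular e s)
    then have a: "x = y" "s = x" using c by auto
    show ?thesis
    proof (cases n')
      case (Regular b1 b2)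
      then have "x' \<noteq> y'" using c' assms(3) by auto
      then show ?thesis using k a by auto
    next
      case S': (Singular e' s')
      then have b': "x' = y'" "s' = x'" using c' by auto
      have xK: "x = x' + K" using k b' unfolding K_def by auto
      have "e = e'" using stiso_Singular_sign[of e x e' x' k] assms(4) xK unfolding Singular S' a b' K_def by simp
      then show ?thesis using tr[of x' "x' + pi" e] H xK unfolding Singular S' a(2) b'(2)
        by (simp add: algebra_simps)
    qed
  qed
qed

end


section \<open>Crossing in \<open>H\<close>\<close>

text \<open>The limit of \<open>cross_at\<close> as \<open>b\<close> tends to \<open>pi\<close> from
  below: \<open>a1 <= y + b + k pi\<close> for some \<open>b < pi\<close> means
  \<open>a1 < y + pi + k pi\<close>, and likewise for \<open>a2\<close>.\<close>

definition strict_at :: "real \<Rightarrow> real \<Rightarrow> real \<Rightarrow> real \<Rightarrow> int \<Rightarrow> bool" where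
  "strict_at a1 a2 x y k \<longleftrightarrow> x + of_int k * pi < a1 \<and> a1 < y + pi + of_int k * pi \<and>
     y + of_int k * pi < a2 \<and> a2 < x + pi + of_int k * pi"

fun strict_crossing :: "real \<times> real \<Rightarrow> real \<times> real \<Rightarrow> bool" where
  "strict_crossing (a1, a2) (x, y) \<longleftrightarrow> (\<exists>k. strict_at a1 a2 x y k \<or> strict_at a1 a2 y x k)"

lemma crossing_imp_strict: "b < pi \<Longrightarrow> crossing b p q \<Longrightarrow> strict_crossing p q"
  by (cases p; cases q) (force simp: cross_at_def strict_at_def)

lemma eventually_cross_at:
  assumes "strict_at a1 a2 x y k" shows "\<forall>\<^sub>F b in at_left pi. cross_at b a1 a2 x y k"
proof -
  define c where "c = max (a1 - y - of_int k * pi) (a2 - x - of_int k * pi)"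
  have "c < pi" using assms by (auto simp: c_def strict_at_def)
  then have "\<forall>\<^sub>F b in at_left pi. c < b" using eventually_at_left_field by (metis (no_types, lifting))
  then show ?thesis
    by (rule eventually_mono) (use assms in \<open>auto simp: c_def strict_at_def cross_at_def\<close>)
qed

lemma eventually_crossing: "strict_crossing p q \<Longrightarrow> \<forall>\<^sub>F b in at_left pi. crossing b p q"
proof -
  obtain a1 a2 x y where pq: "p = (a1, a2)" "q = (x, y)" by fastforce
  assume "strict_crossing p q"
  then obtain k where "strict_at a1 a2 x y k \<or> strict_at a1 a2 y x k" by (auto simp: pq)
  then show ?thesis
  proof
    assume "strict_at a1 a2 x y k"
    from eventually_cross_at[OF this] show ?thesis by (rule eventually_mono) (auto simp: pq)
  next
    assume "strict_at a1 a2 y x k"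
    from eventually_cross_at[OF this] show ?thesis by (rule eventually_mono) (auto simp: pq)
  qed
qed

lemma strict_at_swap: "strict_at a1 a2 x y k \<longleftrightarrow> strict_at a2 a1 y x k"
  by (auto simp: strict_at_def)

text \<open>Moving multiples of \<open>pi\<close> to the other side exchanges upper and lower bounds
  and replaces \<open>k\<close> by \<open>- k - 1\<close>. So crossing is symmetric in the limit,
  although \<open>crossing b\<close> is not for fixed \<open>b < pi\<close>.\<close>

lemma strict_at_sym: "strict_at a1 a2 x y k \<longleftrightarrow> strict_at y x a1 a2 (- k - 1)"
  by (auto simp: strict_at_def algebra_simps)

lemma strict_crossing_swap: "strict_crossing (a1, a2) q \<longleftrightarrow> strict_crossing (a2, a1) q"
  "strict_crossing p (x, y) \<longleftrightarrow> strict_crossing p (y, x)"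
  using strict_at_swap by (cases q; cases p; auto)+

lemma strict_crossing_sym: "strict_crossing p q \<longleftrightarrow> strict_crossing q p"
proof -
  have *: "strict_crossing q p" if sc: "strict_crossing p q" for p q
  proof -
    obtain a1 a2 x y where pq: "p = (a1, a2)" "q = (x, y)" by fastforce
    then obtain k where "strict_at a1 a2 x y k \<or> strict_at a1 a2 y x k" using sc by auto
    then show ?thesis using strict_at_sym strict_at_swap unfolding pq strict_crossing.simps by blast
  qed
  then show ?thesis by blast
qed

text \<open>The second coordinates are moved by \<open>\<pi>\<close> because \<open>[x, y]\<close> is the image of
  \<open>SE(x, y) = SM(x, y - \<pi>)\<close>.\<close>

fun point_cross :: "point \<Rightarrow> point \<Rightarrow> bool" where
  "point_cross (x, y, e) (x', y', e') \<longleftrightarrow>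
     strict_crossing (x, y - pi) (x', y' - pi) \<and> \<not> (y = x + pi \<and> y' = x' + pi \<and> e = e')"

lemma point_cross_sym: "point_cross p q \<longleftrightarrow> point_cross q p"
  by (cases p; cases q) (auto simp: strict_crossing_sym)

text \<open>For a point paired with itself, a lower bound fails if \<open>k >= 0\<close> and an
  upper bound fails if \<open>k <= -1\<close>. Points with \<open>y = x + pi\<close> are excluded by
  equality of signs.\<close>

lemma point_cross_irrefl: assumes "p \<in> H_tilde" shows "\<not> point_cross p p"
proof
  assume c: "point_cross p p"
  obtain x y e where p: "p = (x, y, e)" by (cases p)
  then have y: "y \<le> x + pi" "y \<noteq> x + pi" using assms c by (auto simp: H_tilde_def)
  obtain k where k: "strict_at x (y - pi) x (y - pi) k \<or> strict_at x (y - pi) (y - pi) x k"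
    using c p by auto
  show False
  proof (cases "0 \<le> k")
    case True
    then have "0 \<le> of_int k * pi" by simp
    then show False using k y by (auto simp: strict_at_def)
  next
    case False
    then have "of_int k \<le> (- 1 :: real)" by linarith
    then have "of_int k * pi \<le> - 1 * pi" by (rule mult_right_mono) simp
    then show False using k y by (auto simp: strict_at_def)
  qed
qed

lemma strict_at_translate: "strict_at (a1 + pi) (a2 + pi) x y k \<longleftrightarrow> strict_at a1 a2 x y (k - 1)"
  by (auto simp: strict_at_def algebra_simps)

lemma strict_crossing_translate: "strict_crossing (a1 + pi, a2 + pi) q \<longleftrightarrow> strict_crossing (a1, a2) q"
proof (cases q)
  case (Pair x y)
  have "(\<exists>k. strict_at a1 a2 x y (k - 1) \<or> strict_at a1 a2 y x (k - 1)) \<longleftrightarrow>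
      (\<exists>k. strict_at a1 a2 x y k \<or> strict_at a1 a2 y x k)"
    by (metis add_diff_cancel_right')
  then show ?thesis by (simp add: Pair strict_at_translate)
qed

text \<open>Signs matter only at \<open>y = x + pi\<close>, where points of different sign are not
  identified; translations are absorbed by \<open>k\<close>.\<close>

lemma point_cross_H_gen: "H_gen p p' \<Longrightarrow> point_cross p q \<longleftrightarrow> point_cross p' q"
proof (induction rule: H_gen.induct)
  case (1 x y)
  then show ?case by (cases q) auto
next
  case (2 x y e)
  have "(x + pi, y + pi - pi) = (x + pi, (y - pi) + pi)" by simp
  then have "strict_crossing (x + pi, y + pi - pi) r \<longleftrightarrow> strict_crossing (x, y - pi) r" for r
    using strict_crossing_translate by metis
  moreover obtain x' y' e' where "q = (x', y', e')" by (cases q)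
  ultimately show ?case unfolding point_cross.simps by (simp only: point_cross.simps) auto
qed

lemma point_cross_H_class:
  assumes "H_class p = H_class p'" shows "point_cross p q \<longleftrightarrow> point_cross p' q"
proof -
  have "equivclp H_gen p p'" using assms H_class_eq_iff by blast
  then show ?thesis
    by (induction rule: equivclp_induct) (use point_cross_H_gen in blast)+
qed

lemma open_strict_crossing: "open {p. strict_crossing (fst p, snd p - pi) q}"
proof (cases q)
  case (Pair x y)
  have eq: "{p. strict_crossing (fst p, snd p - pi) q} =
      (\<Union>k. {p. strict_at (fst p) (snd p - pi) x y k} \<union> {p. strict_at (fst p) (snd p - pi) y x k})"
    by (auto simp: Pair)
  have op: "open {p :: real \<times> real. strict_at (fst p) (snd p - pi) x y k}" for x y k
    unfolding strict_at_def by (intro open_Collect_conj open_Collect_less continuous_intros)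
  show ?thesis unfolding eq by (intro open_UN ballI open_Un op)
qed

text \<open>Strict inequalities are open. Signs are discrete, so there are neighbourhoods of fixed
  sign, and on these the exception for equal signs removes at most the closed line
  \<open>y = x + pi\<close>.\<close>

lemma openin_point_cross: "openin H_tilde_topology {p \<in> H_tilde. point_cross p q}"
proof -
  obtain x' y' e' where q: "q = (x', y', e')" by (cases q)
  let ?T = "{p. point_cross p q}"
  have T: "openin (prod_topology euclidean (prod_topology euclidean (discrete_topology UNIV))) ?T"
  proof (rule openin_prod_topology_alt[THEN iffD2], intro allI impI)
    fix x :: real and ye :: "real \<times> sign"
    assume "(x, ye) \<in> ?T"
    moreover obtain y e where ye: "ye = (y, e)" by (cases ye)
    ultimately have c: "point_cross (x, y, e) q" by simp
    define S where "S = {p. strict_crossing (fst p, snd p - pi) (x', y' - pi)} \<inter>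
      (if y' = x' + pi \<and> e = e' then {p. snd p \<noteq> fst p + pi} else UNIV)"
    have "open {p :: real \<times> real. snd p \<noteq> fst p + pi}"
      by (intro open_Collect_neq continuous_intros)
    then have "open S" unfolding S_def using open_strict_crossing by (intro open_Int) auto
    moreover have "(x, y) \<in> S" using c by (auto simp: S_def q)
    ultimately obtain A B where AB: "open A" "open B" "(x, y) \<in> A \<times> B" "A \<times> B \<subseteq> S"
      by (rule open_prod_elim)
    have "openin (prod_topology euclidean (discrete_topology UNIV)) (B \<times> {e})"
      using AB(2) by (simp add: openin_prod_Times_iff)
    moreover have "A \<times> (B \<times> {e}) \<subseteq> ?T"
    proof
      fix r assume "r \<in> A \<times> (B \<times> {e})"
      then obtain a c where r: "r = (a, c, e)" "(a, c) \<in> A \<times> B" by auto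
      then have "(a, c) \<in> S" using AB(4) by blast
      then show "r \<in> ?T" by (auto simp: r S_def q split: if_splits)
    qed
    ultimately show "\<exists>U V. openin euclidean U \<and> openin (prod_topology euclidean (discrete_topology UNIV)) V \<and>
        x \<in> U \<and> ye \<in> V \<and> U \<times> V \<subseteq> ?T"
      using AB ye by (intro exI[of _ A] exI[of _ "B \<times> {e}"]) auto
  qed
  have e: "{p \<in> H_tilde. point_cross p q} = ?T \<inter> H_tilde"
    by (simp only: Collect_conj_eq Collect_mem_eq Int_commute)
  show ?thesis
    unfolding H_tilde_topology_def e by (rule openin_subtopology_Int[OF T])
qed

text \<open>The points that cross \<open>q\<close> form a union of classes, so this set is the full
  preimage of its image and the quotient topology applies.\<close>

lemma openin_H_crossing: "openin H_topology (H_class ` {p \<in> H_tilde. point_cross p q})"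
proof -
  let ?U = "{p \<in> H_tilde. point_cross p q}"
  have "point_cross p q" if "H_class p \<in> H_class ` ?U" for p
    using that point_cross_H_class by blast
  then have "{p \<in> H_tilde. H_class p \<in> H_class ` ?U} = ?U" by blast
  then have "openin H_tilde_topology {p \<in> H_tilde. H_class p \<in> H_class ` ?U}"
    using openin_point_cross[of q] by (simp only:)
  moreover have "H_class ` ?U \<subseteq> H_space" unfolding H_space_def by blast
  ultimately show ?thesis unfolding openin_H_topology by blast
qed

lemma strict_crossing_name:
  assumes "name_point n = (x, y, e)"
  shows "strict_crossing (x, y - pi) q \<longleftrightarrow> strict_crossing (name_coord n) q"
    "strict_crossing q (x, y - pi) \<longleftrightarrow> strict_crossing q (name_coord n)"
  using assms strict_crossing_swap by (cases n; auto split: if_splits)+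

lemma point_cross_name:
  assumes "valid_name pi m" "valid_name pi n"
  shows "point_cross (name_point m) (name_point n) \<longleftrightarrow>
    strict_crossing (name_coord m) (name_coord n) \<and> \<not> same_sign m n"
proof -
  obtain x y e x' y' e' where p: "name_point m = (x, y, e)" "name_point n = (x', y', e')"
    by (metis prod_cases3)
  have "(y = x + pi \<and> y' = x' + pi \<and> e = e') \<longleftrightarrow> same_sign m n"
    using p assms by (cases m; cases n) (auto split: if_splits)
  then show ?thesis unfolding p point_cross.simps
    using strict_crossing_name(1)[OF p(1)] strict_crossing_name(2)[OF p(2)] by simp
qed

lemma same_sign_sym: "same_sign m n \<longleftrightarrow> same_sign n m"
  by (cases m; cases n) auto

text \<open>This is surjectivity of \<open>h\<close>. Away from \<open>y = x + pi\<close> both signs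
  give the same class, so the \<open>Plus\<close> representatives of regular names suffice.\<close>

lemma H_space_named: "c \<in> H_space \<Longrightarrow> \<exists>n. valid_name pi n \<and> H_class (name_point n) = c"
proof -
  assume "c \<in> H_space"
  then obtain x y e where p: "c = H_class (x, y, e)" "(x, y, e) \<in> H_tilde" unfolding H_space_def by auto
  show ?thesis
  proof (cases "y = x + pi")
    case True
    then show ?thesis using p(1) by (intro exI[of _ "Singular e x"]) simp
  next
    case False
    then have y: "x < y" "y < x + pi" using p(2) by (auto simp: H_tilde_def)
    have "(x, y, Plus) \<in> H_tilde" using y by (simp add: H_tilde_def)
    then have "H_class (x, y, Plus) = H_class (x, y, Minus)"
      using H_gen.intros(1) y(2) H_class_eq_iff by (metis r_into_equivclp)
    then have "H_class (x, y, Plus) = c" using p(1) by (cases e) auto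
    then show ?thesis using y by (intro exI[of _ "Regular x (y - pi)"]) auto
  qed
qed

lemma eventually_valid_name: "valid_name pi n \<Longrightarrow> \<forall>\<^sub>F b in at_left pi. valid_name b n"
proof (cases n)
  case (Regular x y)
  assume "valid_name pi n"
  then have "\<bar>x - y\<bar> < pi" "0 < \<bar>x - y\<bar>" using Regular by auto
  then have "\<forall>\<^sub>F b in at_left pi. \<bar>x - y\<bar> < b" using eventually_at_left_field by (metis (no_types, lifting))
  then show ?thesis by (rule eventually_mono) (use \<open>0 < \<bar>x - y\<bar>\<close> Regular in auto)
qed simp

section \<open>Laminations for the family of exact structures\<close>

locale frob_family = dvr u for u :: "'r::idom" +
  fixes E :: "real \<Rightarrow> ('r farrow \<times> 'r farrow) set"
  assumes E: "\<And>b. 0 < b \<Longrightarrow> b \<le> pi \<Longrightarrow> F_exact_structure u b (E b)"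
begin

lemma frob: "0 < b \<Longrightarrow> b \<le> pi \<Longrightarrow> frob u b (E b)"
  by (intro frob.intro frob_axioms.intro dvr_axioms E)

sublocale P: frob u pi "E pi" by (rule frob) simp_all

lemma compatible_named:
  assumes "0 < b" "b < pi" "valid_name b m" "valid_name b n"
  shows "compatible u b (E b) (named m) (named n) \<longleftrightarrow>
    (\<not> crossing b (name_coord m) (name_coord n) \<and> \<not> crossing b (name_coord n) (name_coord m)) \<or> same_sign m n"
proof -
  interpret B: frob u b "E b" using assms by (intro frob) auto
  show ?thesis unfolding compatible_def
    using B.Ext1_named[OF assms(2-4)] B.Ext1_named[OF assms(2,4,3)] same_sign_sym by blast
qed

text \<open>Crossing at some \<open>b < pi\<close> implies strict crossing, and strict crossing
  implies crossing at all \<open>b\<close> near \<open>pi\<close>. A crossing pair cannot be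
  eventually compatible as well, since the filter \<open>at_left pi\<close> is nontrivial.\<close>

lemma eventually_compatible_iff:
  assumes "valid_name pi m" "valid_name pi n"
  shows "(\<forall>\<^sub>F b in at_left pi. compatible u b (E b) (named m) (named n)) \<longleftrightarrow>
    \<not> point_cross (name_point m) (name_point n)"
proof -
  have "\<forall>\<^sub>F b in at_left pi. 0 < b \<and> b < pi"
    using eventually_at_left_field[of "\<lambda>b. 0 < b \<and> b < pi" pi] pi_gt_zero by blast
  then have ev: "\<forall>\<^sub>F b in at_left pi. (0 < b \<and> b < pi) \<and> valid_name b m \<and> valid_name b n"
    using eventually_valid_name[OF assms(1)] eventually_valid_name[OF assms(2)]
    by (simp only: eventually_conj_iff simp_thms)
  show ?thesis
  proof
    assume nc: "\<not> point_cross (name_point m) (name_point n)"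
    show "\<forall>\<^sub>F b in at_left pi. compatible u b (E b) (named m) (named n)"
      using ev
    proof (rule eventually_mono)
      fix b assume b: "(0 < b \<and> b < pi) \<and> valid_name b m \<and> valid_name b n"
      then show "compatible u b (E b) (named m) (named n)"
        using nc crossing_imp_strict[of b] strict_crossing_sym
        unfolding point_cross_name[OF assms] by (simp add: compatible_named) blast
    qed
  next
    assume c: "\<forall>\<^sub>F b in at_left pi. compatible u b (E b) (named m) (named n)"
    show "\<not> point_cross (name_point m) (name_point n)"
    proof
      assume "point_cross (name_point m) (name_point n)"
      then have s: "strict_crossing (name_coord m) (name_coord n)" "\<not> same_sign m n"
        using point_cross_name[OF assms] by auto
      have "\<forall>\<^sub>F b in at_left pi. False"
        using c ev eventually_crossing[OF s(1)]
      proof eventually_elim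
        case (elim b)
        then show ?case using compatible_named[of b m n] s(2) by blast
      qed
      then show False by simp
    qed
  qed
qed

lemma isomorphic_named:
  assumes "pob pi X x" "valid_name pi n"
  shows "isomorphic (C_psi u pi (E pi)) (PO X x) (named n) \<longleftrightarrow> P.stiso X x (nX n) (nx n)"
  unfolding named_PO using P.isomorphic_CP[OF assms(1) pob_named[OF assms(2) pi_gt_zero]] .

text \<open>The name \<open>n\<close> itself satisfies one clause of the definition. Any clause
  satisfied by another point produces a further name of the same object, which has the same
  class.\<close>

lemma h_map_named:
  assumes X: "pob pi X x" and n: "valid_name pi n" "P.stiso X x (nX n) (nx n)"
  shows "h_map u (E pi) (PO X x) = H_class (name_point n)"
  unfolding h_map_def
proof (rule the_equality)
  have iso: "isomorphic (C_psi u pi (E pi)) (PO X x) (named n)" using isomorphic_named[OF X n(1)] n(2) by blast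
  show "(\<exists>a b. a < b \<and> b < a + pi \<and> isomorphic (C_psi u pi (E pi)) (PO X x) (obj_S [obj_E a b]) \<and>
        H_class (name_point n) = H_class (a, b, Plus)) \<or>
     (\<exists>a b. a + pi < b \<and> b < a + 2 * pi \<and> isomorphic (C_psi u pi (E pi)) (PO X x) (obj_S [obj_E a b]) \<and>
        H_class (name_point n) = H_class (b, a + 2 * pi, Plus)) \<or>
     (\<exists>\<epsilon> a. isomorphic (C_psi u pi (E pi)) (PO X x) (obj_Z \<epsilon> a) \<and> H_class (name_point n) = H_class (a, a + pi, \<epsilon>))"
    (is "?A \<or> ?B \<or> ?C")
  proof (cases n)
    case (Regular a b)
    show ?thesis
    proof (cases "b < a")
      case True
      have ?A
        by (rule exI[of _ a], rule exI[of _ "b + pi"])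
          (use True n(1) iso Regular in \<open>auto simp: obj_E_def\<close>)
      then show ?thesis ..
    next
      case False
      then have ab: "a < b" "b < a + pi" using n(1) Regular by auto
      have "(b, a + pi, Plus) \<in> H_tilde" using ab by (simp add: H_tilde_def)
      from H_class_translate[OF this, of 1] have "H_class (name_point n) = H_class (b + pi, a + 2 * pi, Plus)"
        using ab by (simp add: Regular algebra_simps)
      note H = this
      have ?B
        by (rule exI[of _ a], rule exI[of _ "b + pi"]) (use ab iso H Regular in \<open>auto simp: obj_E_def\<close>)
      then show ?thesis by blast
    qed
  next
    case (Singular e a)
    then have ?C using iso by (intro exI[of _ e] exI[of _ a]) simp
    then show ?thesis by blast
  qed
next
  fix p
  have uniq: "H_class (name_point n') = H_class (name_point n)"
    if "valid_name pi n'" "isomorphic (C_psi u pi (E pi)) (PO X x) (named n')" for n'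
  proof -
    have "P.stiso X x (nX n') (nx n')" using isomorphic_named[OF X that(1)] that(2) by blast
    then have "P.stiso (nX n') (nx n') (nX n) (nx n)" using P.stiso_trans[OF P.stiso_sym n(2)] by blast
    then show ?thesis using P.stiso_named_H_class[OF _ that(1) n(1)] by simp
  qed
  assume "(\<exists>a b. a < b \<and> b < a + pi \<and> isomorphic (C_psi u pi (E pi)) (PO X x) (obj_S [obj_E a b]) \<and>
        p = H_class (a, b, Plus)) \<or>
     (\<exists>a b. a + pi < b \<and> b < a + 2 * pi \<and> isomorphic (C_psi u pi (E pi)) (PO X x) (obj_S [obj_E a b]) \<and>
        p = H_class (b, a + 2 * pi, Plus)) \<or>
     (\<exists>\<epsilon> a. isomorphic (C_psi u pi (E pi)) (PO X x) (obj_Z \<epsilon> a) \<and> p = H_class (a, a + pi, \<epsilon>))"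
  then consider (A) a b where "a < b" "b < a + pi" "isomorphic (C_psi u pi (E pi)) (PO X x) (obj_S [obj_E a b])"
      "p = H_class (a, b, Plus)"
    | (B) a b where "a + pi < b" "b < a + 2 * pi" "isomorphic (C_psi u pi (E pi)) (PO X x) (obj_S [obj_E a b])"
      "p = H_class (b, a + 2 * pi, Plus)"
    | (C) e a where "isomorphic (C_psi u pi (E pi)) (PO X x) (obj_Z e a)" "p = H_class (a, a + pi, e)"
    by blast
  then show "p = H_class (name_point n)"
  proof cases
    case A
    then show ?thesis using uniq[of "Regular a (b - pi)"] by (simp add: obj_E_def)
  next
    case B
    have "(b - pi, a + pi, Plus) \<in> H_tilde" using B by (simp add: H_tilde_def)
    from H_class_translate[OF this, of 1] have "H_class (b - pi, a + pi, Plus) = p"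
      using B(4) by (simp add: algebra_simps)
    then show ?thesis using B uniq[of "Regular a (b - pi)"] by (simp add: obj_E_def)
  next
    case C
    then show ?thesis using uniq[of "Singular e a"] by simp
  qed
qed

lemma indecomposable_named:
  assumes "indecomposable (C_psi u pi (E pi)) A"
  obtains X x n where "A = PO X x" "pob pi X x" "valid_name pi n" "P.stiso X x (nX n) (nx n)"
proof -
  have "A \<in> Ob (C_psi u pi (E pi))" using assms unfolding indecomposable_def by blast
  then obtain X x where "A = PO X x" "pob pi X x" using P.Ob_CP by blast
  then show ?thesis using that P.stable_classification assms by blast
qed

lemma named_self: "valid_name pi n \<Longrightarrow> P.stiso (nX n) (nx n) (nX n) (nx n)"
  using P.stiso_refl[OF pob_named[OF _ pi_gt_zero]] .

lemma h_map_named_self: "valid_name pi n \<Longrightarrow> h_map u (E pi) (named n) = H_class (name_point n)"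
  unfolding named_PO using h_map_named[OF pob_named[OF _ pi_gt_zero]] named_self by blast

text \<open>\<open>compatible_pi\<close> asks only for some pair of names. All names of an object
  have the same class and \<open>point_cross\<close> respects classes, so the choice does not
  matter.\<close>

lemma compatible_pi_H_class:
  assumes X: "pob pi X x" "valid_name pi m" "P.stiso X x (nX m) (nx m)"
    and Y: "pob pi Y y" "valid_name pi n" "P.stiso Y y (nX n) (nx n)"
  shows "compatible_pi u E (PO X x) (PO Y y) \<longleftrightarrow> \<not> point_cross (name_point m) (name_point n)"
proof
  assume "\<not> point_cross (name_point m) (name_point n)"
  then show "compatible_pi u E (PO X x) (PO Y y)"
    unfolding compatible_pi_def
    using isomorphic_named[OF X(1,2)] isomorphic_named[OF Y(1,2)] eventually_compatible_iff[OF X(2) Y(2)] X Y by blast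
next
  assume "compatible_pi u E (PO X x) (PO Y y)"
  then obtain m' n' where mn: "valid_name pi m'" "valid_name pi n'"
    "isomorphic (C_psi u pi (E pi)) (PO X x) (named m')" "isomorphic (C_psi u pi (E pi)) (PO Y y) (named n')"
    "\<forall>\<^sub>F b in at_left pi. compatible u b (E b) (named m') (named n')"
    unfolding compatible_pi_def by blast
  have "H_class (name_point m') = H_class (name_point m)"
    using h_map_named[OF X] h_map_named[OF X(1) mn(1)] isomorphic_named[OF X(1) mn(1)] mn(3) by simp
  moreover have "H_class (name_point n') = H_class (name_point n)"
    using h_map_named[OF Y] h_map_named[OF Y(1) mn(2)] isomorphic_named[OF Y(1) mn(2)] mn(4) by simp
  moreover have "\<not> point_cross (name_point m') (name_point n')"
    using eventually_compatible_iff[OF mn(1,2)] mn(5) by blast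
  ultimately show "\<not> point_cross (name_point m) (name_point n)"
    using point_cross_H_class point_cross_sym by metis
qed

lemma isomorphic_h_map:
  assumes "indecomposable (C_psi u pi (E pi)) A" "indecomposable (C_psi u pi (E pi)) B"
    "isomorphic (C_psi u pi (E pi)) A B"
  shows "h_map u (E pi) A = h_map u (E pi) B"
proof -
  obtain X x m where A: "A = PO X x" "pob pi X x" "valid_name pi m" "P.stiso X x (nX m) (nx m)"
    using assms(1) by (rule indecomposable_named)
  obtain Y y n where B: "B = PO Y y" "pob pi Y y" "valid_name pi n" "P.stiso Y y (nX n) (nx n)"
    using assms(2) by (rule indecomposable_named)
  have "P.stiso X x Y y" using assms(3) P.isomorphic_CP[OF A(2) B(2)] A(1) B(1) by simp
  then have "P.stiso X x (nX n) (nx n)" using P.stiso_trans B(4) by blast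
  then show ?thesis using h_map_named[OF A(2) B(3)] h_map_named[OF B(2-4)] A(1) B(1) by simp
qed

lemma closed_lamination:
  assumes L: "lamination u E L"
  shows "closedin H_topology (h_map u (E pi) ` L)"
proof -
  have pw: "pairwise_compatible u E L" and
    max: "\<And>L'. pairwise_compatible u E L' \<Longrightarrow> L \<subseteq> L' \<Longrightarrow> L' = L"
    using L unfolding lamination_def by blast+
  have ind: "indecomposable (C_psi u pi (E pi)) A" if "A \<in> L" for A
    using pw that unfolding pairwise_compatible_def by blast
  have sub: "h_map u (E pi) ` L \<subseteq> H_space"
  proof
    fix c assume "c \<in> h_map u (E pi) ` L"
    then obtain A where A: "A \<in> L" "c = h_map u (E pi) A" by blast
    obtain X x n where "A = PO X x" "pob pi X x" "valid_name pi n" "P.stiso X x (nX n) (nx n)"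
      using ind[OF A(1)] by (rule indecomposable_named)
    then show "c \<in> H_space" using h_map_named name_point_H_tilde by (simp add: A(2) H_space_def)
  qed
  have "\<exists>T. openin H_topology T \<and> c \<in> T \<and> T \<subseteq> H_space - h_map u (E pi) ` L"
    if c: "c \<in> H_space - h_map u (E pi) ` L" for c
  proof -
    obtain n where n: "valid_name pi n" "H_class (name_point n) = c" using H_space_named c by blast
    have hn: "h_map u (E pi) (named n) = c" using h_map_named_self n by simp
    have indn: "indecomposable (C_psi u pi (E pi)) (named n)" using P.named_indecomposable[OF n(1)] .
    note pn = pob_named[OF n(1) pi_gt_zero]
    \<comment> \<open>Equal or isomorphic indecomposables have equal images under \<open>h\<close>,
      while \<open>c\<close> lies outside the image of \<open>L\<close>. So only an incompatibility
      can prevent \<open>L\<close> from being enlarged by the named object.\<close>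
    have "named n \<notin> L" using c hn by blast
    then have "\<not> pairwise_compatible u E (insert (named n) L)" using max by blast
    moreover have "\<not> isomorphic (C_psi u pi (E pi)) (named n) A \<and> \<not> isomorphic (C_psi u pi (E pi)) A (named n)" if "A \<in> L" for A
      using isomorphic_h_map[OF indn ind[OF that]] isomorphic_h_map[OF ind[OF that] indn] that c hn by auto
    ultimately obtain A where A: "A \<in> L" "\<not> compatible_pi u E (named n) A \<or> \<not> compatible_pi u E A (named n)"
      using pw indn unfolding pairwise_compatible_def by (metis insert_iff)
    obtain X x m where X: "A = PO X x" "pob pi X x" "valid_name pi m" "P.stiso X x (nX m) (nx m)"
      using ind[OF A(1)] by (rule indecomposable_named)
    have cr: "point_cross (name_point n) (name_point m)"
      using A(2) compatible_pi_H_class[OF X(2-4) pn n(1) named_self[OF n(1)]]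
        compatible_pi_H_class[OF pn n(1) named_self[OF n(1)] X(2-4)] point_cross_sym
      unfolding X(1) named_PO by blast
    let ?T = "H_class ` {p \<in> H_tilde. point_cross p (name_point m)}"
    have "c \<in> ?T" using cr n name_point_H_tilde by blast
    moreover have "d \<notin> ?T" if d: "d \<in> h_map u (E pi) ` L" for d
    proof
      assume "d \<in> ?T"
      then obtain p where p: "d = H_class p" "point_cross p (name_point m)" by blast
      obtain B where B: "B \<in> L" "d = h_map u (E pi) B" using d by blast
      obtain Y y k where Y: "B = PO Y y" "pob pi Y y" "valid_name pi k" "P.stiso Y y (nX k) (nx k)"
        using ind[OF B(1)] by (rule indecomposable_named)
      have "H_class (name_point k) = H_class p" using h_map_named[OF Y(2-4)] B(2) Y(1) p(1) by simp
      then have cr': "point_cross (name_point k) (name_point m)" using p(2) point_cross_H_class by blast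
      \<comment> \<open>Pairwise compatibility says nothing about an object paired with itself, so
        the case \<open>B = A\<close> rests on \<open>point_cross_irrefl\<close>.\<close>
      show False
      proof (cases "B = A")
        case True
        then have "H_class (name_point k) = H_class (name_point m)"
          using h_map_named[OF Y(2-4)] h_map_named[OF X(2-4)] X(1) Y(1) by simp
        then have "point_cross (name_point m) (name_point m)" using cr' point_cross_H_class by blast
        then show False using point_cross_irrefl name_point_H_tilde[OF X(3)] by blast
      next
        case False
        then have "compatible_pi u E B A" using pw A(1) B(1) unfolding pairwise_compatible_def by blast
        then show False using compatible_pi_H_class[OF Y(2-4) X(2-4)] cr' X(1) Y(1) by blast
      qed
    qed
    moreover have "?T \<subseteq> H_space" unfolding H_space_def by blast
    ultimately show ?thesis using openin_H_crossing by (intro exI[of _ ?T]) blast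
  qed
  then have "openin H_topology (H_space - h_map u (E pi) ` L)"
    by (subst openin_subopen) blast
  then show ?thesis using sub unfolding closedin_def topspace_H_topology by blast
qed

end

theorem theorem2p5p4:
  fixes u :: "'r::idom"
    and E :: "real \<Rightarrow> ('r farrow \<times> 'r farrow) set"
    and L :: "'r fpobj set"
  assumes "dvr_with_uniformizer u"
    and "residue_char u \<noteq> 2"
    and "\<And>b. 0 < b \<Longrightarrow> b \<le> pi \<Longrightarrow> F_exact_structure u b (E b)"
    and "lamination u E L"
  shows "closedin H_topology (h_map u (E pi) ` L)"
proof -
  interpret frob_family u E
    using assms(1-3) by (intro frob_family.intro dvr.intro frob_family_axioms.intro)
  show ?thesis using assms(4) by (rule closed_lamination)
qed

end
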